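(* Let $\mathcal{A}=L(N)\rtimes_\xi H$ be a Kac algebra of Izumi-Kosaki type, and assume that the finite groups $N$ and $H$ are solvable. Then the number of maximal right coideals of $\mathcal{A}$ is less than $\dim\mathcal{A}$, and the number of minimal right coideals of $\mathcal{A}$ is less than $\dim\mathcal{A}$.
   Context: Let $G=N\rtimes H$ be a semidirect product of finite groups. For $n\in N$, $h\in H$ put $n^h=h^{-1}nh$. $L(N)$ is the algebra of complex valued functions on $N$; for $f\in L(N)$ put $f^h(n)=f(h^{-1}nh)$. Cocycle data: $U(1)$-valued functions $\eta_h(n_1,n_2)$ and $\xi_n(h_1,h_2)$ ($n,n_i\in N$, $h,h_i\in H$) satisfying $\eta_h(n_1,n_2)\eta_h(n_1n_2,n_3)=\eta_h(n_1,n_2n_3)\eta_h(n_2,n_3)$; $\xi_n(h_1h_2,h_3)\xi_n(h_1,h_2)=\xi_n(h_1,h_2h_3)\xi_{n^{h_1}}(h_2,h_3)$; the pentagon equation $\dfrac{\eta_{h_1}(n_1,n_2)\,\eta_{h_2}(n_1^{h_1},n_2^{h_1})}{\eta_{h_1h_2}(n_1,n_2)}=\dfrac{\xi_{n_1n_2}(h_1,h_2)}{\xi_{n_1}(h_1,h_2)\,\xi_{n_2}(h_1,h_2)}$; and the normalizations $\eta_h(e,n_2)=\eta_h(n_1,e)=\xi_n(e,h_2)=\xi_n(h_1,e)=\eta_e(n_1,n_2)=1$. The Kac algebra of Izumi-Kosaki type $\mathcal{A}=L(N)\rtimes_\xi H$ is the Hopf $*$-algebra with underlying space $\bigoplus_{h\in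 H}(L(N),h)$ (so $\dim\mathcal{A}=|N||H|$); for $n\in N$, $(n,h)$ stands for $(\delta_n,h)$. Product: $(f_1,h_1)(f_2,h_2)=(g,h_1h_2)$ with $g(n)=f_1(n)f_2^{h_1}(n)\xi_n(h_1,h_2)$. Coproduct: $\Delta(n,h)=\sum_{n_2\in N}\eta_h(nn_2^{-1},n_2)\,(nn_2^{-1},h)\otimes(n_2,h)$. Involution: $(f,h)^*=\big(\overline{f\,\xi(h,h^{-1})}^{\,h^{-1}},h^{-1}\big)$, where $\xi(h,h^{-1})$ is the function $n\mapsto\xi_n(h,h^{-1})$. The unit is $(1,e)$. A right coideal of $\mathcal{A}$ is a unital $*$-subalgebra $\mathcal{B}\subset\mathcal{A}$ with $\Delta(\mathcal{B})\subset\mathcal{B}\otimes\mathcal{A}$. A right coideal $\mathcal{B}\ne\mathbb{C}1,\mathcal{A}$ is maximal if the only right coideals containing it are $\mathcal{B}$ and $\mathcal{A}$; it is minimal if the only right coideals contained in it are $\mathcal{B}$ and $\mathbb{C}1$. *)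

theory Defs
  imports
    Complex_Main
    "HOL-Algebra.Solvable_Groups"
    "HOL-Library.Function_Algebras"
begin

lemma sum_apply: "(\<Sum>i\<in>I. f i) x = (\<Sum>i\<in>I. f i x)"
  for f :: "'i \<Rightarrow> 'p \<Rightarrow> 'b::comm_monoid_add"
  by (induction I rule: infinite_finite_induct) auto

definition cscale :: "complex \<Rightarrow> ('p \<Rightarrow> complex) \<Rightarrow> 'p \<Rightarrow> complex"
  where "cscale c f = (\<lambda>p. c * f p)"

interpretation cfun: vector_space cscale
  by unfold_locales (auto simp: cscale_def algebra_simps)

text \<open>For finite \<open>P\<close> and \<open>Q\<close>, the tensor product of the function spaces over \<open>P\<close> and \<open>Q\<close> is
  the function space over \<open>P \<times> Q\<close>.\<close>

definition tensor :: "('p \<Rightarrow> complex) \<Rightarrow> ('q \<Rightarrow> complex) \<Rightarrow> 'p \<times> 'q \<Rightarrow> complex"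
  where "tensor a b = (\<lambda>(p, q). a p * b q)"

definition tensor_space ::
    "('p \<Rightarrow> complex) set \<Rightarrow> ('q \<Rightarrow> complex) set \<Rightarrow> ('p \<times> 'q \<Rightarrow> complex) set"
  where "tensor_space U V = cfun.span {tensor u v | u v. u \<in> U \<and> v \<in> V}"

context group
begin

text \<open>The conjugate $n^h$, and $f^h$ for a function \<open>f\<close>.\<close>

definition cj :: "'a \<Rightarrow> 'a \<Rightarrow> 'a"
  where "cj n h = inv h \<otimes> n \<otimes> h"

definition cj_fun :: "('a \<Rightarrow> complex) \<Rightarrow> 'a \<Rightarrow> 'a \<Rightarrow> complex"
  where "cj_fun f h = (\<lambda>n. f (cj n h))"

end

text \<open>\<open>G\<close> is the internal semidirect product of \<open>N\<close> and \<open>H\<close>. The value \<open>\<eta> h n\<^sub>1 n\<^sub>2\<close> is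
  $\eta_h(n_1,n_2)$ and \<open>\<xi> n h\<^sub>1 h\<^sub>2\<close> is $\xi_n(h_1,h_2)$; values at arguments outside of \<open>N\<close>, \<open>H\<close>
  are irrelevant.\<close>

locale izumi_kosaki = group G for G (structure) +
  fixes N H :: "'a set"
    and \<eta> \<xi> :: "'a \<Rightarrow> 'a \<Rightarrow> 'a \<Rightarrow> complex"
  assumes finite_G: "finite (carrier G)"
    and normal_N: "N \<lhd> G"
    and subgroup_H: "subgroup H G"
    and N_inter_H: "N \<inter> H = {\<one>}"
    and N_mult_H: "N <#> H = carrier G"
    and eta_U1: "\<lbrakk>h \<in> H; n1 \<in> N; n2 \<in> N\<rbrakk> \<Longrightarrow> cmod (\<eta> h n1 n2) = 1"
    and xi_U1: "\<lbrakk>n \<in> N; h1 \<in> H; h2 \<in> H\<rbrakk> \<Longrightarrow> cmod (\<xi> n h1 h2) = 1"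
    and eta_cocycle: "\<lbrakk>h \<in> H; n1 \<in> N; n2 \<in> N; n3 \<in> N\<rbrakk> \<Longrightarrow>
          \<eta> h n1 n2 * \<eta> h (n1 \<otimes> n2) n3 = \<eta> h n1 (n2 \<otimes> n3) * \<eta> h n2 n3"
    and xi_cocycle: "\<lbrakk>n \<in> N; h1 \<in> H; h2 \<in> H; h3 \<in> H\<rbrakk> \<Longrightarrow>
          \<xi> n (h1 \<otimes> h2) h3 * \<xi> n h1 h2 = \<xi> n h1 (h2 \<otimes> h3) * \<xi> (cj n h1) h2 h3"
    and pentagon: "\<lbrakk>n1 \<in> N; n2 \<in> N; h1 \<in> H; h2 \<in> H\<rbrakk> \<Longrightarrow>
          \<eta> h1 n1 n2 * \<eta> h2 (cj n1 h1) (cj n2 h1) / \<eta> (h1 \<otimes> h2) n1 n2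
            = \<xi> (n1 \<otimes> n2) h1 h2 / (\<xi> n1 h1 h2 * \<xi> n2 h1 h2)"
    and eta_one_left: "\<lbrakk>h \<in> H; n \<in> N\<rbrakk> \<Longrightarrow> \<eta> h \<one> n = 1"
    and eta_one_right: "\<lbrakk>h \<in> H; n \<in> N\<rbrakk> \<Longrightarrow> \<eta> h n \<one> = 1"
    and xi_one_left: "\<lbrakk>n \<in> N; h \<in> H\<rbrakk> \<Longrightarrow> \<xi> n \<one> h = 1"
    and xi_one_right: "\<lbrakk>n \<in> N; h \<in> H\<rbrakk> \<Longrightarrow> \<xi> n h \<one> = 1"
    and eta_one: "\<lbrakk>n1 \<in> N; n2 \<in> N\<rbrakk> \<Longrightarrow> \<eta> \<one> n1 n2 = 1"
begin

text \<open>An element of $\bigoplus_h (L(N),h)$ is encoded by its coefficient function on \<open>N \<times> H\<close>,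
  extended by zero: the value at \<open>(n, h)\<close> is the coefficient of $(\delta_n,h)$.\<close>

definition alg :: "('a \<times> 'a \<Rightarrow> complex) set"
  where "alg = {a. \<forall>p. p \<notin> N \<times> H \<longrightarrow> a p = 0}"

definition homog :: "('a \<Rightarrow> complex) \<Rightarrow> 'a \<Rightarrow> 'a \<times> 'a \<Rightarrow> complex"
  where "homog f h = (\<lambda>(n, k). if n \<in> N \<and> k = h then f n else 0)"

definition basis_elt :: "'a \<Rightarrow> 'a \<Rightarrow> 'a \<times> 'a \<Rightarrow> complex"
  where "basis_elt n h = homog (\<lambda>m. if m = n then 1 else 0) h"

definition alg_one :: "'a \<times> 'a \<Rightarrow> complex"
  where "alg_one = homog (\<lambda>_. 1) \<one>"

text \<open>The structure maps are the (bi)linear, respectively antilinear, extensions of the formulas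
  on the elements $(f,h)$ and $(\delta_n,h)$.\<close>

definition alg_mult ::
    "('a \<times> 'a \<Rightarrow> complex) \<Rightarrow> ('a \<times> 'a \<Rightarrow> complex) \<Rightarrow> 'a \<times> 'a \<Rightarrow> complex"
  where "alg_mult a b = (\<Sum>h1\<in>H. \<Sum>h2\<in>H.
    homog (\<lambda>n. a (n, h1) * cj_fun (\<lambda>m. b (m, h2)) h1 n * \<xi> n h1 h2) (h1 \<otimes> h2))"

definition alg_star :: "('a \<times> 'a \<Rightarrow> complex) \<Rightarrow> 'a \<times> 'a \<Rightarrow> complex"
  where "alg_star a = (\<Sum>h\<in>H.
    homog (cj_fun (\<lambda>n. cnj (a (n, h) * \<xi> n h (inv h))) (inv h)) (inv h))"

definition comult :: "('a \<times> 'a \<Rightarrow> complex) \<Rightarrow> ('a \<times> 'a) \<times> ('a \<times> 'a) \<Rightarrow> complex"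
  where "comult a = (\<Sum>n\<in>N. \<Sum>h\<in>H. cscale (a (n, h))
    (\<Sum>n2\<in>N. cscale (\<eta> h (n \<otimes> inv n2) n2)
      (tensor (basis_elt (n \<otimes> inv n2) h) (basis_elt n2 h))))"

definition right_coideal :: "('a \<times> 'a \<Rightarrow> complex) set \<Rightarrow> bool"
  where "right_coideal B \<longleftrightarrow>
    B \<subseteq> alg \<and> cfun.subspace B \<and> alg_one \<in> B \<and>
    (\<forall>a\<in>B. \<forall>b\<in>B. alg_mult a b \<in> B) \<and>
    (\<forall>a\<in>B. alg_star a \<in> B) \<and>
    comult ` B \<subseteq> tensor_space B alg"

definition maximal_right_coideal :: "('a \<times> 'a \<Rightarrow> complex) set \<Rightarrow> bool"
  where "maximal_right_coideal B \<longleftrightarrow>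
    right_coideal B \<and> B \<noteq> cfun.span {alg_one} \<and> B \<noteq> alg \<and>
    (\<forall>C. right_coideal C \<and> B \<subseteq> C \<longrightarrow> C = B \<or> C = alg)"

definition minimal_right_coideal :: "('a \<times> 'a \<Rightarrow> complex) set \<Rightarrow> bool"
  where "minimal_right_coideal B \<longleftrightarrow>
    right_coideal B \<and> B \<noteq> cfun.span {alg_one} \<and> B \<noteq> alg \<and>
    (\<forall>C. right_coideal C \<and> C \<subseteq> B \<longrightarrow> C = B \<or> C = cfun.span {alg_one})"

lemma finite_N: "finite N"
  using finite_subset[OF _ finite_G] normal_N normal_imp_subgroup subgroup.subset by blast

lemma finite_H: "finite H"
  using finite_subset[OF _ finite_G] subgroup_H subgroup.subset by blast

lemma cj_closed: assumes "n \<in> N" "h \<in> H" shows "cj n h \<in> N"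
  unfolding cj_def using assms normal_N subgroup.mem_carrier[OF subgroup_H]
  by (simp add: normal.inv_op_closed1)

text \<open>The structure maps satisfy the formulas that determine them.\<close>

lemma alg_mult_homog:
  assumes "h1 \<in> H" "h2 \<in> H"
  shows "alg_mult (homog f1 h1) (homog f2 h2) =
    homog (\<lambda>n. f1 n * cj_fun f2 h1 n * \<xi> n h1 h2) (h1 \<otimes> h2)"
proof
  fix p :: "'a \<times> 'a"
  obtain n k where p: "p = (n, k)" by fastforce
  have "alg_mult (homog f1 h1) (homog f2 h2) p = (\<Sum>k1\<in>H. \<Sum>k2\<in>H. if k1 = h1 \<and> k2 = h2 then
      homog (\<lambda>n. f1 n * cj_fun f2 h1 n * \<xi> n h1 h2) (h1 \<otimes> h2) p else 0)"
    unfolding alg_mult_def sum_apply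
    by (intro sum.cong refl) (auto simp: homog_def cj_fun_def p cj_closed)
  also have "\<dots> = (\<Sum>k1\<in>H. if k1 = h1 then
      homog (\<lambda>n. f1 n * cj_fun f2 h1 n * \<xi> n h1 h2) (h1 \<otimes> h2) p else 0)"
    using finite_H assms by (intro sum.cong refl) (auto simp: sum.delta)
  also have "\<dots> = homog (\<lambda>n. f1 n * cj_fun f2 h1 n * \<xi> n h1 h2) (h1 \<otimes> h2) p"
    using finite_H assms by (simp add: sum.delta)
  finally show "alg_mult (homog f1 h1) (homog f2 h2) p = \<dots>" .
qed

lemma alg_star_homog:
  assumes "h \<in> H"
  shows "alg_star (homog f h) = homog (cj_fun (\<lambda>n. cnj (f n * \<xi> n h (inv h))) (inv h)) (inv h)"
proof
  fix p :: "'a \<times> 'a"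
  have "alg_star (homog f h) p = (\<Sum>k\<in>H. if k = h then
      homog (cj_fun (\<lambda>n. cnj (f n * \<xi> n h (inv h))) (inv h)) (inv h) p else 0)"
    unfolding alg_star_def sum_apply
    by (intro sum.cong refl)
      (auto simp: homog_def cj_fun_def cj_closed subgroup.m_inv_closed[OF subgroup_H] split: prod.split)
  then show "alg_star (homog f h) p =
      homog (cj_fun (\<lambda>n. cnj (f n * \<xi> n h (inv h))) (inv h)) (inv h) p"
    using finite_H assms by (simp add: sum.delta)
qed

lemma comult_basis_elt:
  assumes "n \<in> N" "h \<in> H"
  shows "comult (basis_elt n h) = (\<Sum>n2\<in>N. cscale (\<eta> h (n \<otimes> inv n2) n2)
      (tensor (basis_elt (n \<otimes> inv n2) h) (basis_elt n2 h)))" (is "_ = ?R n h")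
proof
  fix p
  have "comult (basis_elt n h) p = (\<Sum>m\<in>N. \<Sum>k\<in>H. if m = n \<and> k = h then ?R n h p else 0)"
    unfolding comult_def sum_apply
    by (intro sum.cong refl) (auto simp: basis_elt_def homog_def cscale_def sum_apply)
  also have "\<dots> = (\<Sum>m\<in>N. if m = n then ?R n h p else 0)"
    using finite_H assms by (intro sum.cong refl) (auto simp: sum.delta)
  finally show "comult (basis_elt n h) p = ?R n h p"
    using finite_N assms by (simp add: sum.delta)
qed

lemma basis_elt_eq: "n \<in> N \<Longrightarrow> basis_elt n h = (\<lambda>p. if p = (n, h) then 1 else 0)"
  by (auto simp: basis_elt_def homog_def fun_eq_iff)

lemma dim_alg: "cfun.dim alg = card N * card H"
proof -
  let ?e = "\<lambda>(n, h). basis_elt n h" and ?P = "N \<times> H"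
  have e: "?e p = (\<lambda>q. if q = p then 1 else 0)" if "p \<in> ?P" for p
    using that by (auto simp: basis_elt_eq)
  have inj: "inj_on ?e ?P"
    by (rule inj_onI) (metis (no_types, lifting) e zero_neq_one)
  have fin: "finite ?P" using finite_N finite_H by simp
  have ex: "a = (\<Sum>p\<in>?P. cscale (a p) (?e p))" if "a \<in> alg" for a
  proof
    fix q
    have "(\<Sum>p\<in>?P. cscale (a p) (?e p)) q = (\<Sum>p\<in>?P. if q = p then a p else 0)"
      unfolding sum_apply by (intro sum.cong refl) (simp add: e cscale_def del: split_paired_All)
    also have "\<dots> = (if q \<in> ?P then a q else 0)"
      using fin by (simp add: sum.delta')
    also have "\<dots> = a q" using that unfolding alg_def by (cases q) auto
    finally show "a q = (\<Sum>p\<in>?P. cscale (a p) (?e p)) q" by simp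
  qed
  have "cfun.independent (?e ` ?P)"
  proof (rule cfun.independent_if_scalars_zero)
    show "finite (?e ` ?P)" using fin by blast
    fix f x assume 0: "(\<Sum>x\<in>?e ` ?P. cscale (f x) x) = 0" and "x \<in> ?e ` ?P"
    then obtain q where q: "q \<in> ?P" "x = ?e q" by blast
    have "0 = (\<Sum>p\<in>?P. cscale (f (?e p)) (?e p)) q"
      using 0 by (simp only: sum.reindex[OF inj] o_def) simp
    also have "\<dots> = (\<Sum>p\<in>?P. if q = p then f (?e p) else 0)"
      unfolding sum_apply by (intro sum.cong refl) (simp add: e cscale_def del: split_paired_All)
    also have "\<dots> = f (?e q)" using fin q by (simp add: sum.delta')
    finally show "f x = 0" using q by simp
  qed
  moreover have "?e ` ?P \<subseteq> alg" using e by (fastforce simp: alg_def)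
  moreover have "alg \<subseteq> cfun.span (?e ` ?P)"
  proof
    fix a assume "a \<in> alg"
    show "a \<in> cfun.span (?e ` ?P)"
      by (subst ex[OF \<open>a \<in> alg\<close>]) (intro cfun.span_sum cfun.span_scale cfun.span_base imageI)
  qed
  ultimately have "cfun.dim alg = card (?e ` ?P)"
    by (intro cfun.dim_unique) auto
  also have "\<dots> = card ?P" using inj by (rule card_image)
  finally show ?thesis by (simp add: card_cartesian_product)
qed

end

end

theory Submission
  imports Defs "HOL-Algebra.Zassenhaus" "HOL-Algebra.SndIsomorphismGrp" "HOL-Library.Indicator_Function"
begin

text \<open>A right coideal is graded by \<open>H\<close>, and it is determined by a triple \<open>(M, K, l)\<close>: the support \<open>K\<close>
  of the grading is a subgroup of \<open>H\<close>, the component of degree \<open>\<one>\<close> consists of the functions on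
  the cosets of a \<open>K\<close>-invariant subgroup \<open>M\<close> of \<open>N\<close>, and \<open>l\<close> is a family of twisted characters of
  \<open>M\<close>, indexed by \<open>K\<close>, any two of which differ by a 1-cocycle of \<open>K\<close> in the group of linear
  characters of \<open>M\<close>. A maximal right coideal has either \<open>M\<close> trivial and \<open>K\<close> a maximal subgroup of
  \<open>H\<close>, or \<open>K = H\<close> and \<open>M\<close> a minimal \<open>H\<close>-invariant subgroup of \<open>N\<close>; a minimal one has either \<open>K\<close>
  trivial and \<open>M\<close> a maximal subgroup of \<open>N\<close>, or \<open>M = N\<close> and \<open>K\<close> a minimal subgroup of \<open>H\<close>.

  Two bounds enter. A solvable group of order \<open>n\<close> has fewer than \<open>n\<close> maximal subgroups (Wall), and a
  solvable group \<open>H\<close> has at most \<open>(|V| - 1) |H|\<close> cocycles in a nontrivial irreducible module \<open>V\<close>. The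
  second applies to the characters of a minimal \<open>M\<close>, and the first follows from it by induction
  along a chief series, since the complements of a minimal normal abelian subgroup \<open>B\<close> form a
  family of cocycles in \<open>B\<close>. The different \<open>M\<close> meet trivially, so at most
  \<open>(|H| - 1) + (|N| - 1) |H| = |N| |H| - 1\<close> maximal right coideals arise; minimal ones are similar,
  as \<open>N\<close> has at most \<open>|N|\<close> linear characters.\<close>

text \<open>Both theorems end at |N| |H| - 1, so a bound |V| |H| for cocycles would be too weak: the
  count of maximal subgroups telescopes to a strict inequality only if complements of a minimal
  normal B number at most (|B| - 1) |G| / |B|. Gaining that one unit is the point of the cocycle
  estimate, and it comes from comparing the index of the kernel of the action with 2. Quotients are
  kept out of the way. Cocycles, homomorphisms and maximal subgroups are counted relative to a
  normal subgroup K, and |K| stands as a factor on the smaller side of each bound, so that a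
  statement about a quotient by K is proved with elements of the group itself. Classically an
  irreducible module is a vector space over its endomorphism field, and cohomology vanishes by a
  coprimality or fixed point argument. Here neither fields nor cohomology groups occur: everything
  is counting of fibres, with irreducibility used only to say that a nonzero invariant subgroup is
  everything. Likewise duality for characters is reduced to one orthogonality computation. That a
  right coideal is graded is obtained by evaluating the second leg of the coproduct at a basis
  point.\<close>

lemma card_le_mult_fibers:
  assumes "finite S" "finite T" "f ` S \<subseteq> T"
    and "\<And>s. s \<in> S \<Longrightarrow> card {x \<in> S. f x = f s} \<le> m"
  shows "card S \<le> card T * m"
proof -
  have "card S = (\<Sum>t\<in>f ` S. card {x \<in> S. f x = t})"
    using sum.image_gen[OF assms(1), of "\<lambda>_. 1::nat" f] by simp
  also have "\<dots> \<le> (\<Sum>t\<in>f ` S. m)" using assms(4) by (intro sum_mono) auto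
  also have "\<dots> \<le> card T * m" using card_mono[OF assms(2,3)] by simp
  finally show ?thesis .
qed

lemma (in group_hom) card_image_mult_card_kernel:
  assumes "subgroup X G" "finite X"
  shows "card (h ` X) * card {x \<in> X. h x = \<one>\<^bsub>H\<^esub>} = card X"
proof -
  have fib: "card {x \<in> X. h x = h s} = card {x \<in> X. h x = \<one>\<^bsub>H\<^esub>}" if "s \<in> X" for s
  proof (rule bij_betw_same_card[of "\<lambda>x. inv s \<otimes> x"], rule bij_betw_byWitness[where f' = "\<lambda>x. s \<otimes> x"])
    note [simp] = subgroup.mem_carrier[OF assms(1)] subgroup.m_closed[OF assms(1)]
      subgroup.m_inv_closed[OF assms(1)]
    show "\<forall>a\<in>{x \<in> X. h x = h s}. s \<otimes> (inv s \<otimes> a) = a"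
      using that by (simp add: G.m_assoc[symmetric])
    show "\<forall>a'\<in>{x \<in> X. h x = \<one>\<^bsub>H\<^esub>}. inv s \<otimes> (s \<otimes> a') = a'"
      using that by (simp add: G.m_assoc[symmetric])
    show "(\<otimes>) (inv s) ` {x \<in> X. h x = h s} \<subseteq> {x \<in> X. h x = \<one>\<^bsub>H\<^esub>}" using that by auto
    show "(\<otimes>) s ` {x \<in> X. h x = \<one>\<^bsub>H\<^esub>} \<subseteq> {x \<in> X. h x = h s}" using that by auto
  qed
  have "card X = (\<Sum>t\<in>h ` X. card {x \<in> X. h x = t})"
    using sum.image_gen[OF assms(2), of "\<lambda>_. 1::nat" h] by simp
  also have "\<dots> = (\<Sum>t\<in>h ` X. card {x \<in> X. h x = \<one>\<^bsub>H\<^esub>})"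
    using fib by (intro sum.cong refl) auto
  finally show ?thesis by simp
qed

text \<open>If the \<open>\<tau> i\<close> are \<open>x \<mapsto> i x - x\<close> for a commuting family of operators, the compatible families
  are the cocycles. A non-injective \<open>\<tau> b \<noteq> 0\<close> splits \<open>X\<close> into its image and its kernel, on both
  of which the hypotheses are inherited.\<close>

lemma (in comm_group) card_compatible_families_le:
  fixes \<tau> :: "'i \<Rightarrow> 'a \<Rightarrow> 'a"
  assumes fin: "finite (carrier G)" "finite I"
    and hom: "\<And>i. i \<in> I \<Longrightarrow> \<tau> i \<in> hom G G"
    and comm: "\<And>i j x. \<lbrakk>i \<in> I; j \<in> I; x \<in> carrier G\<rbrakk> \<Longrightarrow> \<tau> i (\<tau> j x) = \<tau> j (\<tau> i x)"
    and "subgroup X G"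
    and "\<And>i x. \<lbrakk>i \<in> I; x \<in> X\<rbrakk> \<Longrightarrow> \<tau> i x \<in> X"
    and "\<And>x. \<lbrakk>x \<in> X; \<And>i. i \<in> I \<Longrightarrow> \<tau> i x = \<one>\<rbrakk> \<Longrightarrow> x = \<one>"
  shows "card {d \<in> I \<rightarrow>\<^sub>E X. \<forall>i\<in>I. \<forall>j\<in>I. \<tau> i (d j) = \<tau> j (d i)} \<le> card X"
  using assms(5-)
proof (induction "card X" arbitrary: X rule: less_induct)
  case less
  let ?D = "\<lambda>X. {d \<in> I \<rightarrow>\<^sub>E X. \<forall>i\<in>I. \<forall>j\<in>I. \<tau> i (d j) = \<tau> j (d i)}"
  note X = less.prems(1)
  have X_sub: "X \<subseteq> carrier G" using X by (rule subgroup.subset)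
  have finX: "finite X" using X_sub fin(1) finite_subset by blast
  have finD: "finite (?D Y)" if "finite Y" for Y
    by (rule finite_subset[OF _ finite_PiE[OF fin(2) that]]) blast
  have gh: "group_hom G G (\<tau> i)" if "i \<in> I" for i
    using hom[OF that] by unfold_locales
  show ?case
  proof (cases "\<forall>b\<in>I. \<forall>x\<in>X. \<tau> b x = \<one>")
    case True
    \<comment> \<open>If every operator kills X, the absence of a common kernel makes X trivial, and
      only the constant family remains.\<close>
    have "x = \<one>" if "x \<in> X" for x by (rule less.prems(3)[OF that]) (use True that in blast)
    then have X1: "X = {\<one>}" using subgroup.one_closed[OF X] by blast
    then have "I \<rightarrow>\<^sub>E X = {\<lambda>i\<in>I. \<one>}" 
      by (auto simp: PiE_iff fun_eq_iff extensional_def)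
    then have "?D X \<subseteq> {\<lambda>i\<in>I. \<one>}" by blast
    then have "card (?D X) \<le> card {\<lambda>i\<in>I. \<one>}" by (rule card_mono[rotated]) simp
    then show ?thesis using X1 by simp
  next
    case False
    then obtain b x0 where b: "b \<in> I" "x0 \<in> X" "\<tau> b x0 \<noteq> \<one>" by blast
    interpret b: group_hom G G "\<tau> b" using gh[OF b(1)] .
    define Z where "Z = {x \<in> X. \<tau> b x = \<one>}"
    define Y where "Y = \<tau> b ` X"
    have YZ: "card Y * card Z = card X"
      unfolding Y_def Z_def using b.card_image_mult_card_kernel[OF X finX] .
    have oneX: "\<one> \<in> X" using subgroup.one_closed[OF X] .
    have Z: "subgroup Z G"
      unfolding Z_def using X X_sub
      by (auto intro!: subgroup.intro simp: subgroup.m_closed subgroup.m_inv_closed subgroup.one_closed subset_iff)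
    have Y: "subgroup Y G" unfolding Y_def using b.subgroup_img_is_subgroup[OF X] .
    have "Z \<subset> X" using b unfolding Z_def by blast
    then have cZ: "card Z < card X" using finX psubset_card_mono by blast
    have YX: "Y \<subseteq> X" unfolding Y_def using less.prems(2) b(1) by auto
    show ?thesis
    proof (cases "card Y = card X")
      case True
      then have "inj_on (\<tau> b) X" unfolding Y_def using finX eq_card_imp_inj_on by auto
      \<comment> \<open>An injective \<tau> b leaves no freedom beyond \<open>d b\<close>:
        compatibility gives \<open>\<tau> b (d i) = \<tau> i (d b)\<close>, which fixes
        \<open>d i\<close>.\<close>
      then have "inj_on (\<lambda>d. d b) (?D X)"
      proof (intro inj_onI)
        fix d d' assume inj: "inj_on (\<tau> b) X" and d: "d \<in> ?D X" and d': "d' \<in> ?D X" and eq: "d b = d' b"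
        have "d i = d' i" if i: "i \<in> I" for i
        proof -
          have "\<tau> b (d i) = \<tau> b (d' i)" using d d' i b(1) eq by (metis (mono_tags, lifting) mem_Collect_eq)
          then show ?thesis using inj d d' i by (auto dest!: inj_onD)
        qed
        then show "d = d'" using d d' by (auto intro: PiE_ext)
      qed
      then show ?thesis
        by (rule card_inj_on_le) (use b(1) finX in auto)
    next
      case False
      have cY: "card Y < card X" using False card_mono[OF finX YX] by simp
      have IY: "card (?D Y) \<le> card Y"
      proof (rule less.hyps[OF cY Y])
        show "\<tau> i x \<in> Y" if "i \<in> I" "x \<in> Y" for i x
          using that comm[OF _ b(1)] less.prems(2) X_sub unfolding Y_def by (auto simp: subset_iff)
        show "x = \<one>" if "x \<in> Y" "\<And>i. i \<in> I \<Longrightarrow> \<tau> i x = \<one>" for x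
          using that YX less.prems(3) by blast
      qed
      have IZ: "card (?D Z) \<le> card Z"
      proof (rule less.hyps[OF cZ Z])
        show "\<tau> i x \<in> Z" if i: "i \<in> I" and x: "x \<in> Z" for i x
        proof -
          interpret i: group_hom G G "\<tau> i" using gh[OF i] .
          have "\<tau> b (\<tau> i x) = \<tau> i (\<tau> b x)" using comm[OF b(1) i] x X_sub unfolding Z_def by blast
          then show ?thesis using i x less.prems(2) unfolding Z_def by simp
        qed
        show "x = \<one>" if "x \<in> Z" "\<And>i. i \<in> I \<Longrightarrow> \<tau> i x = \<one>" for x
          using that less.prems(3) unfolding Z_def by blast
      qed
      \<comment> \<open>Composing with \<tau> b maps compatible families into \<open>Y\<close>; two
        families with the same composite differ by a compatible family in \<open>Z\<close>. Both
        counts come from the induction, and |Y| |Z| = |X|.\<close>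
      have "card (?D X) \<le> card (?D Y) * card Z"
      proof (rule card_le_mult_fibers[where f = "\<lambda>d. \<lambda>i\<in>I. \<tau> b (d i)"])
        show "finite (?D X)" using finD[OF finX] .
        show "finite (?D Y)" using finD[OF finite_subset[OF YX finX]] .
        show "(\<lambda>d. \<lambda>i\<in>I. \<tau> b (d i)) ` ?D X \<subseteq> ?D Y"
        proof (intro image_subsetI CollectI conjI ballI)
          fix d assume d: "d \<in> ?D X"
          show "(\<lambda>i\<in>I. \<tau> b (d i)) \<in> I \<rightarrow>\<^sub>E Y" using d unfolding Y_def by auto
          fix i j assume ij: "i \<in> I" "j \<in> I"
          then have "d i \<in> carrier G" "d j \<in> carrier G" using d X_sub by (auto simp: PiE_def Pi_def)
          then have "\<tau> i (\<tau> b (d j)) = \<tau> b (\<tau> i (d j))" "\<tau> j (\<tau> b (d i)) = \<tau> b (\<tau> j (d i))"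
            using ij b(1) comm by auto
          then show "\<tau> i ((\<lambda>i\<in>I. \<tau> b (d i)) j) = \<tau> j ((\<lambda>i\<in>I. \<tau> b (d i)) i)" using d ij by auto
        qed
        fix d0 assume d0: "d0 \<in> ?D X"
        have d0c: "d0 i \<in> X" "d0 i \<in> carrier G" if "i \<in> I" for i using d0 that X_sub by (auto simp: PiE_def Pi_def)
        let ?F = "{d \<in> ?D X. (\<lambda>i\<in>I. \<tau> b (d i)) = (\<lambda>i\<in>I. \<tau> b (d0 i))}"
        have "card ?F \<le> card (?D Z)"
        proof (rule card_inj_on_le[where f = "\<lambda>d. \<lambda>i\<in>I. d i \<otimes> inv (d0 i)"])
          show "finite (?D Z)" using finD[of Z] finX unfolding Z_def by auto
          show "inj_on (\<lambda>d. \<lambda>i\<in>I. d i \<otimes> inv (d0 i)) ?F"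
          proof (intro inj_onI)
            fix d d' assume d: "d \<in> ?F" and d': "d' \<in> ?F"
              and eq: "(\<lambda>i\<in>I. d i \<otimes> inv (d0 i)) = (\<lambda>i\<in>I. d' i \<otimes> inv (d0 i))"
            have "d i = d' i" if i: "i \<in> I" for i
            proof -
              have "d i \<otimes> inv (d0 i) = d' i \<otimes> inv (d0 i)" using fun_cong[OF eq, of i] i by simp
              moreover have "d i \<in> carrier G" "d' i \<in> carrier G"
                using d d' i X_sub by (auto simp: PiE_def Pi_def)
              ultimately show ?thesis using d0c[OF i] by simp
            qed
            then show "d = d'" using d d' by (auto intro: PiE_ext)
          qed
          show "(\<lambda>d. \<lambda>i\<in>I. d i \<otimes> inv (d0 i)) ` ?F \<subseteq> ?D Z"
          proof (intro image_subsetI CollectI conjI ballI)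
            fix d assume d: "d \<in> ?F"
            have dc: "d i \<in> X" "d i \<in> carrier G" if "i \<in> I" for i using d that X_sub by (auto simp: PiE_def Pi_def)
            have db: "\<tau> b (d i) = \<tau> b (d0 i)" if "i \<in> I" for i using d that by (auto dest: fun_cong[of _ _ i])
            show "(\<lambda>i\<in>I. d i \<otimes> inv (d0 i)) \<in> I \<rightarrow>\<^sub>E Z"
              using dc d0c db X by (auto simp: Z_def subgroup.m_closed subgroup.m_inv_closed)
            fix i j assume ij: "i \<in> I" "j \<in> I"
            interpret i: group_hom G G "\<tau> i" using gh[OF ij(1)] .
            interpret j: group_hom G G "\<tau> j" using gh[OF ij(2)] .
            show "\<tau> i ((\<lambda>i\<in>I. d i \<otimes> inv (d0 i)) j) = \<tau> j ((\<lambda>i\<in>I. d i \<otimes> inv (d0 i)) i)"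
              using d d0 ij dc d0c by simp
          qed
        qed
        then show "card ?F \<le> card Z" using IZ by linarith
      qed
      also have "\<dots> \<le> card Y * card Z" using IY by simp
      finally show ?thesis using YZ by simp
    qed
  qed
qed

section \<open>Cocycles with values in an irreducible module\<close>

text \<open>The witness is the last term of the derived series not contained in \<open>C\<close>:
  its commutators lie in the next term, hence in \<open>C\<close>. It stands for a nontrivial
  abelian normal subgroup of the quotient by \<open>C\<close>, but consists of elements of
  G.\<close>

lemma (in group) solvable_imp_normal_abelian_mod:
  assumes "solvable G" "C \<lhd> G" "C \<noteq> carrier G"
  obtains A where "A \<lhd> G" "\<not> A \<subseteq> C"
    "\<And>x y. \<lbrakk>x \<in> A; y \<in> A\<rbrakk> \<Longrightarrow> x \<otimes> y \<otimes> inv x \<otimes> inv y \<in> C"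
proof -
  let ?D = "\<lambda>n. (derived G ^^ n) (carrier G)"
  have normal: "?D n \<lhd> G" for n
    by (induction n) (auto simp: normal_self derived_is_normal)
  obtain n where "?D n = {\<one>}" using assms(1) solvable_iff_trivial_derived_seq by blast
  then have "?D n \<subseteq> C" using subgroup.one_closed[OF normal_imp_subgroup[OF assms(2)]] by simp
  moreover have "\<not> ?D 0 \<subseteq> C"
    using assms(2,3) subgroup.subset[OF normal_imp_subgroup[OF assms(2)]] by auto
  ultimately have "\<exists>m. \<not> ?D m \<subseteq> C \<and> ?D (Suc m) \<subseteq> C"
    using ex_least_nat_less[of "\<lambda>n. ?D n \<subseteq> C" n] by blast
  then obtain m where m: "\<not> ?D m \<subseteq> C" "?D (Suc m) \<subseteq> C" by blast
  show thesis
  proof (rule that[OF normal m(1)])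
    fix x y assume "x \<in> ?D m" "y \<in> ?D m"
    then have "x \<otimes> y \<otimes> inv x \<otimes> inv y \<in> derived G (?D m)"
      unfolding derived_def by (intro generate.incl) blast
    then show "x \<otimes> y \<otimes> inv x \<otimes> inv y \<in> C" using m(2) by auto
  qed
qed

text \<open>Turns the identity z(a) + a.z(b) = z(b) + b.z(a), valid for a cocycle with z(ab) =
  z(ba), into the compatibility of the operators v |-> a.v - v required by
  \<open>card_compatible_families_le\<close>.\<close>

lemma (in comm_group) mult_inv_eq_mult_inv:
  assumes "x \<otimes> p = y \<otimes> q" "x \<in> carrier G" "y \<in> carrier G" "p \<in> carrier G" "q \<in> carrier G"
  shows "p \<otimes> inv y = q \<otimes> inv x"
proof -
  have "p \<otimes> inv y = inv x \<otimes> (x \<otimes> p) \<otimes> inv y" using assms(2-) by (simp add: m_assoc[symmetric])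
  also have "\<dots> = inv x \<otimes> (y \<otimes> q) \<otimes> inv y" using assms(1) by simp
  also have "y \<otimes> q = q \<otimes> y" using assms(2-) by (simp add: m_comm)
  also have "inv x \<otimes> (q \<otimes> y) \<otimes> inv y = inv x \<otimes> q" using assms(2-) by (simp add: m_assoc)
  also have "\<dots> = q \<otimes> inv x" using assms(2-) by (simp add: m_comm)
  finally show ?thesis .
qed

lemma (in comm_group) inj_on_divide_by_family:
  assumes "f0 \<in> I \<rightarrow> carrier G"
  shows "inj_on (\<lambda>f. \<lambda>i\<in>I. f i \<otimes> inv (f0 i)) (I \<rightarrow>\<^sub>E carrier G)"
proof (rule inj_onI)
  fix f g assume f: "f \<in> I \<rightarrow>\<^sub>E carrier G" and g: "g \<in> I \<rightarrow>\<^sub>E carrier G"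
    and eq: "(\<lambda>i\<in>I. f i \<otimes> inv (f0 i)) = (\<lambda>i\<in>I. g i \<otimes> inv (f0 i))"
  show "f = g"
  proof (rule PiE_ext[OF f g])
    fix i assume i: "i \<in> I"
    have "f i \<otimes> inv (f0 i) = g i \<otimes> inv (f0 i)" using fun_cong[OF eq, of i] i by simp
    moreover have "f i \<in> carrier G" "g i \<in> carrier G" "f0 i \<in> carrier G"
      using f g assms i by auto
    ultimately show "f i = g i" by simp
  qed
qed

locale finite_module = H: group H + V: comm_group V
  for H :: "('h, 'm) monoid_scheme" (structure) and V :: "('v, 'n) monoid_scheme" (structure) +
  fixes act :: "'h \<Rightarrow> 'v \<Rightarrow> 'v"
  assumes finite_H: "finite (carrier H)" and finite_V: "finite (carrier V)"
    and act_closed [simp]: "\<lbrakk>h \<in> carrier H; v \<in> carrier V\<rbrakk> \<Longrightarrow> act h v \<in> carrier V"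
    and act_mult [simp]: "\<lbrakk>h \<in> carrier H; v \<in> carrier V; w \<in> carrier V\<rbrakk> \<Longrightarrow>
      act h (v \<otimes>\<^bsub>V\<^esub> w) = act h v \<otimes>\<^bsub>V\<^esub> act h w"
    and act_comp: "\<lbrakk>h \<in> carrier H; k \<in> carrier H; v \<in> carrier V\<rbrakk> \<Longrightarrow>
      act (h \<otimes> k) v = act h (act k v)"
    and act_id [simp]: "v \<in> carrier V \<Longrightarrow> act \<one> v = v"
begin

text \<open>The zero module qualifies; nontriviality is a separate hypothesis of
  \<open>card_cocycles_le\<close>. For character groups irreducibility is established before it is
  known whether there are nontrivial characters.\<close>

definition irreducible_module :: bool
  where "irreducible_module \<longleftrightarrow> (\<forall>X. subgroup X V \<longrightarrow> (\<forall>h\<in>carrier H. \<forall>x\<in>X. act h x \<in> X) \<longrightarrow>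
    X = {\<one>\<^bsub>V\<^esub>} \<or> X = carrier V)"

text \<open>Crossed homomorphisms from H to V. The set K makes the notion relative: if K is a normal
  subgroup acting trivially, these are the cocycles of the quotient by K, inflated to H.\<close>

definition cocycles :: "'h set \<Rightarrow> ('h \<Rightarrow> 'v) set"
  where "cocycles K = {z \<in> carrier H \<rightarrow>\<^sub>E carrier V.
    (\<forall>g\<in>carrier H. \<forall>h\<in>carrier H. z (g \<otimes> h) = z g \<otimes>\<^bsub>V\<^esub> act g (z h)) \<and> (\<forall>k\<in>K. z k = \<one>\<^bsub>V\<^esub>)}"

text \<open>For normal subgroups K \<le> C of H these are the H-equivariant homomorphisms from C/K
  to V. Restrictions of cocycles to the kernel of the action have this form.\<close>

definition equivariant_homs :: "'h set \<Rightarrow> 'h set \<Rightarrow> ('h \<Rightarrow> 'v) set"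
  where "equivariant_homs C K = {f \<in> C \<rightarrow>\<^sub>E carrier V.
    (\<forall>c\<in>C. \<forall>d\<in>C. f (c \<otimes> d) = f c \<otimes>\<^bsub>V\<^esub> f d) \<and>
    (\<forall>h\<in>carrier H. \<forall>c\<in>C. f (h \<otimes> c \<otimes> inv h) = act h (f c)) \<and> (\<forall>k\<in>K. f k = \<one>\<^bsub>V\<^esub>)}"

definition acts_trivially :: "'h set"
  where "acts_trivially = {h \<in> carrier H. \<forall>v\<in>carrier V. act h v = v}"

lemma act_hom: "h \<in> carrier H \<Longrightarrow> group_hom V V (act h)"
  by unfold_locales (auto simp: hom_def)

lemma act_one [simp]: "h \<in> carrier H \<Longrightarrow> act h \<one>\<^bsub>V\<^esub> = \<one>\<^bsub>V\<^esub>"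
  using group_hom.hom_one[OF act_hom] .

lemma act_inv [simp]:
  "\<lbrakk>h \<in> carrier H; v \<in> carrier V\<rbrakk> \<Longrightarrow> act h (inv\<^bsub>V\<^esub> v) = inv\<^bsub>V\<^esub> (act h v)"
  using group_hom.hom_inv[OF act_hom] .

lemma act_inv_cancel [simp]:
  "\<lbrakk>h \<in> carrier H; v \<in> carrier V\<rbrakk> \<Longrightarrow> act (inv h) (act h v) = v"
  "\<lbrakk>h \<in> carrier H; v \<in> carrier V\<rbrakk> \<Longrightarrow> act h (act (inv h) v) = v"
  using act_comp[of "inv h" h v] act_comp[of h "inv h" v] by simp_all

lemma irreducible_moduleD:
  "\<lbrakk>irreducible_module; subgroup X V; \<And>h x. \<lbrakk>h \<in> carrier H; x \<in> X\<rbrakk> \<Longrightarrow> act h x \<in> X;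
    x \<in> X; x \<noteq> \<one>\<^bsub>V\<^esub>\<rbrakk> \<Longrightarrow> X = carrier V"
  unfolding irreducible_module_def by blast

lemma cocycles_iff:
  "z \<in> cocycles K \<longleftrightarrow> z \<in> carrier H \<rightarrow>\<^sub>E carrier V \<and>
    (\<forall>g\<in>carrier H. \<forall>h\<in>carrier H. z (g \<otimes> h) = z g \<otimes>\<^bsub>V\<^esub> act g (z h)) \<and> (\<forall>k\<in>K. z k = \<one>\<^bsub>V\<^esub>)"
  unfolding cocycles_def by blast

lemma cocycle_closed: "\<lbrakk>z \<in> cocycles K; h \<in> carrier H\<rbrakk> \<Longrightarrow> z h \<in> carrier V"
  unfolding cocycles_iff by auto

lemma cocycle_mult:
  "\<lbrakk>z \<in> cocycles K; g \<in> carrier H; h \<in> carrier H\<rbrakk> \<Longrightarrow> z (g \<otimes> h) = z g \<otimes>\<^bsub>V\<^esub> act g (z h)"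
  unfolding cocycles_iff by blast

lemma cocycle_vanish: "\<lbrakk>z \<in> cocycles K; k \<in> K\<rbrakk> \<Longrightarrow> z k = \<one>\<^bsub>V\<^esub>"
  unfolding cocycles_iff by blast

lemma equivariant_homs_iff:
  "f \<in> equivariant_homs C K \<longleftrightarrow> f \<in> C \<rightarrow>\<^sub>E carrier V \<and>
    (\<forall>c\<in>C. \<forall>d\<in>C. f (c \<otimes> d) = f c \<otimes>\<^bsub>V\<^esub> f d) \<and>
    (\<forall>h\<in>carrier H. \<forall>c\<in>C. f (h \<otimes> c \<otimes> inv h) = act h (f c)) \<and> (\<forall>k\<in>K. f k = \<one>\<^bsub>V\<^esub>)"
  unfolding equivariant_homs_def by blast

lemma finite_cocycles: "finite (cocycles K)"
  unfolding cocycles_def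
  by (rule finite_subset[OF _ finite_PiE[OF finite_H finite_V]]) blast

lemma finite_equivariant_homs:
  assumes "C \<subseteq> carrier H"
  shows "finite (equivariant_homs C K)"
  unfolding equivariant_homs_def
  by (rule finite_subset[OF _ finite_PiE[OF finite_subset[OF assms finite_H] finite_V]]) blast

lemma cocycles_divide:
  assumes "z \<in> cocycles K" "z0 \<in> cocycles K'"
    and "C \<subseteq> carrier H" "\<And>c. c \<in> C \<Longrightarrow> z c = z0 c"
  shows "(\<lambda>h\<in>carrier H. z h \<otimes>\<^bsub>V\<^esub> inv\<^bsub>V\<^esub> (z0 h)) \<in> cocycles C"
  using assms(3,4) cocycle_closed[OF assms(1)] cocycle_closed[OF assms(2)]
  unfolding cocycles_iff
  by (auto simp: subset_iff cocycle_mult[OF assms(1)] cocycle_mult[OF assms(2)] V.inv_mult V.m_ac)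

lemma acts_trivially_normal: "acts_trivially \<lhd> H"
proof (rule H.normal_invI)
  show "subgroup acts_trivially H"
    by (rule H.subgroupI) (auto simp: acts_trivially_def act_comp intro: exI[of _ \<one>], metis act_inv_cancel(1))
  show "h \<otimes> c \<otimes> inv h \<in> acts_trivially" if "h \<in> carrier H" "c \<in> acts_trivially" for h c
    using that by (auto simp: acts_trivially_def act_comp)
qed

text \<open>One copy of V is split off at a time. A nontrivial \<open>f0\<close> is onto by
  irreducibility, so its kernel \<open>C'\<close> has index |V| in \<open>C\<close>. Homomorphisms
  agreeing on \<open>C'\<close> differ by a map factoring through C/C', which is isomorphic to V,
  and an endomorphism of V is determined by one value. Passing from \<open>C'\<close> to
  \<open>C\<close> thus multiplies the left side by at most |V| and the right side by exactly
  |V|.\<close>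

lemma card_equivariant_homs_le:
  assumes irr: irreducible_module and K: "K \<lhd> H"
  shows "C \<lhd> H \<Longrightarrow> K \<subseteq> C \<Longrightarrow> card (equivariant_homs C K) * card K \<le> card C"
proof (induction "card C" arbitrary: C rule: less_induct)
  case less
  interpret C: normal C H using less.prems(1) .
  have finC: "finite C" using C.subset finite_H finite_subset by blast
  show ?case
  proof (cases "\<forall>f\<in>equivariant_homs C K. \<forall>c\<in>C. f c = \<one>\<^bsub>V\<^esub>")
    case True
    have "equivariant_homs C K \<subseteq> {\<lambda>c\<in>C. \<one>\<^bsub>V\<^esub>}"
    proof
      fix f assume f: "f \<in> equivariant_homs C K"
      then have "f \<in> C \<rightarrow>\<^sub>E carrier V" "\<forall>c\<in>C. f c = \<one>\<^bsub>V\<^esub>"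
        using bspec[OF True f] unfolding equivariant_homs_iff by blast+
      then have "f = (\<lambda>c\<in>C. \<one>\<^bsub>V\<^esub>)" by (auto simp: fun_eq_iff PiE_iff extensional_def)
      then show "f \<in> {\<lambda>c\<in>C. \<one>\<^bsub>V\<^esub>}" by simp
    qed
    then have "card (equivariant_homs C K) \<le> 1"
      using card_mono[of "{\<lambda>c\<in>C. \<one>\<^bsub>V\<^esub>}"] by simp
    then have "card (equivariant_homs C K) * card K \<le> 1 * card K" by (rule mult_le_mono1)
    also have "\<dots> \<le> card C" using card_mono[OF finC less.prems(2)] by simp
    finally show ?thesis .
  next
    case False
    then obtain f0 c0 where f0: "f0 \<in> equivariant_homs C K" and c0: "c0 \<in> C" "f0 c0 \<noteq> \<one>\<^bsub>V\<^esub>" by blast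
    have f0c [simp]: "f0 c \<in> carrier V" if "c \<in> C" for c
      using f0 that by (auto simp: equivariant_homs_iff)
    have f0m: "f0 (c \<otimes> d) = f0 c \<otimes>\<^bsub>V\<^esub> f0 d" if "c \<in> C" "d \<in> C" for c d
      using f0 that by (simp add: equivariant_homs_iff)
    have f0e: "f0 (h \<otimes> c \<otimes> inv h) = act h (f0 c)" if "h \<in> carrier H" "c \<in> C" for h c
      using f0 that by (simp add: equivariant_homs_iff)
    interpret HC: group "H\<lparr>carrier := C\<rparr>" using C.subgroup_is_group H.group_axioms .
    interpret f0: group_hom "H\<lparr>carrier := C\<rparr>" V f0
      by unfold_locales (auto simp: hom_def f0m)
    have Csub: "subgroup C (H\<lparr>carrier := C\<rparr>)" using HC.subgroup_self by simp
    \<comment> \<open>Used for X = C, where it gives surjectivity, and for the equaliser of two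
      homomorphisms, where it shows that they agree up to the kernel of \<open>f0\<close>.\<close>
    have span: "f0 ` X = carrier V"
      if X: "subgroup X H" "X \<subseteq> C" "\<And>h x. h \<in> carrier H \<Longrightarrow> x \<in> X \<Longrightarrow> h \<otimes> x \<otimes> inv h \<in> X" "c0 \<in> X" for X
    proof (rule irreducible_moduleD[OF irr _ _ imageI[OF X(4), of f0] c0(2)])
      show "subgroup (f0 ` X) V"
        by (rule f0.subgroup_img_is_subgroup, rule H.subgroup_incl[OF X(1) C.subgroup_axioms X(2)])
      show "act h v \<in> f0 ` X" if h: "h \<in> carrier H" and v: "v \<in> f0 ` X" for h v
      proof -
        obtain x where x: "x \<in> X" "v = f0 x" using v by blast
        then have "act h v = f0 (h \<otimes> x \<otimes> inv h)" using f0e[OF h, of x] X(2) by auto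
        then show ?thesis using X(3)[OF h x(1)] by blast
      qed
    qed
    have imgC: "f0 ` C = carrier V"
      by (rule span[OF C.subgroup_axioms]) (auto simp: c0 C.inv_op_closed2)
    define C' where "C' = {c \<in> C. f0 c = \<one>\<^bsub>V\<^esub>}"
    have cC': "card (carrier V) * card C' = card C"
      using f0.card_image_mult_card_kernel[OF Csub finC] imgC unfolding C'_def by simp
    have normC': "C' \<lhd> H"
    proof (rule H.normal_invI)
      have "f0 (inv x) = inv\<^bsub>V\<^esub> f0 x" if "x \<in> C" for x
        using f0.hom_inv[of x] that H.m_inv_consistent[OF C.subgroup_axioms that] by simp
      moreover have "f0 \<one> = \<one>\<^bsub>V\<^esub>" using f0.hom_one by simp
      ultimately show "subgroup C' H"
        by (intro subgroup.intro) (auto simp: C'_def f0m)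
      show "h \<otimes> c \<otimes> inv h \<in> C'" if "h \<in> carrier H" "c \<in> C'" for h c
        using that f0e by (auto simp: C'_def C.inv_op_closed2)
    qed
    have KC': "K \<subseteq> C'" using f0 less.prems(2) by (auto simp: C'_def equivariant_homs_iff)
    have "C' \<subset> C" using c0 unfolding C'_def by blast
    then have "card C' < card C" using finC psubset_card_mono by blast
    then have IH: "card (equivariant_homs C' K) * card K \<le> card C'"
      using less.hyps normC' KC' by blast
    have C'H: "C' \<subseteq> carrier H" using normC' by (simp add: normal_imp_subgroup subgroup.subset)
    have "card (equivariant_homs C K) \<le> card (equivariant_homs C' K) * card (carrier V)"
    proof (rule card_le_mult_fibers[where f = "\<lambda>f. restrict f C'"])
      show "finite (equivariant_homs C K)" "finite (equivariant_homs C' K)"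
        using finite_equivariant_homs C.subset C'H by auto
      have C'C: "c \<in> C' \<Longrightarrow> c \<in> C" for c unfolding C'_def by blast
      have C'm: "c \<in> C' \<Longrightarrow> d \<in> C' \<Longrightarrow> c \<otimes> d \<in> C'" for c d
        using normC' by (simp add: normal_imp_subgroup subgroup.m_closed)
      have C'e: "h \<in> carrier H \<Longrightarrow> c \<in> C' \<Longrightarrow> h \<otimes> c \<otimes> inv h \<in> C'" for h c
        using normC' normal.inv_op_closed2 by metis
      show "(\<lambda>f. restrict f C') ` equivariant_homs C K \<subseteq> equivariant_homs C' K"
      proof
        fix f' assume "f' \<in> (\<lambda>f. restrict f C') ` equivariant_homs C K"
        then obtain f where f: "f \<in> equivariant_homs C K" "f' = restrict f C'" by blast
        show "f' \<in> equivariant_homs C' K"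
          using f(1) KC' unfolding f(2) equivariant_homs_iff
          by (auto simp: C'C C'm C'e subset_iff)
      qed
      fix g0 assume g0: "g0 \<in> equivariant_homs C K"
      let ?F = "{g \<in> equivariant_homs C K. restrict g C' = restrict g0 C'}"
      show "card ?F \<le> card (carrier V)"
      proof (rule card_inj_on_le[where f = "\<lambda>g. g c0"])
        show "(\<lambda>g. g c0) ` ?F \<subseteq> carrier V" using c0(1) by (auto simp: equivariant_homs_iff)
        show "finite (carrier V)" by (rule finite_V)
        show "inj_on (\<lambda>g. g c0) ?F"
        proof (rule inj_onI)
          fix g g' assume g: "g \<in> ?F" and g': "g' \<in> ?F" and eq: "g c0 = g' c0"
          have hg: "group_hom (H\<lparr>carrier := C\<rparr>) V g" "group_hom (H\<lparr>carrier := C\<rparr>) V g'"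
            using g g' by (auto intro!: group_hom.intro group_hom_axioms.intro HC.group_axioms V.group_axioms
                simp: hom_def equivariant_homs_iff PiE_iff)
          have ginv: "k (inv x) = inv\<^bsub>V\<^esub> (k x)" "k \<one> = \<one>\<^bsub>V\<^esub>"
            if "x \<in> C" "group_hom (H\<lparr>carrier := C\<rparr>) V k" for x k
            using group_hom.hom_inv[OF that(2), of x] group_hom.hom_one[OF that(2)] that(1)
            unfolding H.m_inv_consistent[OF C.subgroup_axioms that(1)] by simp_all
          have gm: "k (c \<otimes> d) = k c \<otimes>\<^bsub>V\<^esub> k d" "k c \<in> carrier V" if "c \<in> C" "d \<in> C" "k = g \<or> k = g'" for k c d
            using that g g' by (auto simp: equivariant_homs_iff)
          have ge: "k (h \<otimes> c \<otimes> inv h) = act h (k c)" if "h \<in> carrier H" "c \<in> C" "k = g \<or> k = g'" for k h c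
            using that g g' by (auto simp: equivariant_homs_iff)
          \<comment> \<open>By irreducibility an endomorphism of the module is determined by its value at \<open>f0 c0\<close>;
            this is phrased without factoring \<open>g\<close> and \<open>g'\<close> through \<open>f0\<close>.\<close>
          define X where "X = {c \<in> C. g c = g' c}"
          have X: "subgroup X H"
            by (intro subgroup.intro)
              (auto simp: X_def gm ginv(1)[OF _ hg(1)] ginv(1)[OF _ hg(2)]
                ginv(2)[OF C.one_closed hg(1)] ginv(2)[OF C.one_closed hg(2)])
          have "f0 ` X = carrier V"
            by (rule span[OF X]) (auto simp: X_def c0 eq C.inv_op_closed2 ge)
          have "g c = g' c" if c: "c \<in> C" for c
          proof -
            have "f0 c \<in> f0 ` X" using \<open>f0 ` X = carrier V\<close> c by simp
            then obtain c1 where c1: "c1 \<in> X" "f0 c = f0 c1" by blast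
            then have c1C: "c1 \<in> C" by (simp add: X_def)
            have "f0 (inv c1) = inv\<^bsub>V\<^esub> (f0 c1)" using ginv(1)[OF c1C f0.group_hom_axioms] .
            then have d: "c \<otimes> inv c1 \<in> C'" using c c1 c1C f0m by (simp add: C'_def)
            have "restrict g C' (c \<otimes> inv c1) = restrict g' C' (c \<otimes> inv c1)" using g g' by simp
            then have "g (c \<otimes> inv c1) = g' (c \<otimes> inv c1)" using d by simp
            moreover have "k c = k (c \<otimes> inv c1) \<otimes>\<^bsub>V\<^esub> k c1" if "k = g \<or> k = g'" for k
              using gm(1)[of "c \<otimes> inv c1" c1 k] that c c1C by (simp add: H.m_assoc)
            moreover have "g c1 = g' c1" using c1 by (simp add: X_def)
            ultimately show ?thesis by metis
          qed
          then show "g = g'" using g g' by (auto intro: PiE_ext simp: equivariant_homs_iff)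
        qed
      qed
    qed
    then have "card (equivariant_homs C K) * card K
        \<le> card (equivariant_homs C' K) * card (carrier V) * card K" by (rule mult_le_mono1)
    also have "\<dots> \<le> card (carrier V) * card C'" using IH by (metis mult.assoc mult.commute mult_le_mono2)
    finally show ?thesis using cC' by simp
  qed
qed

text \<open>The fixed points of A form a submodule because A is normal, and a proper one because A
  acts nontrivially; so A fixes only the neutral element. Hence a cocycle is determined by its
  restriction to A, an inflation-restriction argument. As A acts through commuting operators, these
  restrictions are compatible families for v |-> a.v - v, of which there are at most |V|.\<close>

lemma card_cocycles_trivial_on_acts_trivially_le:
  assumes irr: irreducible_module
    and A: "A \<lhd> H" "\<not> A \<subseteq> acts_trivially"
    and commutator: "\<And>x y. \<lbrakk>x \<in> A; y \<in> A\<rbrakk> \<Longrightarrow> x \<otimes> y \<otimes> inv x \<otimes> inv y \<in> acts_trivially"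
  shows "card (cocycles acts_trivially) \<le> card (carrier V)"
proof -
  interpret A: normal A H using A(1) .
  define \<tau> where "\<tau> a v = act a v \<otimes>\<^bsub>V\<^esub> inv\<^bsub>V\<^esub> v" for a v
  have swap: "\<exists>c\<in>acts_trivially. a \<otimes> b = c \<otimes> (b \<otimes> a)" if "a \<in> A" "b \<in> A" for a b
  proof (rule bexI[OF _ commutator[OF that]])
    have "inv a \<otimes> (inv b \<otimes> (b \<otimes> a)) = \<one>" using that by (simp add: H.m_assoc[symmetric, of "inv b"])
    then show "a \<otimes> b = a \<otimes> b \<otimes> inv a \<otimes> inv b \<otimes> (b \<otimes> a)" using that by (simp add: H.m_assoc)
  qed
  have triv: "act c v = v" "c \<in> carrier H" if "c \<in> acts_trivially" "v \<in> carrier V" for c v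
    using that by (auto simp: acts_trivially_def)
  have act_swap: "act a (act b v) = act b (act a v)" if ab: "a \<in> A" "b \<in> A" and v: "v \<in> carrier V" for a b v
  proof -
    obtain c where c: "c \<in> acts_trivially" "a \<otimes> b = c \<otimes> (b \<otimes> a)" using swap[OF ab] by blast
    have "act (a \<otimes> b) v = act c (act (b \<otimes> a) v)"
      using c v ab triv(2)[OF c(1) v] by (simp add: act_comp)
    then show ?thesis using ab v triv[OF c(1)] by (simp add: act_comp)
  qed
  define F where "F = {v \<in> carrier V. \<forall>a\<in>A. act a v = v}"
  have "F = {\<one>\<^bsub>V\<^esub>}"
  proof -
    have "subgroup F V" by (intro subgroup.intro) (auto simp: F_def)
    moreover have "act h x \<in> F" if h: "h \<in> carrier H" and x: "x \<in> F" for h x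
    proof -
      have "act a (act h x) = act h x" if a: "a \<in> A" for a
      proof -
        have "inv h \<otimes> a \<otimes> h \<in> A" using h a by (rule A.inv_op_closed1)
        then have "act (inv h \<otimes> a \<otimes> h) x = x" using x by (simp add: F_def)
        then have "act h (act (inv h \<otimes> a \<otimes> h) x) = act h x" by simp
        moreover have "h \<otimes> (inv h \<otimes> a \<otimes> h) = a \<otimes> h"
          using h a by (simp add: H.m_assoc[symmetric])
        ultimately show ?thesis
          using h a x act_comp[of h "inv h \<otimes> a \<otimes> h" x] act_comp[of a h x] by (simp add: F_def)
      qed
      then show ?thesis using h x by (simp add: F_def)
    qed
    moreover have "F \<noteq> carrier V"
      using A(2) A.subset by (auto simp: F_def acts_trivially_def)
    ultimately show ?thesis using irr unfolding irreducible_module_def by metis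
  qed
  then have F1: "x = \<one>\<^bsub>V\<^esub>" if "x \<in> carrier V" "\<And>a. a \<in> A \<Longrightarrow> act a x = x" for x
    using that unfolding F_def by blast
  have tau1: "\<tau> a v = \<one>\<^bsub>V\<^esub> \<longleftrightarrow> act a v = v" if "a \<in> A" "v \<in> carrier V" for a v
    using that unfolding \<tau>_def by (metis A.mem_carrier V.inv_closed V.inv_equality V.inv_inv V.r_inv act_closed)
  let ?D = "{d \<in> A \<rightarrow>\<^sub>E carrier V. \<forall>a\<in>A. \<forall>b\<in>A. \<tau> a (d b) = \<tau> b (d a)}"
  have finA: "finite A" using A.subset finite_H finite_subset by blast
  have "card ?D \<le> card (carrier V)"
  proof (rule V.card_compatible_families_le[OF finite_V finA])
    show "\<tau> a \<in> hom V V" if "a \<in> A" for a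
      using that by (auto simp: \<tau>_def hom_def V.inv_mult V.m_ac)
    show "\<tau> a (\<tau> b x) = \<tau> b (\<tau> a x)" if "a \<in> A" "b \<in> A" "x \<in> carrier V" for a b x
      using that by (simp add: \<tau>_def act_swap[OF that] V.inv_mult V.m_ac)
    show "subgroup (carrier V) V" by (rule V.subgroup_self)
    show "\<tau> a x \<in> carrier V" if "a \<in> A" "x \<in> carrier V" for a x using that by (simp add: \<tau>_def)
    show "x = \<one>\<^bsub>V\<^esub>" if x: "x \<in> carrier V" and "\<And>a. a \<in> A \<Longrightarrow> \<tau> a x = \<one>\<^bsub>V\<^esub>" for x
      by (rule F1[OF x]) (use that tau1 in blast)
  qed
  moreover have "card (cocycles acts_trivially) \<le> card ?D"
  proof (rule card_inj_on_le[where f = "\<lambda>z. restrict z A"])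
    show "finite ?D" by (rule finite_subset[OF _ finite_PiE[OF finA finite_V]]) blast
    show "(\<lambda>z. restrict z A) ` cocycles acts_trivially \<subseteq> ?D"
    proof (intro image_subsetI CollectI conjI ballI)
      fix z assume z: "z \<in> cocycles acts_trivially"
      note zc [simp] = cocycle_closed[OF z]
      show "restrict z A \<in> A \<rightarrow>\<^sub>E carrier V" by simp
      fix a b assume ab: "a \<in> A" "b \<in> A"
      obtain c where c: "c \<in> acts_trivially" "a \<otimes> b = c \<otimes> (b \<otimes> a)" using swap[OF ab] by blast
      have ch: "c \<in> carrier H" using c by (simp add: acts_trivially_def)
      have "z (a \<otimes> b) = z (b \<otimes> a)"
        using c ab ch cocycle_mult[OF z, of c "b \<otimes> a"] cocycle_vanish[OF z c(1)] triv(1)[OF c(1)] by simp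
      then have eq: "z a \<otimes>\<^bsub>V\<^esub> act a (z b) = z b \<otimes>\<^bsub>V\<^esub> act b (z a)" using ab cocycle_mult[OF z] by simp
      have "act a (z b) \<otimes>\<^bsub>V\<^esub> inv\<^bsub>V\<^esub> z b = act b (z a) \<otimes>\<^bsub>V\<^esub> inv\<^bsub>V\<^esub> z a"
        by (rule V.mult_inv_eq_mult_inv[OF eq]) (use ab in simp_all)
      then show "\<tau> a (restrict z A b) = \<tau> b (restrict z A a)" using ab by (simp add: \<tau>_def)
    qed
    show "inj_on (\<lambda>z. restrict z A) (cocycles acts_trivially)"
    proof (rule inj_onI)
      fix z z' assume z: "z \<in> cocycles acts_trivially" and z': "z' \<in> cocycles acts_trivially"
        and eq: "restrict z A = restrict z' A"
      define w where "w = (\<lambda>h\<in>carrier H. z h \<otimes>\<^bsub>V\<^esub> inv\<^bsub>V\<^esub> (z' h))"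
      have w: "w \<in> cocycles A"
        unfolding w_def by (rule cocycles_divide[OF z z' A.subset]) (metis eq restrict_apply')
      \<comment> \<open>Since \<open>w\<close> vanishes on A, expanding w(hb) = w(ah) with b = inv h
        a h leaves w(h) = a.w(h), so w(h) is fixed by A.\<close>
      have w1: "w h = \<one>\<^bsub>V\<^esub>" if h: "h \<in> carrier H" for h
      proof (rule F1)
        show wh: "w h \<in> carrier V" using cocycle_closed[OF w h] .
        fix a assume a: "a \<in> A"
        define b where "b = inv h \<otimes> a \<otimes> h"
        have b: "b \<in> A" unfolding b_def using h a by (rule A.inv_op_closed1)
        have "h \<otimes> b = a \<otimes> h" unfolding b_def using h a by (simp add: H.m_assoc[symmetric])
        then have "w h \<otimes>\<^bsub>V\<^esub> act h (w b) = w a \<otimes>\<^bsub>V\<^esub> act a (w h)"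
          using cocycle_mult[OF w h, of b] cocycle_mult[OF w _ h, of a] a b A.mem_carrier by simp
        then show "act a (w h) = w h"
          using cocycle_vanish[OF w a] cocycle_vanish[OF w b] h a wh by simp
      qed
      have "z h = z' h" if h: "h \<in> carrier H" for h
      proof -
        have "z h \<otimes>\<^bsub>V\<^esub> inv\<^bsub>V\<^esub> (z' h) = \<one>\<^bsub>V\<^esub>" using w1[OF h] h by (simp add: w_def)
        then have "inv\<^bsub>V\<^esub> (inv\<^bsub>V\<^esub> (z' h)) = z h"
          using cocycle_closed[OF z h] cocycle_closed[OF z' h] by (intro V.inv_equality) auto
        then show ?thesis using cocycle_closed[OF z' h] by simp
      qed
      then show "z = z'" using z z' by (auto intro: PiE_ext simp: cocycles_iff)
    qed
  qed
  ultimately show ?thesis by simp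
qed

text \<open>Restriction to the kernel C of the action sends cocycles to equivariant homomorphisms,
  at most |C| / |K| in number, and division by one member embeds each fibre in the cocycles
  vanishing on C. The unit is gained in the second factor: it is 1 if C = H, and otherwise at most
  |V| \<le> 2 (|V| - 1), where the 2 is absorbed because C has index at least 2.\<close>

theorem card_cocycles_le:
  assumes irr: irreducible_module and "solvable H" and K: "K \<lhd> H" "K \<subseteq> acts_trivially"
    and nontriv: "carrier V \<noteq> {\<one>\<^bsub>V\<^esub>}"
  shows "card (cocycles K) * card K \<le> (card (carrier V) - 1) * card (carrier H)"
proof -
  let ?C = acts_trivially
  interpret C: normal ?C H by (rule acts_trivially_normal)
  have V2: "card (carrier V) \<ge> 2"
  proof (rule ccontr)
    assume "\<not> card (carrier V) \<ge> 2"
    moreover have "card (carrier V) \<noteq> 0" using finite_V V.one_closed by (metis card_0_eq empty_iff)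
    ultimately have "card (carrier V) = 1" by linarith
    then show False using nontriv V.one_closed by (metis card_1_singletonE singletonD)
  qed
  have E: "card (equivariant_homs ?C K) * card K \<le> card ?C"
    using card_equivariant_homs_le[OF irr K(1) acts_trivially_normal K(2)] .
  have "card (cocycles K) \<le> card (equivariant_homs ?C K) * card (cocycles ?C)"
  proof (rule card_le_mult_fibers[where f = "\<lambda>z. restrict z ?C"])
    show "finite (cocycles K)" "finite (equivariant_homs ?C K)"
      using finite_cocycles finite_equivariant_homs C.subset by auto
    show "(\<lambda>z. restrict z ?C) ` cocycles K \<subseteq> equivariant_homs ?C K"
    proof
      fix f assume "f \<in> (\<lambda>z. restrict z ?C) ` cocycles K"
      then obtain z where z: "z \<in> cocycles K" "f = restrict z ?C" by blast
      \<comment> \<open>The value at hc = dh, with d the conjugate of c, is expanded in two ways; d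
        acts trivially because C is normal.\<close>
      have conj: "z (h \<otimes> c \<otimes> inv h) = act h (z c)" if h: "h \<in> carrier H" and c: "c \<in> ?C" for h c
      proof -
        let ?d = "h \<otimes> c \<otimes> inv h"
        have d: "?d \<in> ?C" using h c by (rule C.inv_op_closed2)
        have "z h \<otimes>\<^bsub>V\<^esub> act h (z c) = z (h \<otimes> c)" using cocycle_mult[OF z(1) h] c by simp
        also have "h \<otimes> c = ?d \<otimes> h" using h c by (simp add: H.m_assoc)
        also have "z (?d \<otimes> h) = z ?d \<otimes>\<^bsub>V\<^esub> act ?d (z h)" using cocycle_mult[OF z(1) _ h] d by simp
        also have "act ?d (z h) = z h" using d cocycle_closed[OF z(1) h] unfolding acts_trivially_def by blast
        finally show ?thesis
          using h c d cocycle_closed[OF z(1)]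
          by (metis C.mem_carrier V.m_comm V.right_cancel act_closed)
      qed
      show "f \<in> equivariant_homs ?C K"
        unfolding equivariant_homs_iff z(2)
      proof (intro conjI ballI)
        show "restrict z ?C \<in> ?C \<rightarrow>\<^sub>E carrier V" using cocycle_closed[OF z(1)] by simp
        show "restrict z ?C (c \<otimes> d) = restrict z ?C c \<otimes>\<^bsub>V\<^esub> restrict z ?C d"
          if c: "c \<in> ?C" and d: "d \<in> ?C" for c d
        proof -
          have "act c (z d) = z d" using c cocycle_closed[OF z(1) C.mem_carrier[OF d]]
            unfolding acts_trivially_def by blast
          then show ?thesis using c d cocycle_mult[OF z(1), of c d] by simp
        qed
        show "restrict z ?C (h \<otimes> c \<otimes> inv h) = act h (restrict z ?C c)"
          if "h \<in> carrier H" "c \<in> ?C" for h c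
          using that conj C.inv_op_closed2 by simp
        show "restrict z ?C k = \<one>\<^bsub>V\<^esub>" if "k \<in> K" for k
          using that K(2) cocycle_vanish[OF z(1) that] by auto
      qed
    qed
    fix z0 assume z0: "z0 \<in> cocycles K"
    let ?F = "{z \<in> cocycles K. restrict z ?C = restrict z0 ?C}"
    show "card ?F \<le> card (cocycles ?C)"
    proof (rule card_inj_on_le[where f = "\<lambda>z. \<lambda>h\<in>carrier H. z h \<otimes>\<^bsub>V\<^esub> inv\<^bsub>V\<^esub> (z0 h)"])
      show "inj_on (\<lambda>z. \<lambda>h\<in>carrier H. z h \<otimes>\<^bsub>V\<^esub> inv\<^bsub>V\<^esub> (z0 h)) ?F"
        by (rule inj_on_subset[OF V.inj_on_divide_by_family]) (use z0 in \<open>auto simp: cocycles_iff\<close>)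
      show "(\<lambda>z. \<lambda>h\<in>carrier H. z h \<otimes>\<^bsub>V\<^esub> inv\<^bsub>V\<^esub> (z0 h)) ` ?F \<subseteq> cocycles ?C"
      proof (rule image_subsetI)
        fix z assume "z \<in> ?F"
        then show "(\<lambda>h\<in>carrier H. z h \<otimes>\<^bsub>V\<^esub> inv\<^bsub>V\<^esub> (z0 h)) \<in> cocycles ?C"
          by (intro cocycles_divide[OF _ z0 C.subset]) (auto, metis restrict_apply')
      qed
      show "finite (cocycles ?C)" by (rule finite_cocycles)
    qed
  qed
  then have "card (cocycles K) * card K \<le> card (equivariant_homs ?C K) * card (cocycles ?C) * card K"
    by (rule mult_le_mono1)
  also have "\<dots> \<le> card ?C * card (cocycles ?C)"
    using E by (metis mult.assoc mult.commute mult_le_mono1)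
  also have "\<dots> \<le> (card (carrier V) - 1) * card (carrier H)"
  proof (cases "?C = carrier H")
    case True
    have "cocycles ?C \<subseteq> {\<lambda>h\<in>carrier H. \<one>\<^bsub>V\<^esub>}"
    proof
      fix f assume f: "f \<in> cocycles ?C"
      have "f = (\<lambda>c\<in>carrier H. \<one>\<^bsub>V\<^esub>)"
        using f True unfolding cocycles_iff by (auto simp: fun_eq_iff PiE_iff extensional_def)
      then show "f \<in> {\<lambda>h\<in>carrier H. \<one>\<^bsub>V\<^esub>}" by simp
    qed
    then have "card (cocycles ?C) \<le> 1"
      using card_mono[of "{\<lambda>h\<in>carrier H. \<one>\<^bsub>V\<^esub>}"] by simp
    then have "card ?C * card (cocycles ?C) \<le> card (carrier H) * (card (carrier V) - 1)"
      using V2 True by (intro mult_mono) auto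
    then show ?thesis by (simp add: mult.commute)
  next
    case False
    obtain A where A: "A \<lhd> H" "\<not> A \<subseteq> ?C" "\<And>x y. \<lbrakk>x \<in> A; y \<in> A\<rbrakk> \<Longrightarrow> x \<otimes> y \<otimes> inv x \<otimes> inv y \<in> ?C"
      using H.solvable_imp_normal_abelian_mod[OF assms(2) acts_trivially_normal False] by blast
    have Z: "card (cocycles ?C) \<le> card (carrier V)"
      using card_cocycles_trivial_on_acts_trivially_le[OF irr A] .
    have "card (rcosets ?C) * card ?C = card (carrier H)"
      using H.lagrange[OF C.subgroup_axioms] by (simp add: order_def mult.commute)
    moreover have "card (rcosets ?C) \<noteq> 1"
    proof
      assume "card (rcosets ?C) = 1"
      then have "card ?C = card (carrier H)" using calculation by simp
      then show False using False C.subset finite_H card_subset_eq by blast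
    qed
    moreover have "card (carrier H) \<noteq> 0" using finite_H H.one_closed by (metis card_0_eq empty_iff)
    ultimately have "2 \<le> card (rcosets ?C)" by (cases "card (rcosets ?C)") auto
    then have CH: "2 * card ?C \<le> card (carrier H)"
      using \<open>card (rcosets ?C) * card ?C = card (carrier H)\<close> by (metis mult_le_mono1)
    have "card ?C * card (cocycles ?C) \<le> card ?C * (2 * (card (carrier V) - 1))"
      using Z V2 by (intro mult_le_mono2) linarith
    also have "\<dots> = 2 * card ?C * (card (carrier V) - 1)" by simp
    also have "\<dots> \<le> card (carrier H) * (card (carrier V) - 1)"
      using CH by (rule mult_le_mono1)
    finally show ?thesis by (simp only: mult.commute)
  qed
  finally show ?thesis .
qed

end

section \<open>Maximal subgroups of solvable groups\<close>

text \<open>Under conjugation B is an irreducible module by minimality, and B acts trivially on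
  itself by commutativity. Measured against one fixed complement, the others become cocycles
  vanishing on B, so \<open>card_cocycles_le\<close> applies with K = B. The quantified condition on
  M is G = BM, written in the form that defines the projection.\<close>

lemma (in group) card_complements_le:
  assumes fin: "finite (carrier G)" and "solvable G"
    and B: "B \<lhd> G" "B \<noteq> {\<one>}" "\<And>x y. \<lbrakk>x \<in> B; y \<in> B\<rbrakk> \<Longrightarrow> x \<otimes> y = y \<otimes> x"
    and minimal: "\<And>X. \<lbrakk>X \<lhd> G; X \<subseteq> B\<rbrakk> \<Longrightarrow> X = {\<one>} \<or> X = B"
  shows "card {M. subgroup M G \<and> M \<inter> B = {\<one>} \<and> (\<forall>g\<in>carrier G. \<exists>b\<in>B. inv b \<otimes> g \<in> M)} * card B
    \<le> (card B - 1) * card (carrier G)" (is "card ?S * _ \<le> _")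
proof -
  interpret B: normal B G using B(1) .
  let ?V = "G\<lparr>carrier := B\<rparr>"
  interpret V: comm_group ?V
    using subgroup_imp_group[OF B.subgroup_axioms] B(3) by (intro group.group_comm_groupI) auto
  have invV [simp]: "inv\<^bsub>?V\<^esub> b = inv b" if "b \<in> B" for b
    using m_inv_consistent[OF B.subgroup_axioms that] .
  define act where "act g b = g \<otimes> b \<otimes> inv g" for g b
  interpret M: finite_module G ?V act
  proof unfold_locales
    show "finite (carrier G)" by (rule fin)
    show "finite (carrier ?V)" using fin B.subset finite_subset by auto
    show "act h v \<in> carrier ?V" if "h \<in> carrier G" "v \<in> carrier ?V" for h v
      using that by (simp add: act_def B.inv_op_closed2)
    show "act h (v \<otimes>\<^bsub>?V\<^esub> w) = act h v \<otimes>\<^bsub>?V\<^esub> act h w"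
      if "h \<in> carrier G" "v \<in> carrier ?V" "w \<in> carrier ?V" for h v w
    proof -
      have "v \<in> carrier G" "w \<in> carrier G" using that by auto
      then show ?thesis using that by (simp add: act_def m_assoc inv_solve_left)
    qed
    show "act (h \<otimes> k) v = act h (act k v)"
      if "h \<in> carrier G" "k \<in> carrier G" "v \<in> carrier ?V" for h k v
      using that by (simp add: act_def m_assoc inv_mult_group)
    show "act \<one> v = v" if "v \<in> carrier ?V" for v using that by (simp add: act_def)
  qed
  have irr: M.irreducible_module
    unfolding M.irreducible_module_def
  proof (intro allI impI)
    fix X assume X: "subgroup X ?V" "\<forall>h\<in>carrier G. \<forall>x\<in>X. act h x \<in> X"
    have "X \<lhd> G"
      by (rule normal_invI) (use X incl_subgroup[OF B.subgroup_axioms X(1)] in \<open>auto simp: act_def\<close>)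
    then show "X = {\<one>\<^bsub>?V\<^esub>} \<or> X = carrier ?V" using minimal subgroup.subset[OF X(1)] by simp
  qed
  have triv: "B \<subseteq> M.acts_trivially"
  proof
    fix b assume b: "b \<in> B"
    have "act b v = v" if "v \<in> B" for v
      using b that B(3)[OF b that] by (simp add: act_def m_assoc)
    then show "b \<in> M.acts_trivially" using b by (simp add: M.acts_trivially_def)
  qed
  have main: "card (M.cocycles B) * card B \<le> (card B - 1) * card (carrier G)"
    using M.card_cocycles_le[OF irr assms(2) B(1) triv] B(2) by simp
  \<comment> \<open>Projection of \<open>G = B M\<close> onto \<open>B\<close>: a cocycle which is the identity on \<open>B\<close>, so that any two
    of them differ by a cocycle vanishing on \<open>B\<close>.\<close>
  define \<phi> where "\<phi> M = (\<lambda>g\<in>carrier G. THE b. b \<in> B \<and> inv b \<otimes> g \<in> M)" for M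
  have \<phi>: "\<phi> M g = b" if M: "M \<in> ?S" and b: "b \<in> B" and m: "inv b \<otimes> g \<in> M" and g: "g \<in> carrier G" for M g b
  proof -
    have "(THE b. b \<in> B \<and> inv b \<otimes> g \<in> M) = b"
    proof (rule the_equality)
      fix c assume c: "c \<in> B \<and> inv c \<otimes> g \<in> M"
      have "inv b \<otimes> g \<otimes> inv (inv c \<otimes> g) \<in> M"
        using M m c by (auto simp: subgroup.m_closed subgroup.m_inv_closed)
      moreover have "inv b \<otimes> g \<otimes> inv (inv c \<otimes> g) = inv b \<otimes> c"
        using b c g by (simp add: inv_mult_group m_assoc[symmetric]) (simp add: m_assoc)
      moreover have "inv b \<otimes> c \<in> B" using b c by simp
      ultimately have "inv b \<otimes> c = \<one>" using M by auto
      then show "c = b" using b c by (metis B.mem_carrier inv_equality inv_closed inv_inv)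
    qed (use b m in auto)
    then show ?thesis using g by (simp add: \<phi>_def)
  qed
  have \<phi>ex: "\<exists>b\<in>B. \<phi> M g = b \<and> inv b \<otimes> g \<in> M" if M: "M \<in> ?S" and g: "g \<in> carrier G" for M g
    using M g \<phi>[OF M] by blast
  have \<phi>cocycle: "\<phi> M \<in> M.cocycles {}" if M: "M \<in> ?S" for M
    unfolding M.cocycles_iff
  proof (intro conjI ballI)
    show "\<phi> M \<in> carrier G \<rightarrow>\<^sub>E carrier ?V"
      using \<phi>ex[OF M] by (auto simp: PiE_iff) (auto simp: \<phi>_def)
    fix g h assume gh: "g \<in> carrier G" "h \<in> carrier G"
    obtain b where b: "b \<in> B" "\<phi> M g = b" "inv b \<otimes> g \<in> M" using \<phi>ex[OF M gh(1)] by blast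
    obtain c where c: "c \<in> B" "\<phi> M h = c" "inv c \<otimes> h \<in> M" using \<phi>ex[OF M gh(2)] by blast
    define m where "m = inv b \<otimes> g"
    have m: "m \<in> M" "m \<in> carrier G" using b gh by (auto simp: m_def)
    have gm: "g = b \<otimes> m" using b gh by (simp add: m_def m_assoc[symmetric])
    have bm: "act m c \<in> B" using m c by (simp add: act_def B.inv_op_closed2)
    \<comment> \<open>The B-part of gh, with g = bm, is b times the conjugate of c by m. Conjugating
      by g instead changes nothing, since b commutes with B, and this makes the projection a
      cocycle.\<close>
    have act_eq: "act g c = act m c"
    proof -
      have "act g c = act b (act m c)" using M.act_comp[of b m c] b c m by (simp add: gm)
      also have "\<dots> = act m c"
        using triv b(1) bm unfolding M.acts_trivially_def by auto
      finally show ?thesis .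
    qed
    have "inv (b \<otimes> act g c) \<otimes> (g \<otimes> h) = m \<otimes> (inv c \<otimes> h)"
    proof -
      have "inv (b \<otimes> act m c) \<otimes> (b \<otimes> m \<otimes> h) = inv (act m c) \<otimes> (inv b \<otimes> (b \<otimes> (m \<otimes> h)))"
        using b m c bm gh by (simp add: inv_mult_group m_assoc)
      also have "inv b \<otimes> (b \<otimes> (m \<otimes> h)) = m \<otimes> h" using b m gh by (simp add: m_assoc[symmetric])
      also have "inv (act m c) \<otimes> (m \<otimes> h) = m \<otimes> (inv c \<otimes> (inv m \<otimes> (m \<otimes> h)))"
        using m c gh by (simp add: act_def inv_mult_group m_assoc)
      also have "inv m \<otimes> (m \<otimes> h) = h" using m gh by (simp add: m_assoc[symmetric])
      finally show ?thesis unfolding act_eq by (simp only: gm)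
    qed
    moreover have "m \<otimes> (inv c \<otimes> h) \<in> M" using M m c by (auto simp: subgroup.m_closed)
    ultimately have "\<phi> M (g \<otimes> h) = b \<otimes> act g c"
      using b bm gh unfolding act_eq by (intro \<phi>[OF M]) auto
    then show "\<phi> M (g \<otimes> h) = \<phi> M g \<otimes>\<^bsub>?V\<^esub> act g (\<phi> M h)" using b c by simp
  qed simp
  have \<phi>B: "\<phi> M b = b" if "M \<in> ?S" "b \<in> B" for M b
    using that by (intro \<phi>[OF that(1)]) (auto simp: subgroup.one_closed)
  have \<phi>inj: "inj_on \<phi> ?S"
  proof (rule inj_onI)
    have rec: "M = {g \<in> carrier G. \<phi> M g = \<one>}" if M: "M \<in> ?S" for M
    proof -
      have sub: "M \<subseteq> carrier G" using M by (auto dest: subgroup.subset)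
      have "\<phi> M g = \<one>" if "g \<in> M" for g using that sub by (intro \<phi>[OF M]) auto
      moreover have "g \<in> M" if "g \<in> carrier G" "\<phi> M g = \<one>" for g using \<phi>ex[OF M that(1)] that by auto
      ultimately show ?thesis using sub by blast
    qed
    fix M M' assume "M \<in> ?S" "M' \<in> ?S" "\<phi> M = \<phi> M'"
    then show "M = M'" using rec[of M] rec[of M'] by simp
  qed
  have "card ?S \<le> card (M.cocycles B)"
  proof (cases "?S = {}")
    case False
    then obtain M0 where M0: "M0 \<in> ?S" by blast
    let ?f = "\<lambda>z. \<lambda>g\<in>carrier G. z g \<otimes>\<^bsub>?V\<^esub> inv\<^bsub>?V\<^esub> (\<phi> M0 g)"
    show ?thesis
    proof (rule card_inj_on_le[where f = "?f \<circ> \<phi>"])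
      have pi: "\<phi> M \<in> carrier G \<rightarrow>\<^sub>E carrier ?V" if "M \<in> ?S" for M
        using \<phi>cocycle[OF that] unfolding M.cocycles_iff by blast
      have "inj_on ?f (\<phi> ` ?S)"
      proof (rule inj_on_subset[OF V.inj_on_divide_by_family])
        show "\<phi> M0 \<in> carrier G \<rightarrow> carrier ?V" using pi[OF M0] by blast
        show "\<phi> ` ?S \<subseteq> carrier G \<rightarrow>\<^sub>E carrier ?V" using pi by blast
      qed
      then show "inj_on (?f \<circ> \<phi>) ?S" using \<phi>inj by (rule comp_inj_on[rotated])
      show "(?f \<circ> \<phi>) ` ?S \<subseteq> M.cocycles B"
      proof (rule image_subsetI)
        fix M assume M: "M \<in> ?S"
        show "(?f \<circ> \<phi>) M \<in> M.cocycles B"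
          using M.cocycles_divide[OF \<phi>cocycle[OF M] \<phi>cocycle[OF M0] B.subset] \<phi>B[OF M] \<phi>B[OF M0] by simp
      qed
      show "finite (M.cocycles B)" by (rule M.finite_cocycles)
    qed
  next
    case True
    then show ?thesis by (simp only: card.empty le0)
  qed
  then show ?thesis using main by (meson le_trans mult_le_mono1)
qed

lemma (in group) subset_set_mult:
  assumes A: "subgroup A G" and B: "subgroup B G"
  shows "A \<subseteq> A <#> B" "B \<subseteq> A <#> B"
proof -
  have "a \<otimes> \<one> \<in> A <#> B" if "a \<in> A" for a
    using that subgroup.one_closed[OF B] unfolding set_mult_def by blast
  then show "A \<subseteq> A <#> B" using subgroup.mem_carrier[OF A] by auto
  have "\<one> \<otimes> b \<in> A <#> B" if "b \<in> B" for b
    using that subgroup.one_closed[OF A] unfolding set_mult_def by blast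
  then show "B \<subseteq> A <#> B" using subgroup.mem_carrier[OF B] by auto
qed

definition (in group) maximal_subgroup :: "'a set \<Rightarrow> bool"
  where "maximal_subgroup M \<longleftrightarrow> subgroup M G \<and> M \<noteq> carrier G \<and>
    (\<forall>L. subgroup L G \<longrightarrow> M \<subseteq> L \<longrightarrow> L = M \<or> L = carrier G)"

text \<open>Read in Q = G/K: fewer than |Q| maximal subgroups lie above K. Let B = A/K be minimal
  normal and abelian in Q. By induction at most |Q| / |B| - 1 of the maximal subgroups contain A;
  the others map to complements of B, at most |Q| - |Q| / |B| in number. The sum is |Q| - 1, with
  nothing to spare.\<close>

lemma (in group) card_maximal_subgroups_containing:
  assumes fin: "finite (carrier G)" and solv: "solvable G"
  shows "K \<lhd> G \<Longrightarrow> (card {M. maximal_subgroup M \<and> K \<subseteq> M} + 1) * card K \<le> card (carrier G)"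
proof (induction "card (carrier G) - card K" arbitrary: K rule: less_induct)
  case less
  let ?Max = "\<lambda>K. {M. maximal_subgroup M \<and> K \<subseteq> M}"
  interpret K: normal K G using less.prems .
  have finMax: "finite (?Max X)" for X
    using fin by (intro finite_subset[OF _ finite_Pow_iff[THEN iffD2, OF fin]])
      (auto simp: maximal_subgroup_def dest: subgroup.subset)
  show ?case
  proof (cases "K = carrier G")
    case True
    then have "?Max K = {}" by (auto simp: maximal_subgroup_def dest: subgroup.subset)
    then show ?thesis unfolding True by (simp only: card.empty add_0 mult_1 order_refl)
  next
    case False
    let ?Q = "G Mod K"
    note mult_FactGroup [simp del] one_FactGroup [simp del]
    define \<pi> where "\<pi> g = K #> g" for g
    interpret Q: group ?Q by (rule K.factorgroup_is_group)
    have "\<pi> = (\<lambda>a. K #> a)" by (simp add: \<pi>_def fun_eq_iff)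
    then interpret \<pi>: group_hom G ?Q \<pi>
      using K.r_coset_hom_Mod by unfold_locales simp
    have surj: "\<pi> ` carrier G = carrier ?Q" by (auto simp: carrier_FactGroup \<pi>_def)
    have ker: "\<pi> g = \<one>\<^bsub>?Q\<^esub> \<longleftrightarrow> g \<in> K" if "g \<in> carrier G" for g
      using that coset_join1[OF _ that K.subgroup_axioms] coset_join2[OF that K.subgroup_axioms]
      by (auto simp: \<pi>_def one_FactGroup)
    have eq_iff: "\<pi> x = \<pi> y \<longleftrightarrow> x \<otimes> inv y \<in> K" if "x \<in> carrier G" "y \<in> carrier G" for x y
      using that ker[of "x \<otimes> inv y"] Q.right_cancel[of "inv\<^bsub>?Q\<^esub> (\<pi> y)" "\<pi> x" "\<pi> y"] by simp
    have mem: "x \<in> X" if "\<pi> x \<in> \<pi> ` X" "x \<in> carrier G" "subgroup X G" "K \<subseteq> X" for x X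
    proof -
      from that(1) obtain y where y: "y \<in> X" "\<pi> x = \<pi> y" by blast
      have yc: "y \<in> carrier G" using y(1) subgroup.mem_carrier[OF that(3)] by blast
      then have "x \<otimes> inv y \<in> X" using eq_iff[OF that(2) yc] y(2) that(4) by blast
      then have "x \<otimes> inv y \<otimes> y \<in> X" using subgroup.m_closed[OF that(3)] y(1) by blast
      then show ?thesis using that(2) yc by (simp add: m_assoc)
    qed
    have solvQ: "solvable ?Q"
      using \<pi>.solvable_imp_solvable_img[of "carrier G"] solv surj by (simp add: solvable_def)
    let ?F = "\<lambda>A. A \<lhd> G \<and> K \<subset> A \<and> (\<forall>x\<in>A. \<forall>y\<in>A. \<pi> x \<otimes>\<^bsub>?Q\<^esub> \<pi> y = \<pi> y \<otimes>\<^bsub>?Q\<^esub> \<pi> x)"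
    \<comment> \<open>The subgroup \<open>D\<close> is abelian modulo K but need not contain K; the
      product KD does, and has the same image in the quotient.\<close>
    have "\<exists>A. ?F A"
    proof -
      obtain D where D: "D \<lhd> G" "\<not> D \<subseteq> K" "\<And>x y. \<lbrakk>x \<in> D; y \<in> D\<rbrakk> \<Longrightarrow> x \<otimes> y \<otimes> inv x \<otimes> inv y \<in> K"
        using solvable_imp_normal_abelian_mod[OF solv less.prems False] by blast
      interpret D: normal D G using D(1) .
      note sub = subset_set_mult[OF K.subgroup_axioms D.subgroup_axioms]
      have img: "\<exists>d\<in>D. \<pi> x = \<pi> d" if "x \<in> K <#> D" for x
      proof -
        from that obtain k d where kd: "k \<in> K" "d \<in> D" "x = k \<otimes> d" by (auto simp: set_mult_def)
        then have "\<pi> x = \<pi> d" using ker[of k] \<pi>.hom_mult[of k d] by simp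
        then show ?thesis using kd by blast
      qed
      have commD: "\<pi> x \<otimes>\<^bsub>?Q\<^esub> \<pi> y = \<pi> y \<otimes>\<^bsub>?Q\<^esub> \<pi> x" if "x \<in> D" "y \<in> D" for x y
      proof -
        have "\<pi> (x \<otimes> y) = \<pi> (y \<otimes> x)"
          using eq_iff[of "x \<otimes> y" "y \<otimes> x"] D(3)[OF that] that by (simp add: inv_mult_group m_assoc)
        then show ?thesis using that by simp
      qed
      have "?F (K <#> D)"
      proof (intro conjI ballI)
        show "K <#> D \<lhd> G" by (rule normal_subgroup_set_mult_closed[OF less.prems D(1)])
        show "K \<subset> K <#> D" using sub D(2) by blast
        fix x y assume "x \<in> K <#> D" "y \<in> K <#> D"
        then obtain d e where "d \<in> D" "e \<in> D" "\<pi> x = \<pi> d" "\<pi> y = \<pi> e" using img by metis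
        then show "\<pi> x \<otimes>\<^bsub>?Q\<^esub> \<pi> y = \<pi> y \<otimes>\<^bsub>?Q\<^esub> \<pi> x" using commD by simp
      qed
      then show ?thesis by blast
    qed
    then obtain A0 where "?F A0" by blast
    \<comment> \<open>Least cardinality suffices for minimality: a normal subgroup strictly between
      K and A inherits commutativity modulo K.\<close>
    from ex_has_least_nat[of ?F, OF this, of card]
    obtain A where A_least: "?F A \<and> (\<forall>X. ?F X \<longrightarrow> card A \<le> card X)" by (rule exE)
    then have A: "?F A" by (rule conjunct1)
    have minA: "card A \<le> card X" if "?F X" for X
      using conjunct2[OF A_least] that by blast
    interpret A: normal A G using A by blast
    have finA: "finite A" using A.subset fin finite_subset by blast
    have KA: "K \<subseteq> A" "K \<noteq> A" using conjunct1[OF conjunct2[OF A]] by auto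
    have A_comm: "\<pi> x \<otimes>\<^bsub>?Q\<^esub> \<pi> y = \<pi> y \<otimes>\<^bsub>?Q\<^esub> \<pi> x" if "x \<in> A" "y \<in> A" for x y
      using conjunct2[OF conjunct2[OF A]] that by blast
    have minimalA: "X = K \<or> X = A" if "X \<lhd> G" "K \<subseteq> X" "X \<subseteq> A" for X
    proof (rule ccontr)
      assume "\<not> (X = K \<or> X = A)"
      then have "?F X" "X \<subset> A" using that A by blast+
      then show False using minA psubset_card_mono[OF finA] by (metis linorder_not_le)
    qed
    define B where "B = \<pi> ` A"
    have B: "B \<lhd> ?Q" unfolding B_def by (rule A.surj_hom_normal_subgroup[OF \<pi>.group_hom_axioms surj])
    interpret B: normal B ?Q using B .
    have B1: "B \<noteq> {\<one>\<^bsub>?Q\<^esub>}"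
    proof
      assume "B = {\<one>\<^bsub>?Q\<^esub>}"
      then have "\<pi> x = \<one>\<^bsub>?Q\<^esub>" if "x \<in> A" for x using that unfolding B_def by (metis imageI singletonD)
      then have "A \<subseteq> K" using ker[OF A.mem_carrier] by auto
      then show False using KA by blast
    qed
    have minB: "X = {\<one>\<^bsub>?Q\<^esub>} \<or> X = B" if X: "X \<lhd> ?Q" "X \<subseteq> B" for X
    proof -
      let ?Y = "{g \<in> carrier G. \<pi> g \<in> X}"
      have "?Y \<lhd> G"
        using K.factgroup_subgroup_union_normal[OF X(1)]
          K.factgroup_subgroup_union_char[OF normal_imp_subgroup[OF X(1)]] by (simp add: \<pi>_def)
      moreover have "K \<subseteq> ?Y"
        using ker[OF K.mem_carrier] subgroup.one_closed[OF normal_imp_subgroup[OF X(1)]] by auto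
      moreover have "?Y \<subseteq> A" using X(2) mem[OF _ _ A.subgroup_axioms KA(1)] unfolding B_def by blast
      ultimately have "?Y = K \<or> ?Y = A" by (rule minimalA)
      moreover have "X = \<pi> ` ?Y"
        using subgroup.subset[OF normal_imp_subgroup[OF X(1)]] unfolding surj[symmetric] by blast
      moreover have "\<pi> ` K = {\<one>\<^bsub>?Q\<^esub>}"
        using ker[OF K.mem_carrier] K.one_closed by (auto intro!: image_eqI[of _ _ \<one>])
      ultimately show ?thesis unfolding B_def by (elim disjE) simp_all
    qed
    let ?S = "{M. subgroup M ?Q \<and> M \<inter> B = {\<one>\<^bsub>?Q\<^esub>} \<and> (\<forall>g\<in>carrier ?Q. \<exists>b\<in>B. inv\<^bsub>?Q\<^esub> b \<otimes>\<^bsub>?Q\<^esub> g \<in> M)}"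
    have finQ: "finite (carrier ?Q)" using fin surj by (metis finite_imageI)
    have S: "card ?S * card B \<le> (card B - 1) * card (carrier ?Q)"
      by (rule Q.card_complements_le[OF finQ solvQ B B1 _ minB])
        (use A_comm in \<open>auto simp: B_def\<close>)
    have "card {M \<in> ?Max K. \<not> A \<subseteq> M} \<le> card ?S"
    proof (rule card_inj_on_le[where f = "\<lambda>M. \<pi> ` M"])
      show "finite ?S"
        by (rule finite_subset[OF _ finite_Pow_iff[THEN iffD2, OF finQ]]) (auto dest: subgroup.subset)
      show "inj_on (\<lambda>M. \<pi> ` M) {M \<in> ?Max K. \<not> A \<subseteq> M}"
      proof (rule inj_onI)
        fix M M' assume "M \<in> {M \<in> ?Max K. \<not> A \<subseteq> M}" "M' \<in> {M \<in> ?Max K. \<not> A \<subseteq> M}" and eq: "\<pi> ` M = \<pi> ` M'"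
        then have M: "subgroup M G" "K \<subseteq> M" "subgroup M' G" "K \<subseteq> M'" by (auto simp: maximal_subgroup_def)
        have "x \<in> M'" if "x \<in> M" for x
          using mem[OF _ subgroup.mem_carrier[OF M(1) that] M(3,4)] imageI[OF that, of \<pi>] unfolding eq .
        moreover have "x \<in> M" if "x \<in> M'" for x
          using mem[OF _ subgroup.mem_carrier[OF M(3) that] M(1,2)] imageI[OF that, of \<pi>] unfolding eq .
        ultimately show "M = M'" by blast
      qed
      show "(\<lambda>M. \<pi> ` M) ` {M \<in> ?Max K. \<not> A \<subseteq> M} \<subseteq> ?S"
      proof (intro image_subsetI CollectI conjI ballI)
        fix M assume M': "M \<in> {M \<in> ?Max K. \<not> A \<subseteq> M}"
        then have M: "subgroup M G" "K \<subseteq> M" "\<not> A \<subseteq> M"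
          and max: "\<And>L. \<lbrakk>subgroup L G; M \<subseteq> L\<rbrakk> \<Longrightarrow> L = M \<or> L = carrier G"
          by (auto simp: maximal_subgroup_def)
        interpret M: subgroup M G using M(1) .
        show "subgroup (\<pi> ` M) ?Q" by (rule \<pi>.subgroup_img_is_subgroup[OF M(1)])
        have "A <#> M = carrier G"
        proof -
          have "subgroup (A <#> M) G" using mult_norm_subgroup[OF A.normal_axioms M(1)] .
          then show ?thesis
            using max[of "A <#> M"] M(3) subset_set_mult[OF A.subgroup_axioms M(1)] by blast
        qed
        then have AM: "\<exists>a\<in>A. \<exists>m\<in>M. g = a \<otimes> m" if "g \<in> carrier G" for g
          using that unfolding \<open>A <#> M = carrier G\<close>[symmetric] set_mult_def by blast
        \<comment> \<open>M normalises the intersection because A is normal, and A does because A is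
          abelian modulo K and K lies in M. As G = AM, the intersection is normal, and minimality of
          A leaves only K.\<close>
        have "A \<inter> M \<lhd> G"
        proof (rule normal_invI)
          show "subgroup (A \<inter> M) G" by (rule subgroups_Inter_pair[OF A.subgroup_axioms M(1)])
          fix g x assume g: "g \<in> carrier G" and x: "x \<in> A \<inter> M"
          obtain a m where am: "a \<in> A" "m \<in> M" "g = a \<otimes> m" using AM[OF g] by blast
          define y where "y = m \<otimes> x \<otimes> inv m"
          have y: "y \<in> A" "y \<in> M" using x am by (auto simp: y_def A.inv_op_closed2)
          have y\<pi>: "\<pi> y \<in> carrier ?Q" using \<pi>.hom_closed[OF A.mem_carrier[OF y(1)]] .
          have a\<pi>: "\<pi> a \<in> carrier ?Q" using \<pi>.hom_closed[OF A.mem_carrier[OF am(1)]] .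
          have "\<pi> (a \<otimes> y \<otimes> inv a) = \<pi> a \<otimes>\<^bsub>?Q\<^esub> \<pi> y \<otimes>\<^bsub>?Q\<^esub> inv\<^bsub>?Q\<^esub> \<pi> a" using am y by simp
          also have "\<pi> a \<otimes>\<^bsub>?Q\<^esub> \<pi> y = \<pi> y \<otimes>\<^bsub>?Q\<^esub> \<pi> a" by (rule A_comm[OF am(1) y(1)])
          also have "\<dots> \<otimes>\<^bsub>?Q\<^esub> inv\<^bsub>?Q\<^esub> \<pi> a = \<pi> y"
            using Q.m_assoc[OF y\<pi> a\<pi> Q.inv_closed[OF a\<pi>]] Q.r_inv[OF a\<pi>] Q.r_one[OF y\<pi>] by simp
          finally have "\<pi> (a \<otimes> y \<otimes> inv a) \<in> \<pi> ` M" using y(2) by (rule image_eqI)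
          then have "a \<otimes> y \<otimes> inv a \<in> M"
            by (rule mem[OF _ _ M(1,2)]) (use am y in simp)
          moreover have "a \<otimes> y \<otimes> inv a \<in> A" using am y by simp
          moreover have "g \<otimes> x \<otimes> inv g = a \<otimes> y \<otimes> inv a"
            using am x by (simp add: y_def inv_mult_group m_assoc)
          ultimately show "g \<otimes> x \<otimes> inv g \<in> A \<inter> M" by simp
        qed
        then have AMK: "A \<inter> M = K" using minimalA[of "A \<inter> M"] M KA by blast
        show "\<pi> ` M \<inter> B = {\<one>\<^bsub>?Q\<^esub>}"
        proof -
          have "q = \<one>\<^bsub>?Q\<^esub>" if "q \<in> \<pi> ` M" "q \<in> B" for q
          proof -
            from that(1) obtain m where m: "m \<in> M" "q = \<pi> m" by blast
            have "\<pi> m \<in> \<pi> ` A" using that(2) unfolding B_def m(2) .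
            then have "m \<in> A" by (rule mem[OF _ M.mem_carrier[OF m(1)] A.subgroup_axioms KA(1)])
            then have "m \<in> K" using m(1) AMK by blast
            then show ?thesis using ker[OF M.mem_carrier[OF m(1)]] m(2) by simp
          qed
          moreover have "\<one>\<^bsub>?Q\<^esub> \<in> \<pi> ` M" using \<pi>.hom_one[symmetric] M.one_closed by (rule image_eqI)
          moreover have "\<one>\<^bsub>?Q\<^esub> \<in> B" by (rule B.one_closed)
          ultimately show ?thesis by blast
        qed
        fix q assume "q \<in> carrier ?Q"
        then obtain g where g: "g \<in> carrier G" "q = \<pi> g" unfolding surj[symmetric] by blast
        obtain a m where am: "a \<in> A" "m \<in> M" "g = a \<otimes> m" using AM[OF g(1)] by blast
        then have m: "m = inv a \<otimes> g" by (simp add: m_assoc[symmetric])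
        have "inv\<^bsub>?Q\<^esub> \<pi> a \<otimes>\<^bsub>?Q\<^esub> q = \<pi> m" unfolding m using am(1) g by simp
        then have "inv\<^bsub>?Q\<^esub> \<pi> a \<otimes>\<^bsub>?Q\<^esub> q \<in> \<pi> ` M" using am(2) by (rule image_eqI)
        then show "\<exists>b\<in>B. inv\<^bsub>?Q\<^esub> b \<otimes>\<^bsub>?Q\<^esub> q \<in> \<pi> ` M"
          unfolding B_def by (rule bexI) (rule imageI[OF am(1)])
      qed
    qed
    then have "card {M \<in> ?Max K. \<not> A \<subseteq> M} * card B \<le> (card B - 1) * card (carrier ?Q)"
      using S by (meson le_trans mult_le_mono1)
    moreover have "card (?Max K) \<le> card (?Max A) + card {M \<in> ?Max K. \<not> A \<subseteq> M}"
    proof -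
      have "?Max K \<subseteq> ?Max A \<union> {M \<in> ?Max K. \<not> A \<subseteq> M}" by blast
      then have "card (?Max K) \<le> card (?Max A \<union> {M \<in> ?Max K. \<not> A \<subseteq> M})"
        by (rule card_mono[rotated]) (rule finite_UnI[OF finMax[of A] finite_subset[OF _ finMax[of K]]], blast)
      then show ?thesis using card_Un_le le_trans by blast
    qed
    moreover have cA: "card B * card K = card A"
    proof -
      have "{x \<in> A. \<pi> x = \<one>\<^bsub>?Q\<^esub>} = {x \<in> A. x \<in> K}" using ker[OF A.mem_carrier] by (rule Collect_cong[OF conj_cong[OF refl]])
      then have "{x \<in> A. \<pi> x = \<one>\<^bsub>?Q\<^esub>} = K" using KA(1) by blast
      then show ?thesis using \<pi>.card_image_mult_card_kernel[OF A.subgroup_axioms finA] unfolding B_def by simp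
    qed
    moreover have cG: "card (carrier ?Q) * card K = card (carrier G)"
    proof -
      have "{x \<in> carrier G. \<pi> x = \<one>\<^bsub>?Q\<^esub>} = {x \<in> carrier G. x \<in> K}"
        using ker by (rule Collect_cong[OF conj_cong[OF refl]])
      then have "{x \<in> carrier G. \<pi> x = \<one>\<^bsub>?Q\<^esub>} = K" using K.subset by blast
      then show ?thesis using \<pi>.card_image_mult_card_kernel[OF subgroup_self fin] surj by simp
    qed
    moreover have "(card (?Max A) + 1) * card A \<le> card (carrier G)"
    proof (rule less.hyps[OF _ A.normal_axioms])
      have "card K < card A" using KA psubset_card_mono[OF finA] by blast
      moreover have "card A \<le> card (carrier G)" using card_mono[OF fin A.subset] .
      ultimately show "card (carrier G) - card A < card (carrier G) - card K" by linarith
    qed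
    moreover have "card K > 0" using K.one_closed K.subset fin finite_subset card_gt_0_iff by blast
    moreover have "card B > 0" using cA A.one_closed finA by (metis card_gt_0_iff empty_iff mult_0 gr0I)
    ultimately show ?thesis
    proof -
      define k where "k = card K"
      define b where "b = card B"
      define q where "q = card (carrier ?Q)"
      define x where "x = card (?Max A)"
      define y where "y = card {M \<in> ?Max K. \<not> A \<subseteq> M}"
      assume a: "card {M \<in> ?Max K. \<not> A \<subseteq> M} * card B \<le> (card B - 1) * card (carrier ?Q)"
        "card (?Max K) \<le> card (?Max A) + card {M \<in> ?Max K. \<not> A \<subseteq> M}"
        "(card (?Max A) + 1) * card A \<le> card (carrier G)" "card K > 0" "card B > 0"
      have 1: "y * b \<le> (b - 1) * q" "k > 0" "b > 0" using a by (simp_all add: k_def b_def q_def y_def)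
      have "(x + 1) * b * k \<le> q * k" 
        using a(3) unfolding cA[symmetric] cG[symmetric] k_def b_def q_def x_def by (simp only: mult.assoc)
      then have 2: "(x + 1) * b \<le> q" using 1(2) by simp
      \<comment> \<open>This is b (x + 1) + b y \<le> q + (b - 1) q.\<close>
      have "b * (x + y + 1) \<le> b * q"
        using 1 2 by (cases b) (auto simp: algebra_simps)
      then have "x + y + 1 \<le> q" unfolding nat_mult_le_cancel1[OF 1(3)] .
      then have "card (?Max K) + 1 \<le> q" using a(2) by (simp add: x_def y_def)
      then have "(card (?Max K) + 1) * k \<le> q * k" by (rule mult_le_mono1)
      then show ?thesis using cG by (simp add: k_def q_def)
    qed
  qed
qed

theorem (in group) card_maximal_subgroups_less:
  assumes "finite (carrier G)" "solvable G"
  shows "card {M. maximal_subgroup M} < card (carrier G)"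
proof -
  have "{M. maximal_subgroup M \<and> {\<one>} \<subseteq> M} = {M. maximal_subgroup M}"
    by (auto simp: maximal_subgroup_def subgroup.one_closed)
  then show ?thesis
    using card_maximal_subgroups_containing[OF assms one_is_normal] by simp
qed

section \<open>Linear characters\<close>

context group
begin

definition chars :: "'a set \<Rightarrow> ('a \<Rightarrow> complex) set"
  where "chars M = {\<chi>. (\<forall>m\<in>M. \<forall>n\<in>M. \<chi> (m \<otimes> n) = \<chi> m * \<chi> n) \<and>
    (\<forall>m\<in>M. cmod (\<chi> m) = 1) \<and> (\<forall>x. x \<notin> M \<longrightarrow> \<chi> x = 0)}"

definition char_group :: "'a set \<Rightarrow> ('a \<Rightarrow> complex) monoid"
  where "char_group M = \<lparr>carrier = chars M, mult = (\<lambda>\<chi> \<psi> x. \<chi> x * \<psi> x), one = indicator M\<rparr>"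

text \<open>Conjugation n |-> n^h is a right action, so composing characters with it gives a left
  action, as a module requires.\<close>

definition char_act :: "'a set \<Rightarrow> 'a \<Rightarrow> ('a \<Rightarrow> complex) \<Rightarrow> 'a \<Rightarrow> complex"
  where "char_act M h \<chi> = (\<lambda>m. if m \<in> M then \<chi> (cj m h) else 0)"

definition char_cocycles :: "'a set \<Rightarrow> 'a set \<Rightarrow> ('a \<Rightarrow> 'a \<Rightarrow> complex) set"
  where "char_cocycles H M = {z \<in> H \<rightarrow>\<^sub>E chars M.
    \<forall>g\<in>H. \<forall>h\<in>H. \<forall>m\<in>M. z (g \<otimes> h) m = z g m * z h (cj m g)}"

lemma cj_mult:
  "\<lbrakk>m \<in> carrier G; n \<in> carrier G; h \<in> carrier G\<rbrakk> \<Longrightarrow> cj (m \<otimes> n) h = cj m h \<otimes> cj n h"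
  using m_assoc[of h "inv h" "n \<otimes> h"] by (simp add: cj_def m_assoc)

lemma cj_cj:
  "\<lbrakk>m \<in> carrier G; g \<in> carrier G; h \<in> carrier G\<rbrakk> \<Longrightarrow> cj (cj m g) h = cj m (g \<otimes> h)"
  by (simp add: cj_def m_assoc inv_mult_group)

lemma cj_one [simp]: "m \<in> carrier G \<Longrightarrow> cj m \<one> = m" "h \<in> carrier G \<Longrightarrow> cj \<one> h = \<one>"
  by (simp_all add: cj_def)

lemma cj_in_carrier [simp]: "\<lbrakk>m \<in> carrier G; h \<in> carrier G\<rbrakk> \<Longrightarrow> cj m h \<in> carrier G"
  by (simp add: cj_def)

lemma chars_mult: "\<lbrakk>\<chi> \<in> chars M; m \<in> M; n \<in> M\<rbrakk> \<Longrightarrow> \<chi> (m \<otimes> n) = \<chi> m * \<chi> n"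
  and chars_norm: "\<lbrakk>\<chi> \<in> chars M; m \<in> M\<rbrakk> \<Longrightarrow> cmod (\<chi> m) = 1"
  and chars_outside: "\<lbrakk>\<chi> \<in> chars M; x \<notin> M\<rbrakk> \<Longrightarrow> \<chi> x = 0"
  unfolding chars_def by blast+

lemma chars_mult_cnj: "\<lbrakk>\<chi> \<in> chars M; m \<in> M\<rbrakk> \<Longrightarrow> \<chi> m * cnj (\<chi> m) = 1"
  using chars_norm complex_norm_square[of "\<chi> m"] by (metis mult_1 of_real_1 power2_eq_square)

lemma chars_one:
  assumes "subgroup M G" "\<chi> \<in> chars M"
  shows "\<chi> \<one> = 1"
proof -
  have 1: "\<one> \<in> M" using assms(1) by (rule subgroup.one_closed)
  have "\<chi> \<one> * \<chi> \<one> = \<chi> \<one> * 1" using chars_mult[OF assms(2) 1 1] by simp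
  moreover have "\<chi> \<one> \<noteq> 0" using chars_norm[OF assms(2) 1] by auto
  ultimately show ?thesis by (simp del: mult_1_right)
qed

lemma char_group_comm_group:
  assumes M: "subgroup M G"
  shows "comm_group (char_group M)"
proof (rule comm_groupI)
  show "\<exists>\<psi>\<in>carrier (char_group M). \<psi> \<otimes>\<^bsub>char_group M\<^esub> \<chi> = \<one>\<^bsub>char_group M\<^esub>"
    if "\<chi> \<in> carrier (char_group M)" for \<chi>
  proof (rule bexI)
    have chi: "\<chi> \<in> chars M" using that by (simp add: char_group_def)
    show "(\<lambda>x. cnj (\<chi> x)) \<in> carrier (char_group M)"
      using chi by (auto simp: char_group_def chars_def)
    show "(\<lambda>x. cnj (\<chi> x)) \<otimes>\<^bsub>char_group M\<^esub> \<chi> = \<one>\<^bsub>char_group M\<^esub>"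
    proof
      fix x
      show "((\<lambda>x. cnj (\<chi> x)) \<otimes>\<^bsub>char_group M\<^esub> \<chi>) x = \<one>\<^bsub>char_group M\<^esub> x"
        using chars_mult_cnj[OF chi, of x] chars_outside[OF chi, of x]
        by (cases "x \<in> M") (simp_all add: char_group_def mult.commute)
    qed
  qed
  show "\<one>\<^bsub>char_group M\<^esub> \<otimes>\<^bsub>char_group M\<^esub> \<chi> = \<chi>" if "\<chi> \<in> carrier (char_group M)" for \<chi>
  proof
    fix x
    have chi: "\<chi> \<in> chars M" using that by (simp add: char_group_def)
    show "(\<one>\<^bsub>char_group M\<^esub> \<otimes>\<^bsub>char_group M\<^esub> \<chi>) x = \<chi> x"
      using chars_outside[OF chi, of x] by (cases "x \<in> M") (simp_all add: char_group_def)
  qed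
qed (use M in \<open>auto simp: char_group_def chars_def norm_mult indicator_def subgroup.m_closed fun_eq_iff\<close>)

lemma sum_translate:
  assumes "subgroup M G" "a \<in> M"
  shows "(\<Sum>m\<in>M. f (a \<otimes> m)) = (\<Sum>m\<in>M. f m)"
proof (rule sum.reindex_bij_witness[of _ "\<lambda>m. inv a \<otimes> m" "\<lambda>m. a \<otimes> m"])
  have [simp]: "m \<in> M \<Longrightarrow> m \<in> carrier G" for m using assms(1) subgroup.mem_carrier by metis
  note [simp] = subgroup.m_closed[OF assms(1)] subgroup.m_inv_closed[OF assms(1)] assms(2)
  show "inv a \<otimes> (a \<otimes> m) = m" if "m \<in> M" for m using that by (simp add: m_assoc[symmetric])
  show "a \<otimes> (inv a \<otimes> m) = m" if "m \<in> M" for m using that by (simp add: m_assoc[symmetric])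
qed (use assms in \<open>auto simp: subgroup.m_closed subgroup.m_inv_closed\<close>)

lemma chars_orthogonal:
  assumes M: "subgroup M G" and chi: "\<chi> \<in> chars M" and psi: "\<psi> \<in> chars M"
  shows "(\<Sum>m\<in>M. \<chi> m * cnj (\<psi> m)) = (if \<chi> = \<psi> then of_nat (card M) else 0)"
proof (cases "\<chi> = \<psi>")
  case True
  then show ?thesis using chars_mult_cnj[OF psi] by simp
next
  case False
  then obtain a where a: "\<chi> a \<noteq> \<psi> a" by blast
  then have aM: "a \<in> M" using chars_outside chi psi by metis
  let ?S = "\<Sum>m\<in>M. \<chi> m * cnj (\<psi> m)"
  have "?S = (\<Sum>m\<in>M. \<chi> (a \<otimes> m) * cnj (\<psi> (a \<otimes> m)))"
    using sum_translate[OF M aM, of "\<lambda>m. \<chi> m * cnj (\<psi> m)"] by simp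
  also have "\<dots> = (\<Sum>m\<in>M. \<chi> a * cnj (\<psi> a) * (\<chi> m * cnj (\<psi> m)))"
    using aM by (intro sum.cong refl) (simp add: chars_mult[OF chi] chars_mult[OF psi])
  also have "\<dots> = \<chi> a * cnj (\<psi> a) * ?S" by (simp add: sum_distrib_left)
  finally have "(1 - \<chi> a * cnj (\<psi> a)) * ?S = 0" by (simp add: algebra_simps)
  moreover have "\<chi> a * cnj (\<psi> a) \<noteq> 1"
  proof
    assume "\<chi> a * cnj (\<psi> a) = 1"
    then have "\<chi> a * (\<psi> a * cnj (\<psi> a)) = \<psi> a" by (simp add: mult.left_commute)
    then show False using a chars_mult_cnj[OF psi aM] by simp
  qed
  ultimately show ?thesis using False by simp
qed

text \<open>Orthogonality leaves the diagonal terms only. For arbitrary finite X this bounds the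
  number of characters; for a subgroup X it computes the size of its annihilator.\<close>

lemma sum_chars_norm_square:
  assumes M: "subgroup M G" and X: "finite X" "X \<subseteq> chars M"
  shows "(\<Sum>m\<in>M. (\<Sum>\<chi>\<in>X. \<chi> m) * cnj (\<Sum>\<chi>\<in>X. \<chi> m)) = of_nat (card X * card M)"
proof -
  have "(\<Sum>m\<in>M. (\<Sum>\<chi>\<in>X. \<chi> m) * cnj (\<Sum>\<chi>\<in>X. \<chi> m)) = (\<Sum>m\<in>M. \<Sum>\<chi>\<in>X. \<Sum>\<psi>\<in>X. \<chi> m * cnj (\<psi> m))"
    by (simp add: sum_product)
  also have "\<dots> = (\<Sum>\<chi>\<in>X. \<Sum>\<psi>\<in>X. \<Sum>m\<in>M. \<chi> m * cnj (\<psi> m))"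
    by (subst sum.swap, intro sum.cong refl, subst sum.swap) simp
  also have "\<dots> = (\<Sum>\<chi>\<in>X. \<Sum>\<psi>\<in>X. if \<psi> = \<chi> then of_nat (card M) else 0)"
    by (intro sum.cong refl) (auto simp: chars_orthogonal[OF M subsetD[OF X(2)] subsetD[OF X(2)]])
  also have "\<dots> = of_nat (card X * card M)" using X(1) by simp
  finally show ?thesis .
qed

text \<open>In the sum of squared norms of the sum of X, the term at the identity is already |X|^2,
  while the total is |X| |M|. The argument is run for every finite X, because finiteness of the
  whole set is part of the conclusion.\<close>

lemma card_chars:
  assumes M: "subgroup M G" "finite M"
  shows "finite (chars M)" "card (chars M) \<le> card M"
proof -
  have le: "card X \<le> card M" if X: "finite X" "X \<subseteq> chars M" for X
  proof -
    let ?s = "\<lambda>m. \<Sum>\<chi>\<in>X. \<chi> m"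
    have "(\<Sum>m\<in>M. (cmod (?s m))\<^sup>2) = real (card X * card M)"
    proof -
      have "complex_of_real (\<Sum>m\<in>M. (cmod (?s m))\<^sup>2) = of_nat (card X * card M)"
        using sum_chars_norm_square[OF M(1) X] by (simp only: complex_norm_square of_real_sum)
      then show ?thesis by (metis of_real_eq_iff of_real_of_nat_eq)
    qed
    moreover have "(cmod (?s \<one>))\<^sup>2 \<le> (\<Sum>m\<in>M. (cmod (?s m))\<^sup>2)"
      by (rule member_le_sum) (use M subgroup.one_closed in auto)
    moreover have "?s \<one> = (\<Sum>\<chi>\<in>X. 1)"
      by (intro sum.cong refl chars_one[OF M(1)] subsetD[OF X(2)])
    ultimately have "real (card X * card X) \<le> real (card X * card M)"
      by (simp add: power2_eq_square)
    then have "card X * card X \<le> card X * card M" by (simp only: of_nat_le_iff)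
    then show ?thesis by (cases "card X = 0") auto
  qed
  show fin: "finite (chars M)"
  proof (rule ccontr)
    assume "infinite (chars M)"
    then obtain X where "X \<subseteq> chars M" "finite X" "card X = Suc (card M)"
      using infinite_arbitrarily_large by metis
    then show False using le[of X] by simp
  qed
  show "card (chars M) \<le> card M" using le[OF fin] by simp
qed

text \<open>The sum of all members of X equals |X| on the annihilator and 0 elsewhere: multiplying X
  by a member that is not 1 at m permutes X but rescales the sum. Hence |X| |M| = |X|^2 times the
  size of the annihilator.\<close>

lemma card_annihilator:
  assumes M: "subgroup M G" "finite M" and X: "subgroup X (char_group M)"
  shows "card X * card {m \<in> M. \<forall>\<chi>\<in>X. \<chi> m = 1} = card M"
proof -
  interpret V: comm_group "char_group M" using char_group_comm_group[OF M(1)] .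
  have Xc: "X \<subseteq> chars M" using subgroup.subset[OF X] by (simp add: char_group_def)
  have finX: "finite X" using finite_subset[OF Xc card_chars(1)[OF M]] .
  let ?A = "{m \<in> M. \<forall>\<chi>\<in>X. \<chi> m = 1}"
  let ?s = "\<lambda>m. \<Sum>\<chi>\<in>X. \<chi> m"
  have zero: "?s m = 0" if m: "m \<in> M" "\<chi>0 \<in> X" "\<chi>0 m \<noteq> 1" for m \<chi>0
  proof -
    have "(\<Sum>\<chi>\<in>X. (\<chi>0 \<otimes>\<^bsub>char_group M\<^esub> \<chi>) m) = ?s m"
      using V.sum_translate[OF X m(2), of "\<lambda>\<chi>. \<chi> m"] .
    then have "\<chi>0 m * ?s m = ?s m" by (simp add: char_group_def sum_distrib_left)
    then show ?thesis using m(3) by simp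
  qed
  have "of_nat (card X * card M) = (\<Sum>m\<in>M. ?s m * cnj (?s m))"
    using sum_chars_norm_square[OF M(1) finX Xc] by simp
  also have "\<dots> = (\<Sum>m\<in>?A. ?s m * cnj (?s m))"
    by (rule sum.mono_neutral_right) (use M(2) zero in auto)
  also have "\<dots> = (\<Sum>m\<in>?A. of_nat (card X * card X))"
  proof (intro sum.cong refl)
    fix m assume "m \<in> ?A"
    then have "?s m = (\<Sum>\<chi>\<in>X. 1)" by (intro sum.cong refl) blast
    then show "?s m * cnj (?s m) = of_nat (card X * card X)" by simp
  qed
  also have "\<dots> = (of_nat (card X * (card X * card ?A)) :: complex)" by simp
  finally have "card X * card M = card X * (card X * card ?A)" by (simp only: of_nat_eq_iff)
  moreover have "card X \<noteq> 0" using subgroup.one_closed[OF X] finX by auto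
  ultimately show ?thesis by simp
qed

lemma char_act_module:
  assumes M: "subgroup M G" "finite M" and H: "subgroup H G" "finite H"
    and inv: "\<And>m h. \<lbrakk>m \<in> M; h \<in> H\<rbrakk> \<Longrightarrow> cj m h \<in> M"
  shows "finite_module (G\<lparr>carrier := H\<rparr>) (char_group M) (char_act M)"
proof -
  interpret V: comm_group "char_group M" using char_group_comm_group[OF M(1)] .
  interpret H: group "G\<lparr>carrier := H\<rparr>" using subgroup_imp_group[OF H(1)] .
  have [simp]: "m \<in> M \<Longrightarrow> m \<in> carrier G" "h \<in> H \<Longrightarrow> h \<in> carrier G" for m h
    using M(1) H(1) subgroup.mem_carrier by metis+
  show ?thesis
    by unfold_locales
      (auto simp: H(2) card_chars(1)[OF M, unfolded chars_def] char_group_def char_act_def chars_def fun_eq_iff inv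
        cj_mult subgroup.m_closed[OF M(1)] cj_cj)
qed

text \<open>Minimality of M passes to irreducibility of its character group through annihilators:
  that of an invariant subgroup X is an H-invariant subgroup of M. If it is trivial, then |X| = |M|,
  so X contains all characters; if it is M, then |X| = 1.\<close>

lemma card_char_cocycles_le:
  assumes M: "subgroup M G" "finite M" "M \<noteq> {\<one>}" and H: "subgroup H G" "finite H"
    and solv: "solvable (G\<lparr>carrier := H\<rparr>)"
    and inv: "\<And>m h. \<lbrakk>m \<in> M; h \<in> H\<rbrakk> \<Longrightarrow> cj m h \<in> M"
    and minimal: "\<And>X. \<lbrakk>subgroup X G; X \<subseteq> M; \<And>m h. \<lbrakk>m \<in> X; h \<in> H\<rbrakk> \<Longrightarrow> cj m h \<in> X\<rbrakk> \<Longrightarrow> X = {\<one>} \<or> X = M"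
  shows "finite (char_cocycles H M)" "card (char_cocycles H M) \<le> (card M - 1) * card H"
proof -
  interpret W: finite_module "G\<lparr>carrier := H\<rparr>" "char_group M" "char_act M"
    by (rule char_act_module[OF M(1,2) H inv])
  have MG [simp]: "m \<in> M \<Longrightarrow> m \<in> carrier G" for m
    using M(1) subgroup.mem_carrier by metis
  have HG [simp]: "h \<in> H \<Longrightarrow> h \<in> carrier G" for h
    using H(1) subgroup.mem_carrier by metis
  have irr: W.irreducible_module
    unfolding W.irreducible_module_def
  proof (intro allI impI)
    fix X assume X: "subgroup X (char_group M)"
      "\<forall>h\<in>carrier (G\<lparr>carrier := H\<rparr>). \<forall>\<chi>\<in>X. char_act M h \<chi> \<in> X"
    have Xc: "X \<subseteq> chars M" using subgroup.subset[OF X(1)] by (simp add: char_group_def)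
    let ?A = "{m \<in> M. \<forall>\<chi>\<in>X. \<chi> m = 1}"
    note card = card_annihilator[OF M(1,2) X(1)]
    have "?A = {\<one>} \<or> ?A = M"
    proof (rule minimal)
      show "subgroup ?A G"
      proof (rule subgroupI)
        show "?A \<subseteq> carrier G" by auto
        show "?A \<noteq> {}" using subgroup.one_closed[OF M(1)] chars_one[OF M(1)] Xc by blast
        show "a \<otimes> b \<in> ?A" if "a \<in> ?A" "b \<in> ?A" for a b
        proof -
          have "\<chi> (a \<otimes> b) = 1" if "\<chi> \<in> X" for \<chi>
            using chars_mult[OF subsetD[OF Xc that], of a b] \<open>a \<in> ?A\<close> \<open>b \<in> ?A\<close> that by auto
          then show ?thesis
            using \<open>a \<in> ?A\<close> \<open>b \<in> ?A\<close> subgroup.m_closed[OF M(1), of a b] by simp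
        qed
        show "inv a \<in> ?A" if a: "a \<in> ?A" for a
        proof -
          have ia: "inv a \<in> M" using a subgroup.m_inv_closed[OF M(1)] by auto
          have "\<chi> (inv a) = 1" if "\<chi> \<in> X" for \<chi>
            using a that ia chars_mult[OF subsetD[OF Xc that], of a "inv a"]
              chars_one[OF M(1) subsetD[OF Xc that]] by auto
          then show ?thesis using ia by blast
        qed
      qed
      show "?A \<subseteq> M" by blast
      fix m h assume m: "m \<in> ?A" and h: "h \<in> H"
      have "\<chi> (cj m h) = 1" if "\<chi> \<in> X" for \<chi>
      proof -
        have "char_act M h \<chi> \<in> X" using X(2) h that by simp
        then have "char_act M h \<chi> m = 1" using m by blast
        then show ?thesis using m by (simp add: char_act_def)
      qed
      then show "cj m h \<in> ?A" using m h inv by simp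
    qed
    then show "X = {\<one>\<^bsub>char_group M\<^esub>} \<or> X = carrier (char_group M)"
    proof
      assume "?A = {\<one>}"
      then have "card X = card M" using card by simp
      then have "card (chars M) \<le> card X" using card_chars(2)[OF M(1,2)] by simp
      then have "X = chars M" using card_seteq[OF card_chars(1)[OF M(1,2)] Xc] by simp
      then show ?thesis by (simp add: char_group_def)
    next
      assume "?A = M"
      then have "card X * card M = card M" using card by simp
      moreover have "card M \<noteq> 0" using M(2) subgroup.one_closed[OF M(1)] by auto
      ultimately have "card X = 1" by simp
      then show ?thesis using subgroup.one_closed[OF X(1)] by (metis card_1_singletonE singletonD)
    qed
  qed
  \<comment> \<open>The value at \<open>\<one>\<close> is idempotent and of modulus one on M, hence
    neutral; so the trivial subgroup can serve as the K of \<open>card_cocycles_le\<close>.\<close>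
  have sub: "char_cocycles H M \<subseteq> W.cocycles {\<one>}"
  proof
    fix z assume z: "z \<in> char_cocycles H M"
    have zc: "z h \<in> chars M" if "h \<in> H" for h using z that by (auto simp: char_cocycles_def)
    have zm: "z (g \<otimes> h) m = z g m * z h (cj m g)" if "g \<in> H" "h \<in> H" "m \<in> M" for g h m
      using z that by (simp add: char_cocycles_def)
    have 1: "\<one> \<in> H" using H(1) by (rule subgroup.one_closed)
    have "z \<one> m = indicator M m" for m
    proof (cases "m \<in> M")
      case True
      have "z \<one> m * z \<one> m = z \<one> m" using zm[OF 1 1 True] True by simp
      moreover have "z \<one> m \<noteq> 0" using chars_norm[OF zc[OF 1] True] by auto
      ultimately show ?thesis using True by simp
    qed (use chars_outside[OF zc[OF 1]] in auto)
    moreover have "z (g \<otimes> h) m = z g m * char_act M g (z h) m" if "g \<in> H" "h \<in> H" for g h m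
      using that zm[OF that, of m] chars_outside[OF zc, of _ m] subgroup.m_closed[OF H(1)]
      by (cases "m \<in> M") (auto simp: char_act_def)
    ultimately show "z \<in> W.cocycles {\<one>}"
      unfolding W.cocycles_iff using z
      by (auto simp: char_group_def char_cocycles_def fun_eq_iff)
  qed
  then show fin: "finite (char_cocycles H M)" using W.finite_cocycles finite_subset by blast
  have M2: "2 \<le> card M"
  proof -
    have "{\<one>} \<subset> M" using M(1,3) subgroup.one_closed by blast
    then show ?thesis using psubset_card_mono[OF M(2), of "{\<one>}"] by simp
  qed
  have H1: "1 \<le> card H" using H subgroup.one_closed by (metis One_nat_def Suc_leI card_gt_0_iff empty_iff)
  show "card (char_cocycles H M) \<le> (card M - 1) * card H"
  proof (cases "carrier (char_group M) = {\<one>\<^bsub>char_group M\<^esub>}")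
    case True
    \<comment> \<open>A perfect M has only the trivial character. Then there is at most one cocycle,
      and |M| \<ge> 2 makes the bound at least 1.\<close>
    have "W.cocycles {\<one>} \<subseteq> H \<rightarrow>\<^sub>E {\<one>\<^bsub>char_group M\<^esub>}"
      unfolding W.cocycles_def True by auto
    then have "card (W.cocycles {\<one>}) \<le> card (H \<rightarrow>\<^sub>E {\<one>\<^bsub>char_group M\<^esub>})"
      using H(2) by (intro card_mono finite_PiE) auto
    also have "\<dots> = 1" using H(2) by (simp add: card_PiE)
    finally have "card (char_cocycles H M) \<le> 1"
      using card_mono[OF W.finite_cocycles sub] by linarith
    also have "1 \<le> (card M - 1) * card H" using mult_le_mono[of 1 "card M - 1" 1 "card H"] M2 H1 by simp
    finally show ?thesis .
  next
    case False
    have "{\<one>} \<lhd> G\<lparr>carrier := H\<rparr>" using group.one_is_normal[OF W.H.group_axioms] by simp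
    moreover have "{\<one>} \<subseteq> W.acts_trivially"
      using W.act_id subgroup.one_closed[OF H(1)] by (auto simp: W.acts_trivially_def)
    ultimately have "card (W.cocycles {\<one>}) \<le> (card (chars M) - 1) * card H"
      using W.card_cocycles_le[OF irr solv _ _ False, of "{\<one>}"] by (simp add: char_group_def)
    also have "\<dots> \<le> (card M - 1) * card H"
      using card_chars(2)[OF M(1,2)] by (intro mult_le_mono1) linarith
    finally show ?thesis using card_mono[OF W.finite_cocycles sub] by linarith
  qed
qed

end

section \<open>Right coideals and their data\<close>

context izumi_kosaki
begin

text \<open>On M each \<open>l h\<close> trivialises the 2-cocycle \<open>\<eta> h\<close>, and the
  dependence on h trivialises \<xi>. For \<eta> = \<xi> = 1 these are exactly the 1-cocycles of K in
  the linear characters of M.\<close>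

definition twisted_chars :: "'a set \<Rightarrow> 'a set \<Rightarrow> ('a \<Rightarrow> 'a \<Rightarrow> complex) set"
  where "twisted_chars M K = {l. (\<forall>h m. h \<notin> K \<or> m \<notin> M \<longrightarrow> l h m = 0) \<and>
    (\<forall>h\<in>K. \<forall>m\<in>M. cmod (l h m) = 1) \<and>
    (\<forall>h\<in>K. \<forall>m\<in>M. \<forall>n\<in>M. l h (m \<otimes> n) * \<eta> h m n = l h m * l h n) \<and>
    (\<forall>h\<in>K. \<forall>k\<in>K. \<forall>m\<in>M. l (h \<otimes> k) m = l h m * l k (cj m h) * \<xi> m h k)}"

text \<open>The last condition says that the component of degree \<open>h\<close> transforms under left translation by
  \<open>M\<close> through \<open>l h\<close>. Elements of \<open>twisted_chars\<close>, like those of \<open>chars\<close>, vanish off their domain,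
  so that counting them as functions is meaningful.\<close>

definition coideal_of :: "'a set \<Rightarrow> 'a set \<Rightarrow> ('a \<Rightarrow> 'a \<Rightarrow> complex) \<Rightarrow> ('a \<times> 'a \<Rightarrow> complex) set"
  where "coideal_of M K l = {a \<in> alg. (\<forall>n h. h \<notin> K \<longrightarrow> a (n, h) = 0) \<and>
    (\<forall>m\<in>M. \<forall>n\<in>N. \<forall>h\<in>K. a (m \<otimes> n, h) * \<eta> h m n = l h m * a (n, h))}"

definition coideal_datum :: "'a set \<Rightarrow> 'a set \<Rightarrow> ('a \<Rightarrow> 'a \<Rightarrow> complex) \<Rightarrow> bool"
  where "coideal_datum M K l \<longleftrightarrow> subgroup M G \<and> M \<subseteq> N \<and> subgroup K G \<and> K \<subseteq> H \<and>
    (\<forall>m\<in>M. \<forall>h\<in>K. cj m h \<in> M) \<and> l \<in> twisted_chars M K"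

section \<open>The structure maps in coordinates\<close>

lemma subgroup_N: "subgroup N G"
  using normal_N by (rule normal_imp_subgroup)

lemma N_carrier [simp]: "n \<in> N \<Longrightarrow> n \<in> carrier G"
  using subgroup.mem_carrier[OF subgroup_N] .

lemma H_carrier [simp]: "h \<in> H \<Longrightarrow> h \<in> carrier G"
  using subgroup.mem_carrier[OF subgroup_H] .

lemmas N_closed [simp] = subgroup.m_closed[OF subgroup_N] subgroup.m_inv_closed[OF subgroup_N]
  subgroup.one_closed[OF subgroup_N]

lemmas H_closed [simp] = subgroup.m_closed[OF subgroup_H] subgroup.m_inv_closed[OF subgroup_H]
  subgroup.one_closed[OF subgroup_H]

lemmas cj_N [simp] = cj_closed

lemmas norm_factor [simp] = eta_one_left eta_one_right xi_one_left xi_one_right eta_one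

lemma cj_cancel [simp]:
  "\<lbrakk>n \<in> N; h \<in> H\<rbrakk> \<Longrightarrow> cj (cj n h) (inv h) = n"
  "\<lbrakk>n \<in> N; h \<in> H\<rbrakk> \<Longrightarrow> cj (cj n (inv h)) h = n"
  by (simp_all add: cj_cj)

lemma eta_nonzero: "\<lbrakk>h \<in> H; m \<in> N; n \<in> N\<rbrakk> \<Longrightarrow> \<eta> h m n \<noteq> 0"
  using eta_U1 by (metis norm_zero zero_neq_one)

lemma xi_nonzero: "\<lbrakk>n \<in> N; h \<in> H; k \<in> H\<rbrakk> \<Longrightarrow> \<xi> n h k \<noteq> 0"
  using xi_U1 by (metis norm_zero zero_neq_one)

lemma pentagon_mult:
  assumes "n1 \<in> N" "n2 \<in> N" "h1 \<in> H" "h2 \<in> H"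
  shows "\<eta> h1 n1 n2 * \<eta> h2 (cj n1 h1) (cj n2 h1) * (\<xi> n1 h1 h2 * \<xi> n2 h1 h2)
    = \<xi> (n1 \<otimes> n2) h1 h2 * \<eta> (h1 \<otimes> h2) n1 n2"
  using pentagon[OF assms] eta_nonzero[of "h1 \<otimes> h2" n1 n2] xi_nonzero[of n1 h1 h2]
    xi_nonzero[of n2 h1 h2] assms by (simp add: field_simps)

text \<open>This normalisation is not among the axioms; it is the pentagon equation at n1 = n2 =
  \<open>\<one>\<close>.\<close>

lemma xi_one_middle [simp]: "\<lbrakk>h \<in> H; k \<in> H\<rbrakk> \<Longrightarrow> \<xi> \<one> h k = 1"
  using pentagon_mult[of \<one> \<one> h k] xi_nonzero[of \<one> h k] by simp

lemma alg_mult_apply: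
  assumes "n \<in> N"
  shows "alg_mult a b (n, g) = (\<Sum>h\<in>H. \<Sum>k\<in>H. if g = h \<otimes> k then a (n, h) * b (cj n h, k) * \<xi> n h k else 0)"
  using assms by (simp add: alg_mult_def sum_apply homog_def cj_fun_def)

lemma alg_mult_closed: "alg_mult a b \<in> alg"
  by (auto simp: alg_def alg_mult_def sum_apply homog_def intro!: sum.neutral)

lemma alg_star_apply:
  assumes "n \<in> N" "h \<in> H"
  shows "alg_star a (n, h) = cnj (a (cj n h, inv h) * \<xi> (cj n h) (inv h) h)"
proof -
  have "alg_star a (n, h) = (\<Sum>k\<in>H. if k = inv h then cnj (a (cj n (inv k), k) * \<xi> (cj n (inv k)) k (inv k)) else 0)"
    unfolding alg_star_def sum_apply using assms
    by (intro sum.cong refl) (auto simp: homog_def cj_fun_def)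
  then show ?thesis using assms finite_H by simp
qed

lemma alg_star_closed: "alg_star a \<in> alg"
  by (auto simp: alg_def alg_star_def sum_apply homog_def intro!: sum.neutral)

lemma comult_apply:
  "comult a ((n, h), (n2, h2)) =
    (if n \<in> N \<and> n2 \<in> N \<and> h \<in> H \<and> h2 = h then a (n \<otimes> n2, h) * \<eta> h n n2 else 0)"
proof -
  have eq: "m = n \<otimes> n2 \<longleftrightarrow> m \<otimes> inv n2 = n" if "m \<in> N" "n2 \<in> N" "n \<in> N" for m
    using that by (metis N_carrier inv_solve_right inv_closed)
  define T where "T m k = (\<Sum>n2'\<in>N. cscale (\<eta> k (m \<otimes> inv n2') n2')
      (tensor (basis_elt (m \<otimes> inv n2') k) (basis_elt n2' k)))" for m k
  have inner: "T m k ((n, h), (n2, h2))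
      = (if n \<in> N \<and> n2 \<in> N \<and> h = k \<and> h2 = k \<and> m = n \<otimes> n2 then \<eta> h n n2 else 0)"
    if m: "m \<in> N" for m k
  proof -
    have "T m k ((n, h), (n2, h2))
      = (\<Sum>n2'\<in>N. if n2' = n2 then (if h = k \<and> h2 = k \<and> n = m \<otimes> inv n2 then \<eta> h n n2 else 0) else 0)"
      unfolding T_def sum_apply using m
      by (intro sum.cong refl) (auto simp: cscale_def tensor_def basis_elt_eq)
    also have "\<dots> = (if n \<in> N \<and> n2 \<in> N \<and> h = k \<and> h2 = k \<and> m = n \<otimes> n2 then \<eta> h n n2 else 0)"
      using finite_N eq[OF m] m by (auto simp: sum.delta')
    finally show ?thesis .
  qed
  have "comult a ((n, h), (n2, h2)) = (\<Sum>m\<in>N. \<Sum>k\<in>H. a (m, k) * T m k ((n, h), (n2, h2)))"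
    unfolding comult_def T_def[symmetric] by (simp add: sum_apply cscale_def)
  also have "\<dots> = (\<Sum>m\<in>N. \<Sum>k\<in>H. a (m, k) *
      (if n \<in> N \<and> n2 \<in> N \<and> h = k \<and> h2 = k \<and> m = n \<otimes> n2 then \<eta> h n n2 else 0))"
    by (intro sum.cong refl) (simp only: inner)
  also have "\<dots> = (\<Sum>m\<in>N. if m = n \<otimes> n2 then (\<Sum>k\<in>H. if k = h then
      (if n \<in> N \<and> n2 \<in> N \<and> h2 = h then a (m, h) * \<eta> h n n2 else 0) else 0) else 0)"
    by (intro sum.cong refl) (auto intro!: sum.cong sum.neutral)
  also have "\<dots> = (if n \<in> N \<and> n2 \<in> N \<and> h \<in> H \<and> h2 = h then a (n \<otimes> n2, h) * \<eta> h n n2 else 0)"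
    using finite_N finite_H by (auto simp: sum.delta')
  finally show ?thesis .
qed

lemma homog_cong: "(\<And>n. n \<in> N \<Longrightarrow> f n = g n) \<Longrightarrow> homog f h = homog g h"
  by (auto simp: homog_def fun_eq_iff)

lemma homog_in_alg: "h \<in> H \<Longrightarrow> homog f h \<in> alg"
  by (auto simp: homog_def alg_def)

lemma alg_eq_sum_homog:
  assumes "a \<in> alg"
  shows "a = (\<Sum>h\<in>H. homog (\<lambda>n. a (n, h)) h)"
proof
  fix p :: "'a \<times> 'a"
  obtain n k where p: "p = (n, k)" by fastforce
  have "(\<Sum>h\<in>H. homog (\<lambda>n. a (n, h)) h) p = (\<Sum>h\<in>H. if h = k then (if n \<in> N then a (n, k) else 0) else 0)"
    unfolding sum_apply p by (intro sum.cong refl) (auto simp: homog_def)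
  also have "\<dots> = a p" using finite_H assms by (auto simp: p alg_def sum.delta')
  finally show "a p = (\<Sum>h\<in>H. homog (\<lambda>n. a (n, h)) h) p" by simp
qed

section \<open>The right coideal attached to a datum\<close>

lemma twisted_charsD:
  assumes "l \<in> twisted_chars M K"
  shows "\<And>h m. h \<notin> K \<or> m \<notin> M \<Longrightarrow> l h m = 0"
    and "\<And>h m. \<lbrakk>h \<in> K; m \<in> M\<rbrakk> \<Longrightarrow> cmod (l h m) = 1"
    and "\<And>h m n. \<lbrakk>h \<in> K; m \<in> M; n \<in> M\<rbrakk> \<Longrightarrow> l h (m \<otimes> n) * \<eta> h m n = l h m * l h n"
    and "\<And>h k m. \<lbrakk>h \<in> K; k \<in> K; m \<in> M\<rbrakk> \<Longrightarrow> l (h \<otimes> k) m = l h m * l k (cj m h) * \<xi> m h k"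
  using assms unfolding twisted_chars_def by blast+

lemma coideal_datumD:
  assumes "coideal_datum M K l"
  shows "subgroup M G" "M \<subseteq> N" "subgroup K G" "K \<subseteq> H" "\<And>m h. \<lbrakk>m \<in> M; h \<in> K\<rbrakk> \<Longrightarrow> cj m h \<in> M"
    "l \<in> twisted_chars M K" "\<And>h m. \<lbrakk>h \<in> K; m \<in> M\<rbrakk> \<Longrightarrow> l h m \<noteq> 0"
  using assms twisted_charsD(2)[of l M K] unfolding coideal_datum_def by (auto, force)

lemma twisted_char_at_one:
  assumes "coideal_datum M K l" "h \<in> K"
  shows "l h \<one> = 1"
proof -
  note D = coideal_datumD[OF assms(1)]
  have 1: "\<one> \<in> M" using D(1) by (rule subgroup.one_closed)
  have hH: "h \<in> H" using assms(2) D(4) by blast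
  have "l h \<one> * l h \<one> = l h \<one>" using twisted_charsD(3)[OF D(6) assms(2) 1 1] hH by simp
  then show ?thesis using D(7)[OF assms(2) 1] by simp
qed

lemma twisted_char_one:
  assumes "coideal_datum M K l" "m \<in> M"
  shows "l \<one> m = 1"
proof -
  note D = coideal_datumD[OF assms(1)]
  have 1: "\<one> \<in> K" using D(3) by (rule subgroup.one_closed)
  have mN: "m \<in> N" using assms(2) D(2) by blast
  have "l \<one> m * l \<one> m = l \<one> m" using twisted_charsD(4)[OF D(6) 1 1 assms(2)] mN by simp
  then show ?thesis using D(7)[OF 1 assms(2)] by simp
qed

lemma coideal_ofD:
  assumes "a \<in> coideal_of M K l"
  shows "a \<in> alg" "\<And>n h. h \<notin> K \<Longrightarrow> a (n, h) = 0"
    and "\<And>m n h. \<lbrakk>m \<in> M; n \<in> N; h \<in> K\<rbrakk> \<Longrightarrow> a (m \<otimes> n, h) * \<eta> h m n = l h m * a (n, h)"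
  using assms unfolding coideal_of_def by blast+

lemma coideal_ofI:
  assumes "a \<in> alg" "\<And>n h. \<lbrakk>n \<in> N; h \<in> H; h \<notin> K\<rbrakk> \<Longrightarrow> a (n, h) = 0"
    and "\<And>m n h. \<lbrakk>m \<in> M; n \<in> N; h \<in> K\<rbrakk> \<Longrightarrow> a (m \<otimes> n, h) * \<eta> h m n = l h m * a (n, h)"
  shows "a \<in> coideal_of M K l"
proof -
  have "a (n, h) = 0" if "h \<notin> K" for n h
    using assms(1,2) that by (cases "n \<in> N \<and> h \<in> H") (auto simp: alg_def)
  then show ?thesis using assms(1,3) unfolding coideal_of_def by blast
qed

text \<open>Each closure property rests on one identity. Products use the pentagon equation with the
  multiplicativity of l in K, adjoints use the same for h and its inverse, and the coproduct uses
  the cocycle identity of \<eta>.\<close>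

lemma right_coideal_coideal_of:
  assumes "coideal_datum M K l"
  shows "right_coideal (coideal_of M K l)"
  unfolding right_coideal_def
proof (intro conjI ballI image_subsetI)
  note D = coideal_datumD[OF assms]
  note KH [simp] = subsetD[OF D(4)] and MN [simp] = subsetD[OF D(2)]
  note K_closed = subgroup.m_closed[OF D(3)] subgroup.m_inv_closed[OF D(3)]
  let ?B = "coideal_of M K l"
  show "?B \<subseteq> alg" using coideal_ofD(1) by blast
  show sub: "cfun.subspace ?B"
    by (rule cfun.subspaceI)
      (auto simp: coideal_of_def alg_def cscale_def algebra_simps)
  show "alg_one \<in> ?B"
  proof (rule coideal_ofI)
    show "alg_one \<in> alg" by (simp add: alg_one_def homog_in_alg)
    show "alg_one (n, h) = 0" if "h \<notin> K" for n h
      using that subgroup.one_closed[OF D(3)] by (auto simp: alg_one_def homog_def)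
    show "alg_one (m \<otimes> n, h) * \<eta> h m n = l h m * alg_one (n, h)" if "m \<in> M" "n \<in> N" "h \<in> K" for m n h
      using that twisted_char_one[OF assms that(1)] by (auto simp: alg_one_def homog_def)
  qed
  show "alg_mult a b \<in> ?B" if a: "a \<in> ?B" and b: "b \<in> ?B" for a b
  proof (rule coideal_ofI)
    show "alg_mult a b \<in> alg" by (rule alg_mult_closed)
    fix n g assume n: "n \<in> N"
    show "alg_mult a b (n, g) = 0" if "g \<in> H" "g \<notin> K"
      unfolding alg_mult_apply[OF n]
    proof (intro sum.neutral ballI)
      fix h k
      have "h \<notin> K \<or> k \<notin> K" if "g = h \<otimes> k" using that \<open>g \<notin> K\<close> K_closed(1) by blast
      then show "(if g = h \<otimes> k then a (n, h) * b (cj n h, k) * \<xi> n h k else 0) = 0"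
        using coideal_ofD(2)[OF a] coideal_ofD(2)[OF b] by auto
    qed
    fix m assume m: "m \<in> M" and "g \<in> K"
    have term_eq: "a (m \<otimes> n, h) * b (cj (m \<otimes> n) h, k) * \<xi> (m \<otimes> n) h k * \<eta> (h \<otimes> k) m n
        = l (h \<otimes> k) m * (a (n, h) * b (cj n h, k) * \<xi> n h k)" if hk: "h \<in> H" "k \<in> H" for h k
    proof (cases "h \<in> K \<and> k \<in> K")
      case True
      then have hk: "h \<in> K" "k \<in> K" by auto
      have b': "b (cj (m \<otimes> n) h, k) * \<eta> k (cj m h) (cj n h) = l k (cj m h) * b (cj n h, k)"
        using coideal_ofD(3)[OF b, of "cj m h" "cj n h" k] m n hk by (simp add: D(5) cj_mult)
      have "a (m \<otimes> n, h) * b (cj (m \<otimes> n) h, k) * \<xi> (m \<otimes> n) h k * \<eta> (h \<otimes> k) m n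
        = (a (m \<otimes> n, h) * \<eta> h m n) * (b (cj (m \<otimes> n) h, k) * \<eta> k (cj m h) (cj n h)) * (\<xi> m h k * \<xi> n h k)"
        using pentagon_mult[of m n h k] m n hk by (simp add: mult.assoc mult.left_commute)
      also have "\<dots> = (l h m * a (n, h)) * (l k (cj m h) * b (cj n h, k)) * (\<xi> m h k * \<xi> n h k)"
        using coideal_ofD(3)[OF a m n hk(1)] b' by simp
      also have "\<dots> = l (h \<otimes> k) m * (a (n, h) * b (cj n h, k) * \<xi> n h k)"
        using twisted_charsD(4)[OF D(6) hk m] by (simp add: ac_simps)
      finally show ?thesis .
    qed (use coideal_ofD(2)[OF a] coideal_ofD(2)[OF b] in auto)
    have mn: "m \<otimes> n \<in> N" using m n by simp
    show "alg_mult a b (m \<otimes> n, g) * \<eta> g m n = l g m * alg_mult a b (n, g)"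
      unfolding alg_mult_apply[OF n] alg_mult_apply[OF mn] sum_distrib_left sum_distrib_right
      by (intro sum.cong refl) (simp add: term_eq)
  qed
  show "alg_star a \<in> ?B" if a: "a \<in> ?B" for a
  proof (rule coideal_ofI)
    show "alg_star a \<in> alg" by (rule alg_star_closed)
    show "alg_star a (n, h) = 0" if "n \<in> N" "h \<in> H" "h \<notin> K" for n h
    proof -
      have "inv h \<notin> K" using that K_closed(2)[of "inv h"] by auto
      then show ?thesis using that coideal_ofD(2)[OF a] by (simp add: alg_star_apply)
    qed
    fix m n h assume m: "m \<in> M" and n: "n \<in> N" and h: "h \<in> K"
    define p where "p = cj m h"
    define q where "q = cj n h"
    define k where "k = inv h"
    have hH: "h \<in> H" using h by simp
    have k: "k \<in> K" "k \<in> H" using h K_closed(2) unfolding k_def by simp_all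
    have p: "p \<in> M" "p \<in> N" using D(5)[OF m h] unfolding p_def by simp_all
    have q: "q \<in> N" using n hH unfolding q_def by simp
    have pk: "cj p k = m" "cj q k = n" using m n hH by (simp_all add: p_def q_def k_def)
    have kh: "k \<otimes> h = \<one>" using hH by (simp add: k_def)
    have eta: "\<eta> h m n * cnj (\<eta> h m n) = 1"
      using eta_U1[OF hH MN[OF m] n] complex_norm_square[of "\<eta> h m n"] by simp
    have pent: "\<eta> k p q * \<eta> h m n * (\<xi> p k h * \<xi> q k h) = \<xi> (p \<otimes> q) k h"
      using pentagon_mult[OF p(2) q k(2) hH] p q by (simp add: pk kh)
    have aeq: "a (p \<otimes> q, k) * \<eta> k p q = l k p * a (q, k)"
      using coideal_ofD(3)[OF a p(1) q k(1)] .
    \<comment> \<open>The relation for kh = \<open>\<one>\<close> makes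
      \<open>l k p * \<xi> p k h\<close> the inverse of \<open>l h m\<close>; all moduli being one,
      its conjugate is \<open>l h m\<close>.\<close>
    have "l k p * l h m * \<xi> p k h = 1"
      using twisted_charsD(4)[OF D(6) k(1) h p(1)] twisted_char_one[OF assms p(1)] by (simp add: kh pk)
    then have "cnj (l k p * \<xi> p k h) * (cnj (l h m) * l h m) = l h m"
      by (metis (no_types, lifting) complex_cnj_mult complex_cnj_one mult.assoc mult.commute mult_1)
    moreover have "cnj (l h m) * l h m = 1"
      using twisted_charsD(2)[OF D(6) h m] complex_norm_square[of "l h m"] by (simp add: mult.commute)
    ultimately have lc: "cnj (l k p * \<xi> p k h) = l h m" by simp
    have "a (p \<otimes> q, k) * \<xi> (p \<otimes> q) k h * cnj (\<eta> h m n)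
      = (a (p \<otimes> q, k) * \<eta> k p q) * (\<eta> h m n * cnj (\<eta> h m n)) * (\<xi> p k h * \<xi> q k h)"
      unfolding pent[symmetric] by (simp only: ac_simps)
    also have "\<dots> = (l k p * \<xi> p k h) * (a (q, k) * \<xi> q k h)"
      unfolding eta aeq by (simp only: ac_simps mult_1)
    finally have "cnj (a (p \<otimes> q, k) * \<xi> (p \<otimes> q) k h * cnj (\<eta> h m n))
      = cnj ((l k p * \<xi> p k h) * (a (q, k) * \<xi> q k h))" by (rule arg_cong)
    then have "cnj (a (p \<otimes> q, k) * \<xi> (p \<otimes> q) k h) * \<eta> h m n = l h m * cnj (a (q, k) * \<xi> q k h)"
      using lc by (simp only: complex_cnj_mult complex_cnj_cnj)
    then show "alg_star a (m \<otimes> n, h) * \<eta> h m n = l h m * alg_star a (n, h)"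
      using m n hH by (simp add: alg_star_apply cj_mult p_def q_def k_def)
  qed
  fix a assume a: "a \<in> ?B"
  \<comment> \<open>These twisted right translates are the first legs of the coproduct when the
    second leg is expanded in the basis. Left translation by M commutes with them up to the cocycle
    \<eta>.\<close>
  define s where "s n2 k = homog (\<lambda>n. a (n \<otimes> n2, k) * \<eta> k n n2) k" for n2 k
  have s: "s n2 k \<in> ?B" if n2: "n2 \<in> N" and k: "k \<in> H" for n2 k
  proof (rule coideal_ofI)
    show "s n2 k \<in> alg" using k by (simp add: s_def homog_in_alg)
    show "s n2 k (n, h) = 0" if "h \<notin> K" for n h
      using that coideal_ofD(2)[OF a, of h] by (auto simp: s_def homog_def)
    fix m n h assume m: "m \<in> M" and n: "n \<in> N" and h: "h \<in> K"
    have "a (m \<otimes> n \<otimes> n2, h) * \<eta> h (m \<otimes> n) n2 * \<eta> h m n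
      = a (m \<otimes> (n \<otimes> n2), h) * \<eta> h m (n \<otimes> n2) * \<eta> h n n2"
      using eta_cocycle[of h m n n2] m n n2 h by (simp add: m_assoc mult.assoc mult.commute)
    also have "\<dots> = l h m * (a (n \<otimes> n2, h) * \<eta> h n n2)"
      using coideal_ofD(3)[OF a m _ h, of "n \<otimes> n2"] n n2 by simp
    finally show "s n2 k (m \<otimes> n, h) * \<eta> h m n = l h m * s n2 k (n, h)"
      using m n by (auto simp: s_def homog_def)
  qed
  have "comult a = (\<Sum>n2\<in>N. \<Sum>k\<in>H. tensor (s n2 k) (basis_elt n2 k))"
  proof
    fix p :: "('a \<times> 'a) \<times> ('a \<times> 'a)"
    obtain n h n2 h2 where p: "p = ((n, h), (n2, h2))" by (metis surj_pair)
    have "(\<Sum>m\<in>N. \<Sum>k\<in>H. tensor (s m k) (basis_elt m k)) p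
      = (\<Sum>m\<in>N. if m = n2 then (\<Sum>k\<in>H. if k = h2 then s n2 h2 (n, h) else 0) else 0)"
      unfolding sum_apply p
      by (intro sum.cong refl) (auto simp: tensor_def basis_elt_eq intro!: sum.cong sum.neutral)
    also have "\<dots> = comult a p"
      unfolding p comult_apply using finite_N finite_H
      by (auto simp: s_def homog_def sum.delta')
    finally show "comult a p = (\<Sum>n2\<in>N. \<Sum>k\<in>H. tensor (s n2 k) (basis_elt n2 k)) p" by simp
  qed
  also have "\<dots> \<in> tensor_space ?B alg"
    unfolding tensor_space_def
  proof (intro cfun.span_sum cfun.span_base)
    fix n2 k assume "n2 \<in> N" "k \<in> H"
    then have "s n2 k \<in> ?B" "basis_elt n2 k \<in> alg" by (simp_all add: s basis_elt_def homog_in_alg)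
    then show "tensor (s n2 k) (basis_elt n2 k) \<in> {tensor u v |u v. u \<in> ?B \<and> v \<in> alg}" by blast
  qed
  finally show "comult a \<in> tensor_space ?B alg" .
qed

lemma coideal_of_mono:
  assumes "M' \<subseteq> M" "K \<subseteq> K'" "\<And>h m. \<lbrakk>h \<in> K; m \<in> M'\<rbrakk> \<Longrightarrow> l' h m = l h m"
  shows "coideal_of M K l \<subseteq> coideal_of M' K' l'"
proof
  fix a assume a: "a \<in> coideal_of M K l"
  show "a \<in> coideal_of M' K' l'"
  proof (rule coideal_ofI)
    fix m n h assume "m \<in> M'" "n \<in> N" "h \<in> K'"
    then show "a (m \<otimes> n, h) * \<eta> h m n = l' h m * a (n, h)"
      using coideal_ofD(2,3)[OF a] assms by (cases "h \<in> K") auto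
  next
    show "a \<in> alg" using coideal_ofD(1)[OF a] .
    show "a (n, h) = 0" if "h \<notin> K'" for n h using coideal_ofD(2)[OF a, of h n] that assms(2) by blast
  qed
qed

text \<open>A test element from which the datum can be read off: \<open>l h\<close> is 1 at the
  identity and vanishes exactly off M.\<close>

lemma homog_twisted_char_in_coideal_of:
  assumes "coideal_datum M K l" "h \<in> K"
  shows "homog (l h) h \<in> coideal_of M K l"
proof (rule coideal_ofI)
  note D = coideal_datumD[OF assms(1)]
  have hH: "h \<in> H" using assms(2) D(4) by blast
  show "homog (l h) h \<in> alg" by (rule homog_in_alg[OF hH])
  show "homog (l h) h (n, k) = 0" if "k \<notin> K" for n k using that assms(2) by (auto simp: homog_def)
  fix m n k assume m: "m \<in> M" and n: "n \<in> N" and k: "k \<in> K"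
  have mN: "m \<in> N" using m D(2) by blast
  show "homog (l h) h (m \<otimes> n, k) * \<eta> k m n = l k m * homog (l h) h (n, k)"
  proof (cases "n \<in> M")
    case True
    then show ?thesis using twisted_charsD(3)[OF D(6) assms(2) m True] n mN by (simp add: homog_def)
  next
    case False
    have "m \<otimes> n \<notin> M"
    proof
      assume "m \<otimes> n \<in> M"
      then have "inv m \<otimes> (m \<otimes> n) \<in> M" using m D(1) by (simp add: subgroup.m_closed subgroup.m_inv_closed)
      then show False using False n mN by (simp add: m_assoc[symmetric])
    qed
    then show ?thesis using False twisted_charsD(1)[OF D(6)] by (simp add: homog_def)
  qed
qed

text \<open>Test elements decide both inclusions. The one of degree h is nonzero, which forces h
  into \<open>K'\<close>; the one of degree \<open>\<one>\<close> is the indicator of M, and its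
  invariance under \<open>M'\<close> puts \<open>M'\<close> inside M.\<close>

lemma coideal_of_subsetD:
  assumes D: "coideal_datum M K l" and D': "coideal_datum M' K' l'"
    and sub: "coideal_of M K l \<subseteq> coideal_of M' K' l'"
  shows "K \<subseteq> K'" "M' \<subseteq> M"
proof -
  note d = coideal_datumD[OF D] and d' = coideal_datumD[OF D']
  have w: "homog (l h) h \<in> coideal_of M' K' l'" if "h \<in> K" for h
    using homog_twisted_char_in_coideal_of[OF D that] sub by blast
  show "K \<subseteq> K'"
  proof
    fix h assume h: "h \<in> K"
    have "homog (l h) h (\<one>, h) = 1" using twisted_char_at_one[OF D h] by (simp add: homog_def)
    then show "h \<in> K'" using coideal_ofD(2)[OF w[OF h], of h \<one>] by force
  qed
  show "M' \<subseteq> M"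
  proof
    fix m assume m: "m \<in> M'"
    then have mN: "m \<in> N" using d'(2) by blast
    have 1: "\<one> \<in> K" "\<one> \<in> K'" using d(3) d'(3) subgroup.one_closed by auto
    have "homog (l \<one>) \<one> (m \<otimes> \<one>, \<one>) * \<eta> \<one> m \<one> = l' \<one> m * homog (l \<one>) \<one> (\<one>, \<one>)"
      using coideal_ofD(3)[OF w[OF 1(1)] m _ 1(2)] by simp
    then have "l \<one> m = 1"
      using mN twisted_char_one[OF D' m] twisted_char_at_one[OF D 1(1)] by (simp add: homog_def)
    then show "m \<in> M" using twisted_charsD(1)[OF d(6), of \<one> m] by fastforce
  qed
qed

lemma coideal_datum_restrict:
  assumes D: "coideal_datum M K l"
    and "subgroup M' G" "M' \<subseteq> M" "subgroup K' G" "K' \<subseteq> K"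
    and "\<And>m h. \<lbrakk>m \<in> M'; h \<in> K'\<rbrakk> \<Longrightarrow> cj m h \<in> M'"
  shows "coideal_datum M' K' (\<lambda>h m. if h \<in> K' \<and> m \<in> M' then l h m else 0)"
proof -
  note d = coideal_datumD[OF D]
  show ?thesis
    unfolding coideal_datum_def twisted_chars_def
    using assms(2-) d(2,4) twisted_charsD[OF d(6)]
    by (auto simp: subgroup.m_closed subset_iff)
qed

end

section \<open>Recovering the datum from a right coideal\<close>

context izumi_kosaki
begin

text \<open>Functions live on the whole type, but only their values on N enter;
  \<open>component_cong\<close> allows changes elsewhere.\<close>

definition component :: "('a \<times> 'a \<Rightarrow> complex) set \<Rightarrow> 'a \<Rightarrow> ('a \<Rightarrow> complex) set"
  where "component B h = {f. homog f h \<in> B}"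

context
  fixes B
  assumes B: "right_coideal B"
begin

lemma B_subspace: "cfun.subspace B" and B_alg: "B \<subseteq> alg"
  using B unfolding right_coideal_def by blast+

lemma component_cong:
  "\<lbrakk>f \<in> component B h; \<And>n. n \<in> N \<Longrightarrow> g n = f n\<rbrakk> \<Longrightarrow> g \<in> component B h"
  unfolding component_def using homog_cong[of g f h] by simp

lemma component_one: "(\<lambda>_. 1) \<in> component B \<one>"
  using B unfolding right_coideal_def component_def alg_one_def by simp

lemma component_add:
  assumes "f \<in> component B h" "g \<in> component B h"
  shows "(\<lambda>n. f n + g n) \<in> component B h"
proof -
  have "homog (\<lambda>n. f n + g n) h = homog f h + homog g h" by (auto simp: homog_def fun_eq_iff)
  then show ?thesis using assms cfun.subspace_add[OF B_subspace] by (simp add: component_def)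
qed

lemma component_scale:
  assumes "f \<in> component B h"
  shows "(\<lambda>n. c * f n) \<in> component B h"
proof -
  have "homog (\<lambda>n. c * f n) h = cscale c (homog f h)" by (auto simp: homog_def cscale_def fun_eq_iff)
  then show ?thesis using assms cfun.subspace_scale[OF B_subspace] by (simp add: component_def)
qed

lemma component_zero: "(\<lambda>_. 0) \<in> component B h"
proof -
  have "homog (\<lambda>_. 0) h = 0" by (auto simp: homog_def fun_eq_iff)
  then show ?thesis using cfun.subspace_0[OF B_subspace] by (simp add: component_def)
qed

lemma component_sum:
  assumes "finite I" "\<And>i. i \<in> I \<Longrightarrow> f i \<in> component B h"
  shows "(\<lambda>n. \<Sum>i\<in>I. f i n) \<in> component B h"
  using assms by (induction I) (auto intro: component_zero component_add)

lemma component_mult: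
  assumes "f \<in> component B h" "g \<in> component B k" "h \<in> H" "k \<in> H"
  shows "(\<lambda>n. f n * g (cj n h) * \<xi> n h k) \<in> component B (h \<otimes> k)"
proof -
  have "alg_mult (homog f h) (homog g k) \<in> B"
    using B assms(1,2) unfolding right_coideal_def component_def by blast
  then show ?thesis unfolding alg_mult_homog[OF assms(3,4)] component_def cj_fun_def by simp
qed

lemma component_mult_one:
  assumes "u \<in> component B \<one>" "f \<in> component B h" "h \<in> H"
  shows "(\<lambda>n. u n * f n) \<in> component B h"
  using component_mult[OF assms(1,2) _ assms(3)] assms(3)
  by (auto intro: component_cong)

lemma component_prod:
  assumes "finite I" "\<And>i. i \<in> I \<Longrightarrow> u i \<in> component B \<one>"
  shows "(\<lambda>n. \<Prod>i\<in>I. u i n) \<in> component B \<one>"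
  using assms by (induction I) (auto intro: component_one component_mult_one)

lemma component_star:
  assumes "f \<in> component B h" "h \<in> H"
  shows "(\<lambda>n. cnj (f (cj n (inv h)) * \<xi> (cj n (inv h)) h (inv h))) \<in> component B (inv h)"
proof -
  have "alg_star (homog f h) \<in> B"
    using B assms(1) unfolding right_coideal_def component_def by blast
  then show ?thesis unfolding alg_star_homog[OF assms(2)] component_def cj_fun_def by simp
qed

text \<open>Evaluating the second leg of the coproduct at the point (n2, h) maps B \<otimes> A to B
  and isolates degree h. With n2 = \<open>\<one>\<close> this shows that B is graded, and with
  general n2 that components admit twisted right translations.\<close>

lemma slice_mem:
  assumes a: "a \<in> B" and n2: "n2 \<in> N" and h: "h \<in> H"
  shows "(\<lambda>n. a (n \<otimes> n2, h) * \<eta> h n n2) \<in> component B h"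
proof -
  have T: "(\<lambda>p. T (p, q)) \<in> B" if "T \<in> tensor_space B alg" for T and q :: "'a \<times> 'a"
    using that unfolding tensor_space_def
  proof (rule cfun.span_induct)
    show "cfun.subspace {T. (\<lambda>p. T (p, q)) \<in> B}"
    proof (rule cfun.subspaceI)
      show "0 \<in> {T. (\<lambda>p. T (p, q)) \<in> B}"
        using cfun.subspace_0[OF B_subspace] by (simp add: zero_fun_def)
      show "x + y \<in> {T. (\<lambda>p. T (p, q)) \<in> B}"
        if "x \<in> {T. (\<lambda>p. T (p, q)) \<in> B}" "y \<in> {T. (\<lambda>p. T (p, q)) \<in> B}" for x y
        using cfun.subspace_add[OF B_subspace] that by (force simp: plus_fun_def)
      show "cscale c x \<in> {T. (\<lambda>p. T (p, q)) \<in> B}" if "x \<in> {T. (\<lambda>p. T (p, q)) \<in> B}" for c x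
        using cfun.subspace_scale[OF B_subspace] that by (force simp: cscale_def)
    qed
    fix T assume "T \<in> {tensor u v |u v. u \<in> B \<and> v \<in> alg}"
    then obtain u v where uv: "T = tensor u v" "u \<in> B" by blast
    have "(\<lambda>p. T (p, q)) = cscale (v q) u" by (auto simp: uv tensor_def cscale_def fun_eq_iff)
    then show "(\<lambda>p. T (p, q)) \<in> B" using cfun.subspace_scale[OF B_subspace] uv(2) by simp
  qed
  have "comult a \<in> tensor_space B alg" using B a unfolding right_coideal_def by blast
  from T[OF this, of "(n2, h)"] have "(\<lambda>p. comult a (p, (n2, h))) \<in> B" .
  moreover have "(\<lambda>p. comult a (p, (n2, h))) = homog (\<lambda>n. a (n \<otimes> n2, h) * \<eta> h n n2) h"
    using n2 h by (auto simp: fun_eq_iff comult_apply homog_def)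
  ultimately show ?thesis by (simp add: component_def)
qed

lemma component_translate:
  assumes "f \<in> component B h" "n2 \<in> N" "h \<in> H"
  shows "(\<lambda>n. f (n \<otimes> n2) * \<eta> h n n2) \<in> component B h"
proof -
  have "homog f h \<in> B" using assms(1) by (simp add: component_def)
  from slice_mem[OF this assms(2,3)] show ?thesis
    by (rule component_cong) (use assms(2) in \<open>simp add: homog_def\<close>)
qed

lemma component_part: "\<lbrakk>a \<in> B; h \<in> H\<rbrakk> \<Longrightarrow> (\<lambda>n. a (n, h)) \<in> component B h"
  using slice_mem[of a \<one> h] by (auto intro: component_cong)

text \<open>The product of (f, h) with the adjoint of (g, h) has degree \<open>\<one>\<close>; the
  factor \<xi> of the product cancels its conjugate in the adjoint.\<close>

lemma component_divide:
  assumes f: "f \<in> component B h" and g: "g \<in> component B h" and h: "h \<in> H"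
  shows "(\<lambda>n. f n * cnj (g n)) \<in> component B \<one>"
proof -
  have "(\<lambda>n. f n * cnj (g (cj (cj n h) (inv h)) * \<xi> (cj (cj n h) (inv h)) h (inv h)) * \<xi> n h (inv h))
    \<in> component B (h \<otimes> inv h)"
    using component_mult[OF f component_star[OF g h] h] h by simp
  then have "(\<lambda>n. f n * cnj (g (cj (cj n h) (inv h)) * \<xi> (cj (cj n h) (inv h)) h (inv h)) * \<xi> n h (inv h))
    \<in> component B \<one>" using h by simp
  then show ?thesis
  proof (rule component_cong)
    fix n assume n: "n \<in> N"
    have "cnj (\<xi> n h (inv h)) * \<xi> n h (inv h) = 1"
      using xi_U1[OF n h, of "inv h"] complex_norm_square[of "\<xi> n h (inv h)"] h by (simp add: mult.commute)
    then show "f n * cnj (g n) = f n * cnj (g (cj (cj n h) (inv h)) * \<xi> (cj (cj n h) (inv h)) h (inv h)) * \<xi> n h (inv h)"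
      using n h by simp
  qed
qed

lemma mem_B_iff:
  assumes "a \<in> alg"
  shows "a \<in> B \<longleftrightarrow> (\<forall>h\<in>H. (\<lambda>n. a (n, h)) \<in> component B h)"
proof
  assume "\<forall>h\<in>H. (\<lambda>n. a (n, h)) \<in> component B h"
  then have "(\<Sum>h\<in>H. homog (\<lambda>n. a (n, h)) h) \<in> B"
    by (intro cfun.subspace_sum[OF B_subspace]) (simp add: component_def)
  then show "a \<in> B" using alg_eq_sum_homog[OF assms] by simp
qed (use component_part in blast)

text \<open>The left periods of the functions of degree \<open>\<one>\<close>. Testing at the
  identity suffices, since that component is closed under right translation.\<close>

definition stab :: "'a set"
  where "stab = {m \<in> N. \<forall>u\<in>component B \<one>. u m = u \<one>}"

text \<open>By translation a nonzero value anywhere on N can be moved to the identity, so these are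
  exactly the degrees that occur in B; see \<open>mem_supp\<close>.\<close>

definition supp :: "'a set"
  where "supp = {h \<in> H. \<exists>f\<in>component B h. f \<one> \<noteq> 0}"

lemma stabD: "\<lbrakk>m \<in> stab; u \<in> component B \<one>\<rbrakk> \<Longrightarrow> u m = u \<one>"
  unfolding stab_def by blast

lemma suppI: "\<lbrakk>f \<in> component B h; h \<in> H; f \<one> \<noteq> 0\<rbrakk> \<Longrightarrow> h \<in> supp"
  unfolding supp_def by blast

lemma stab_invariant:
  assumes "u \<in> component B \<one>" "m \<in> stab" "n \<in> N"
  shows "u (m \<otimes> n) = u n"
proof -
  have "u (m \<otimes> n) * \<eta> \<one> m n = u (\<one> \<otimes> n) * \<eta> \<one> \<one> n"
    by (rule stabD[OF assms(2) component_translate[OF assms(1,3)]]) simp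
  moreover have "m \<in> N" using assms(2) by (simp add: stab_def)
  ultimately show ?thesis using assms(3) by simp
qed

lemma stab_subgroup: "subgroup stab G"
proof (rule subgroupI)
  show "stab \<subseteq> carrier G" by (auto simp: stab_def)
  have "\<one> \<in> stab" by (simp add: stab_def)
  then show "stab \<noteq> {}" by blast
  show "inv m \<in> stab" if "m \<in> stab" for m
  proof -
    have mN: "m \<in> N" using that by (simp add: stab_def)
    have "u (inv m) = u \<one>" if u: "u \<in> component B \<one>" for u
      using stab_invariant[OF u \<open>m \<in> stab\<close>, of "inv m"] mN by simp
    then show ?thesis using mN by (simp add: stab_def)
  qed
  show "m \<otimes> n \<in> stab" if "m \<in> stab" "n \<in> stab" for m n
  proof -
    have N: "m \<in> N" "n \<in> N" using that by (simp_all add: stab_def)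
    have "u (m \<otimes> n) = u \<one>" if u: "u \<in> component B \<one>" for u
      using stab_invariant[OF u \<open>m \<in> stab\<close> N(2)] stabD[OF \<open>n \<in> stab\<close> u] by simp
    then show ?thesis using N by (simp add: stab_def)
  qed
qed

lemma mem_supp:
  assumes "f \<in> component B h" "h \<in> H" "n \<in> N" "f n \<noteq> 0"
  shows "h \<in> supp"
proof -
  have "f (\<one> \<otimes> n) * \<eta> h \<one> n \<noteq> 0" using assms by simp
  then show ?thesis by (rule suppI[OF component_translate[OF assms(1,3,2)] assms(2)])
qed

lemma supp_subgroup: "subgroup supp G"
proof (rule subgroupI)
  show "supp \<subseteq> carrier G" by (auto simp: supp_def)
  have "\<one> \<in> supp" by (rule suppI[OF component_one]) simp_all
  then show "supp \<noteq> {}" by blast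
  show "inv h \<in> supp" if "h \<in> supp" for h
  proof -
    from \<open>h \<in> supp\<close> obtain f where f: "h \<in> H" "f \<in> component B h" "f \<one> \<noteq> 0" by (auto simp: supp_def)
    show ?thesis by (rule mem_supp[OF component_star[OF f(2,1)], of \<one>]) (use f in auto)
  qed
  show "h \<otimes> k \<in> supp" if "h \<in> supp" "k \<in> supp" for h k
  proof -
    from \<open>h \<in> supp\<close> obtain f where f: "h \<in> H" "f \<in> component B h" "f \<one> \<noteq> 0" by (auto simp: supp_def)
    from \<open>k \<in> supp\<close> obtain g where g: "k \<in> H" "g \<in> component B k" "g \<one> \<noteq> 0" by (auto simp: supp_def)
    show ?thesis by (rule mem_supp[OF component_mult[OF f(2) g(2) f(1) g(1)], of \<one>]) (use f g in auto)
  qed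
qed

definition ratio :: "'a \<Rightarrow> 'a \<Rightarrow> complex"
  where "ratio h m = (if h \<in> supp \<and> m \<in> stab
    then (let f = SOME f. f \<in> component B h \<and> f \<one> \<noteq> 0 in f m / f \<one>) else 0)"

text \<open>Both f cnj(f) and g cnj(f) have degree \<open>\<one>\<close>, so they agree at m and at
  the identity. The first gives modulus one; the second shows that the quotient does not depend on
  the chosen f.\<close>

lemma ratio:
  assumes h: "h \<in> supp" and m: "m \<in> stab"
  shows "cmod (ratio h m) = 1" "g \<in> component B h \<Longrightarrow> g m = ratio h m * g \<one>"
proof -
  define f where "f = (SOME f. f \<in> component B h \<and> f \<one> \<noteq> 0)"
  have hH: "h \<in> H" using h by (simp add: supp_def)
  have "\<exists>f. f \<in> component B h \<and> f \<one> \<noteq> 0" using h by (auto simp: supp_def)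
  then have "f \<in> component B h \<and> f \<one> \<noteq> 0" unfolding f_def by (rule someI_ex)
  then have f: "f \<in> component B h" "f \<one> \<noteq> 0" by auto
  have r: "f m = ratio h m * f \<one>" using h m f(2) by (simp add: ratio_def Let_def f_def)
  have div: "g m * cnj (f m) = g \<one> * cnj (f \<one>)" if g: "g \<in> component B h" for g
    by (rule stabD[OF m component_divide[OF g f(1) hH]])
  have "(cmod (f m))\<^sup>2 = (cmod (f \<one>))\<^sup>2"
    using div[OF f(1)] unfolding complex_norm_square[symmetric] of_real_eq_iff .
  then have "cmod (f m) = cmod (f \<one>)" by simp
  then show 1: "cmod (ratio h m) = 1" using r f(2) by (simp add: norm_mult)
  assume g: "g \<in> component B h"
  have u: "cnj (ratio h m) * ratio h m = 1"
    using 1 complex_norm_square[of "ratio h m"] by (simp add: mult.commute)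
  have "g m * cnj (ratio h m) * cnj (f \<one>) = g \<one> * cnj (f \<one>)" using div[OF g] r by simp
  then have "g m * cnj (ratio h m) = g \<one>" using f(2) by simp
  then have "g m * (cnj (ratio h m) * ratio h m) = ratio h m * g \<one>" by (simp add: mult.left_commute)
  then show "g m = ratio h m * g \<one>" by (simp only: u mult_1_right)
qed

text \<open>In the product of (f, h) and (u, \<open>\<one>\<close>) the function u is evaluated at
  conjugates by h. Since f and the product both transform through \<open>ratio h m\<close>,
  comparison leaves u unchanged at \<open>cj m h\<close>.\<close>

lemma stab_cj_closed:
  assumes h: "h \<in> supp" and m: "m \<in> stab"
  shows "cj m h \<in> stab"
proof -
  obtain f where f: "h \<in> H" "f \<in> component B h" "f \<one> \<noteq> 0" using h by (auto simp: supp_def)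
  have mN: "m \<in> N" using m by (simp add: stab_def)
  have "u (cj m h) = u \<one>" if u: "u \<in> component B \<one>" for u
  proof -
    have "(\<lambda>n. f n * u (cj n h) * \<xi> n h \<one>) \<in> component B h"
      using component_mult[OF f(2) u f(1)] f(1) by simp
    from ratio(2)[OF h m this] have "f m * u (cj m h) = ratio h m * (f \<one> * u \<one>)"
      using f(1) mN by simp
    then have "ratio h m * f \<one> * u (cj m h) = ratio h m * f \<one> * u \<one>"
      using ratio(2)[OF h m f(2)] by simp
    moreover have "ratio h m \<noteq> 0" using ratio(1)[OF h m] by auto
    ultimately show ?thesis using f(3) by simp
  qed
  then show ?thesis using f(1) mN by (simp add: stab_def)
qed

lemma coideal_datum_ratio: "coideal_datum stab supp ratio"
  unfolding coideal_datum_def twisted_chars_def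
proof (intro conjI CollectI allI ballI impI)
  show "subgroup stab G" "subgroup supp G" by (rule stab_subgroup supp_subgroup)+
  show "stab \<subseteq> N" "supp \<subseteq> H" by (auto simp: stab_def supp_def)
  show "ratio h m = 0" if "h \<notin> supp \<or> m \<notin> stab" for h m using that by (auto simp: ratio_def)
  fix m h assume m: "m \<in> stab" and h: "h \<in> supp"
  have mN: "m \<in> N" using m by (simp add: stab_def)
  show "cj m h \<in> stab" by (rule stab_cj_closed[OF h m])
  show "cmod (ratio h m) = 1" by (rule ratio(1)[OF h m])
  obtain f where f: "h \<in> H" "f \<in> component B h" "f \<one> \<noteq> 0" using h by (auto simp: supp_def)
  show "ratio h (m \<otimes> n) * \<eta> h m n = ratio h m * ratio h n" if n: "n \<in> stab" for n
  proof -
    have nN: "n \<in> N" using n by (simp add: stab_def)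
    have mn: "m \<otimes> n \<in> stab" using subgroup.m_closed[OF stab_subgroup m n] .
    have "f (m \<otimes> n) * \<eta> h m n = ratio h m * (f (\<one> \<otimes> n) * \<eta> h \<one> n)"
      using ratio(2)[OF h m component_translate[OF f(2) nN f(1)]] .
    then have "ratio h (m \<otimes> n) * f \<one> * \<eta> h m n = ratio h m * (ratio h n * f \<one>)"
      using ratio(2)[OF h mn f(2)] ratio(2)[OF h n f(2)] nN f(1) by simp
    then have "(ratio h (m \<otimes> n) * \<eta> h m n) * f \<one> = (ratio h m * ratio h n) * f \<one>" by (simp only: ac_simps)
    then show ?thesis using f(3) by simp
  qed
  show "ratio (h \<otimes> k) m = ratio h m * ratio k (cj m h) * \<xi> m h k" if k: "k \<in> supp" for k
  proof -
    obtain g where g: "k \<in> H" "g \<in> component B k" "g \<one> \<noteq> 0" using k by (auto simp: supp_def)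
    have hk: "h \<otimes> k \<in> supp" using subgroup.m_closed[OF supp_subgroup h k] .
    have "f m * g (cj m h) * \<xi> m h k = ratio (h \<otimes> k) m * (f \<one> * g (cj \<one> h) * \<xi> \<one> h k)"
      using ratio(2)[OF hk m component_mult[OF f(2) g(2) f(1) g(1)]] .
    then have "ratio h m * f \<one> * (ratio k (cj m h) * g \<one>) * \<xi> m h k = ratio (h \<otimes> k) m * (f \<one> * g \<one>)"
      using ratio(2)[OF h m f(2)] ratio(2)[OF k stab_cj_closed[OF h m] g(2)] f(1) g(1) by simp
    then have "(ratio h m * ratio k (cj m h) * \<xi> m h k) * (f \<one> * g \<one>) = ratio (h \<otimes> k) m * (f \<one> * g \<one>)"
      by (simp only: ac_simps)
    then show ?thesis using f(3) g(3) by simp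
  qed
qed

text \<open>A finite Stone-Weierstrass argument: the functions of degree \<open>\<one>\<close> are
  constant on the cosets of \<open>stab\<close> and separate them, and a product of functions that
  are 1 at \<open>n0\<close> and 0 at one other point each is the indicator.\<close>

lemma coset_indicator:
  assumes n0: "n0 \<in> N"
  shows "(\<lambda>n. if n \<otimes> inv n0 \<in> stab then 1 else 0) \<in> component B \<one>"
proof -
  let ?I = "{n \<in> N. n \<otimes> inv n0 \<notin> stab}"
  have "\<exists>v\<in>component B \<one>. v n = 0 \<and> v n0 = 1" if n: "n \<in> ?I" for n
  proof -
    have nN: "n \<in> N" "n \<otimes> inv n0 \<in> N" using n n0 by auto
    then obtain u where u: "u \<in> component B \<one>" "u (n \<otimes> inv n0) \<noteq> u \<one>" using n by (auto simp: stab_def)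
    \<comment> \<open>Translation turns a separation of \<open>n \<otimes> inv n0\<close> from the
      identity into one of n from \<open>n0\<close>; an affine change then normalises the two values
      to 0 and 1.\<close>
    define w where "w = (\<lambda>x. u (x \<otimes> inv n0) * \<eta> \<one> x (inv n0))"
    have w: "w \<in> component B \<one>"
      using component_translate[OF u(1), of "inv n0"] n0 by (simp add: w_def)
    have ne: "w n \<noteq> w n0" using u(2) n0 nN by (simp add: w_def)
    have "(\<lambda>x. 1 / (w n0 - w n) * (w x + (- w n) * 1)) \<in> component B \<one>"
      by (intro component_scale component_add w component_scale[OF component_one])
    then show ?thesis by (rule bexI[rotated]) (use ne in \<open>simp add: field_simps\<close>)
  qed
  then obtain v where v: "\<And>n. n \<in> ?I \<Longrightarrow> v n \<in> component B \<one> \<and> v n n = 0 \<and> v n n0 = 1" by metis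
  have "(\<lambda>x. \<Prod>n\<in>?I. v n x) \<in> component B \<one>"
    using finite_N v by (intro component_prod) auto
  then show ?thesis
  proof (rule component_cong)
    fix x assume x: "x \<in> N"
    show "(if x \<otimes> inv n0 \<in> stab then 1 else 0) = (\<Prod>n\<in>?I. v n x)"
    proof (cases "x \<otimes> inv n0 \<in> stab")
      case True
      have "v n x = 1" if n: "n \<in> ?I" for n
      proof -
        have "v n (x \<otimes> inv n0 \<otimes> n0) = v n n0" using stab_invariant[OF _ True n0] v[OF n] by blast
        then show ?thesis using v[OF n] x n0 by (simp add: m_assoc)
      qed
      then show ?thesis using True by simp
    next
      case False
      then have "x \<in> ?I" using x by simp
      then have "(\<Prod>n\<in>?I. v n x) = 0" using v finite_N by (intro prod_zero) auto
      then show ?thesis using False by simp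
    qed
  qed
qed

text \<open>For the inclusion into B, an element obeying the transformation rule is determined on a
  coset by a single value. In each degree of the support, translates of one nonzero member of the
  component, cut down to cosets and rescaled, therefore assemble every such element.\<close>

lemma right_coideal_eq_coideal_of: "B = coideal_of stab supp ratio"
proof
  show "B \<subseteq> coideal_of stab supp ratio"
  proof
    fix a assume a: "a \<in> B"
    show "a \<in> coideal_of stab supp ratio"
    proof (rule coideal_ofI)
      show "a \<in> alg" using a B_alg by blast
      show "a (n, h) = 0" if "n \<in> N" "h \<in> H" "h \<notin> supp" for n h
        using mem_supp[OF component_part[OF a]] that by blast
      fix m n h assume m: "m \<in> stab" and n: "n \<in> N" and h: "h \<in> supp"
      have hH: "h \<in> H" using h by (simp add: supp_def)
      show "a (m \<otimes> n, h) * \<eta> h m n = ratio h m * a (n, h)"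
        using ratio(2)[OF h m slice_mem[OF a n hH]] n hH by simp
    qed
  qed
  show "coideal_of stab supp ratio \<subseteq> B"
  proof
    fix a assume a: "a \<in> coideal_of stab supp ratio"
    note aD = coideal_ofD[OF a]
    note D = coideal_datumD[OF coideal_datum_ratio]
    have "(\<lambda>n. a (n, h)) \<in> component B h" if h: "h \<in> H" for h
    proof (cases "h \<in> supp")
      case False
      then show ?thesis using component_zero aD(2) by simp
    next
      case True
      obtain f where f: "f \<in> component B h" "f \<one> \<noteq> 0" using True by (auto simp: supp_def)
      define F where "F n0 = (\<lambda>n. f (n \<otimes> inv n0) * \<eta> h n (inv n0))" for n0
      have F: "F n0 \<in> component B h" "F n0 n0 \<noteq> 0" if "n0 \<in> N" for n0
        using component_translate[OF f(1) _ h, of "inv n0"] that f(2) eta_nonzero[OF h, of n0 "inv n0"]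
        by (simp_all add: F_def)
      \<comment> \<open>This is the part of a in degree h on the coset of \<open>n0\<close>:
        \<open>F n0\<close> has the same transformation rule as a, and the scalar matches the two at
        \<open>n0\<close>.\<close>
      define t where "t n0 n = a (n0, h) / F n0 n0 * ((if n \<otimes> inv n0 \<in> stab then 1 else 0) * F n0 n)" for n0 n
      have t: "t n0 \<in> component B h" if "n0 \<in> N" for n0
        unfolding t_def using that
        by (intro component_scale component_mult_one coset_indicator F h)
      have t_eq: "t n0 n = (if n \<otimes> inv n0 \<in> stab then a (n, h) else 0)" if n0: "n0 \<in> N" and n: "n \<in> N" for n0 n
      proof (cases "n \<otimes> inv n0 \<in> stab")
        case True
        define m where "m = n \<otimes> inv n0"
        have m: "m \<in> stab" "m \<in> N" using True D(2) unfolding m_def by auto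
        have nm: "n = m \<otimes> n0" using n n0 by (simp add: m_def m_assoc)
        have Fn: "F n0 n * \<eta> h m n0 = ratio h m * F n0 n0"
        proof -
          have "(\<lambda>x. F n0 (x \<otimes> n0) * \<eta> h x n0) \<in> component B h"
            by (rule component_translate[OF F(1)[OF n0] n0 h])
          from ratio(2)[OF \<open>h \<in> supp\<close> m(1) this] show ?thesis using n0 h by (simp add: nm)
        qed
        have an: "a (n, h) * \<eta> h m n0 = ratio h m * a (n0, h)"
          using aD(3)[OF m(1) n0 \<open>h \<in> supp\<close>] by (simp add: nm)
        have "t n0 n * \<eta> h m n0 = a (n0, h) / F n0 n0 * (F n0 n * \<eta> h m n0)"
          using True by (simp add: t_def)
        also have "\<dots> = a (n, h) * \<eta> h m n0" unfolding Fn an using F(2)[OF n0] by simp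
        finally show ?thesis using True eta_nonzero[OF h m(2) n0] by simp
      qed (simp add: t_def)
      \<comment> \<open>Every coset \<open>stab n\<close> is counted once for each of its elements.\<close>
      have "(\<lambda>n. 1 / of_nat (card stab) * (\<Sum>n0\<in>N. t n0 n)) \<in> component B h"
        using t by (intro component_scale component_sum[OF finite_N])
      then show ?thesis
      proof (rule component_cong)
        fix n assume n: "n \<in> N"
        have "bij_betw (\<lambda>m. inv m \<otimes> n) stab {n0 \<in> N. n \<otimes> inv n0 \<in> stab}"
        proof (rule bij_betw_byWitness[where f' = "\<lambda>n0. n \<otimes> inv n0"])
          show "\<forall>m\<in>stab. n \<otimes> inv (inv m \<otimes> n) = m"
            using n D(2) by (auto simp: inv_mult_group m_assoc[symmetric] subset_iff)
          show "\<forall>n0\<in>{n0 \<in> N. n \<otimes> inv n0 \<in> stab}. inv (n \<otimes> inv n0) \<otimes> n = n0"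
            using n by (auto simp: inv_mult_group m_assoc)
          show "(\<lambda>m. inv m \<otimes> n) ` stab \<subseteq> {n0 \<in> N. n \<otimes> inv n0 \<in> stab}"
            using n D(2) by (auto simp: inv_mult_group m_assoc[symmetric] subset_iff)
        qed auto
        then have "card {n0 \<in> N. n \<otimes> inv n0 \<in> stab} = card stab" by (simp add: bij_betw_same_card)
        moreover have "(\<Sum>n0\<in>N. t n0 n) = (\<Sum>n0\<in>{n0 \<in> N. n \<otimes> inv n0 \<in> stab}. a (n, h))"
          using finite_N n by (simp add: t_eq sum.If_cases Int_def)
        ultimately have "(\<Sum>n0\<in>N. t n0 n) = of_nat (card stab) * a (n, h)" by simp
        moreover have "card stab \<noteq> 0"
          using subgroup.one_closed[OF D(1)] finite_subset[OF D(2) finite_N] by auto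
        ultimately show "a (n, h) = 1 / of_nat (card stab) * (\<Sum>n0\<in>N. t n0 n)" by simp
      qed
    qed
    then show "a \<in> B" using mem_B_iff[OF aD(1)] by blast
  qed
qed

end

lemma right_coideal_cases:
  assumes "right_coideal B"
  obtains M K l where "coideal_datum M K l" "B = coideal_of M K l"
  using coideal_datum_ratio[OF assms] right_coideal_eq_coideal_of[OF assms] by blast

end

section \<open>Counting maximal and minimal right coideals\<close>

text \<open>Without the common point e the sets are disjoint. Applied to minimal subgroups with e
  the identity.\<close>

lemma sum_card_minus_one_le:
  assumes "finite X" "\<And>M. M \<in> S \<Longrightarrow> M \<subseteq> X" "\<And>M. M \<in> S \<Longrightarrow> e \<in> M" "e \<in> X"
    and disj: "\<And>M M'. \<lbrakk>M \<in> S; M' \<in> S; M \<noteq> M'\<rbrakk> \<Longrightarrow> M \<inter> M' \<subseteq> {e}"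
  shows "(\<Sum>M\<in>S. card M - 1) \<le> card X - 1"
proof -
  have finS: "finite S" by (rule finite_subset[of _ "Pow X"]) (use assms(1,2) in auto)
  have fin: "finite M" if "M \<in> S" for M using that assms(1,2) finite_subset by metis
  have "(\<Sum>M\<in>S. card M - 1) = (\<Sum>M\<in>S. card (M - {e}))"
    using fin assms(3) by (intro sum.cong refl) simp
  also have "\<dots> = card (\<Union>M\<in>S. M - {e})"
    by (rule card_UN_disjoint[symmetric]) (use finS fin disj in blast)+
  also have "\<dots> \<le> card (X - {e})"
    using assms(1,2) by (intro card_mono) auto
  finally show ?thesis using assms(1,4) by simp
qed

lemma card_UN_image_le:
  assumes "finite S" "\<And>i. i \<in> S \<Longrightarrow> finite (T i) \<and> card (T i) \<le> c i"
  shows "finite (\<Union>i\<in>S. f i ` T i)" "card (\<Union>i\<in>S. f i ` T i) \<le> (\<Sum>i\<in>S. c i)"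
proof -
  show "finite (\<Union>i\<in>S. f i ` T i)" using assms by blast
  have "card (\<Union>i\<in>S. f i ` T i) \<le> (\<Sum>i\<in>S. card (f i ` T i))" by (rule card_UN_le[OF assms(1)])
  also have "\<dots> \<le> (\<Sum>i\<in>S. c i)"
  proof (rule sum_mono)
    fix i assume "i \<in> S"
    then have T: "finite (T i)" "card (T i) \<le> c i" using assms(2) by blast+
    show "card (f i ` T i) \<le> c i" by (rule le_trans[OF card_image_le[OF T(1)] T(2)])
  qed
  finally show "card (\<Union>i\<in>S. f i ` T i) \<le> (\<Sum>i\<in>S. c i)" .
qed

lemma (in group) maximal_subgroup_of_subgroupI:
  assumes S: "subgroup S G" and M: "subgroup M G" "M \<subseteq> S" "M \<noteq> S"
    and "\<And>L. \<lbrakk>subgroup L G; M \<subseteq> L; L \<subseteq> S\<rbrakk> \<Longrightarrow> L = M \<or> L = S"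
  shows "group.maximal_subgroup (G\<lparr>carrier := S\<rparr>) M"
proof -
  interpret S: group "G\<lparr>carrier := S\<rparr>" using subgroup_imp_group[OF S] .
  show ?thesis
    unfolding S.maximal_subgroup_def
  proof (intro conjI allI impI)
    show "subgroup M (G\<lparr>carrier := S\<rparr>)" by (rule subgroup_incl[OF M(1) S M(2)])
    show "M \<noteq> carrier (G\<lparr>carrier := S\<rparr>)" using M(3) by simp
    fix L assume L: "subgroup L (G\<lparr>carrier := S\<rparr>)" "M \<subseteq> L"
    show "L = M \<or> L = carrier (G\<lparr>carrier := S\<rparr>)"
      using assms(5)[OF incl_subgroup[OF S L(1)] L(2)] subgroup.subset[OF L(1)] by simp
  qed
qed

section \<open>The smallest and the largest right coideal, and the classification of extremal
  ones\<close>

context izumi_kosaki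
begin

lemma trivial_subgroup: "subgroup {\<one>} G"
  by (rule triv_subgroup)

text \<open>When M or K is trivial, the normalisations turn every \<eta> and \<xi> in the defining
  relations into 1, so this is a datum; it is then the only one for that M and K.\<close>

abbreviation trivial_datum :: "'a set \<Rightarrow> 'a set \<Rightarrow> 'a \<Rightarrow> 'a \<Rightarrow> complex"
  where "trivial_datum M K \<equiv> (\<lambda>h m. if h \<in> K \<and> m \<in> M then 1 else 0)"

lemma coideal_datum_trivial_stabilizer:
  assumes "subgroup K G" "K \<subseteq> H"
  shows "coideal_datum {\<one>} K (trivial_datum {\<one>} K)"
  unfolding coideal_datum_def twisted_chars_def
  using assms trivial_subgroup by (auto simp: subgroup.m_closed subset_iff)

lemma coideal_datum_trivial_support:
  assumes "subgroup M G" "M \<subseteq> N"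
  shows "coideal_datum M {\<one>} (trivial_datum M {\<one>})"
  unfolding coideal_datum_def twisted_chars_def
  using assms trivial_subgroup by (auto simp: subgroup.m_closed subset_iff)

lemma coideal_of_trivial_stabilizer_eq:
  assumes "coideal_datum {\<one>} K l"
  shows "l = trivial_datum {\<one>} K"
  using twisted_char_at_one[OF assms] twisted_charsD(1)[OF coideal_datumD(6)[OF assms]]
  by (auto simp: fun_eq_iff)

lemma coideal_of_trivial_support_eq:
  assumes "coideal_datum M {\<one>} l"
  shows "l = trivial_datum M {\<one>}"
  using twisted_char_one[OF assms] twisted_charsD(1)[OF coideal_datumD(6)[OF assms]]
  by (auto simp: fun_eq_iff)

lemma alg_eq_coideal_of: "alg = coideal_of {\<one>} H (trivial_datum {\<one>} H)"
proof
  show "alg \<subseteq> coideal_of {\<one>} H (trivial_datum {\<one>} H)"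
    by (auto intro!: coideal_ofI)
qed (use coideal_ofD(1) in blast)

lemma span_one_eq_coideal_of: "cfun.span {alg_one} = coideal_of N {\<one>} (trivial_datum N {\<one>})"
proof
  have rc: "right_coideal (coideal_of N {\<one>} (trivial_datum N {\<one>}))"
    by (intro right_coideal_coideal_of coideal_datum_trivial_support subgroup_N order_refl)
  show "cfun.span {alg_one} \<subseteq> coideal_of N {\<one>} (trivial_datum N {\<one>})"
    using rc unfolding right_coideal_def by (intro cfun.span_minimal) auto
  show "coideal_of N {\<one>} (trivial_datum N {\<one>}) \<subseteq> cfun.span {alg_one}"
  proof
    fix a assume a: "a \<in> coideal_of N {\<one>} (trivial_datum N {\<one>})"
    note aD = coideal_ofD[OF a]
    have const: "a (n, \<one>) = a (\<one>, \<one>)" if "n \<in> N" for n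
      using aD(3)[of n \<one> \<one>] that by simp
    have "a p = cscale (a (\<one>, \<one>)) alg_one p" for p
    proof (cases "p \<in> N \<times> {\<one>}")
      case True
      then obtain n where "p = (n, \<one>)" "n \<in> N" by blast
      then show ?thesis using const[of n] by (simp add: cscale_def alg_one_def homog_def)
    next
      case False
      have "a p = 0"
      proof (cases p)
        case (Pair n h)
        show ?thesis
        proof (cases "h = \<one>")
          case True
          then have "p \<notin> N \<times> H" using False Pair by blast
          then show ?thesis using aD(1) unfolding alg_def by blast
        next
          case False
          then show ?thesis using aD(2)[of h n] Pair by blast
        qed
      qed
      then show ?thesis using False by (auto simp: cscale_def alg_one_def homog_def split: prod.splits)
    qed
    then have "a = cscale (a (\<one>, \<one>)) alg_one" by blast
    then show "a \<in> cfun.span {alg_one}"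
      by (metis cfun.span_base cfun.span_scale singletonI)
  qed
qed

text \<open>Values have modulus one, so the conjugate is the inverse, and the factors \<eta> and
  \<xi> cancel. Relative to a fixed \<open>l0\<close>, families of twisted characters are thus
  counted by honest cocycles.\<close>

lemma twisted_char_quotient_cocycle:
  assumes l: "coideal_datum M K l" and l0: "coideal_datum M K l0"
  shows "(\<lambda>h\<in>K. \<lambda>m. l h m * cnj (l0 h m)) \<in> char_cocycles K M"
proof -
  note d = coideal_datumD[OF l] and d0 = coideal_datumD[OF l0]
  note t = twisted_charsD[OF d(6)] and t0 = twisted_charsD[OF d0(6)]
  have KH: "h \<in> H" if "h \<in> K" for h using that d(4) by blast
  have MN: "m \<in> N" if "m \<in> M" for m using that d(2) by blast
  have unit: "z * cnj z = 1" if "cmod z = 1" for z using that complex_norm_square[of z] by simp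
  have chars: "(\<lambda>m. l h m * cnj (l0 h m)) \<in> chars M" if h: "h \<in> K" for h
    unfolding chars_def
  proof (intro CollectI conjI ballI allI impI)
    fix m n assume m: "m \<in> M" and n: "n \<in> M"
    have "l h (m \<otimes> n) * cnj (l0 h (m \<otimes> n)) * (\<eta> h m n * cnj (\<eta> h m n))
      = (l h (m \<otimes> n) * \<eta> h m n) * cnj (l0 h (m \<otimes> n) * \<eta> h m n)" by simp
    also have "\<dots> = l h m * l h n * cnj (l0 h m * l0 h n)" by (simp only: t(3)[OF h m n] t0(3)[OF h m n])
    finally show "l h (m \<otimes> n) * cnj (l0 h (m \<otimes> n)) = l h m * cnj (l0 h m) * (l h n * cnj (l0 h n))"
      using unit[OF eta_U1[OF KH[OF h] MN[OF m] MN[OF n]]] by (simp add: ac_simps)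
  qed (use t(1,2) t0(1,2) h in \<open>auto simp: norm_mult\<close>)
  have "l (g \<otimes> h) m * cnj (l0 (g \<otimes> h) m) = l g m * cnj (l0 g m) * (l h (cj m g) * cnj (l0 h (cj m g)))"
    if gh: "g \<in> K" "h \<in> K" and m: "m \<in> M" for g h m
  proof -
    have "l (g \<otimes> h) m * cnj (l0 (g \<otimes> h) m)
      = l g m * cnj (l0 g m) * (l h (cj m g) * cnj (l0 h (cj m g))) * (\<xi> m g h * cnj (\<xi> m g h))"
      unfolding t(4)[OF gh m] t0(4)[OF gh m] by (simp add: ac_simps)
    then show ?thesis using unit[OF xi_U1[OF MN[OF m] KH[OF gh(1)] KH[OF gh(2)]]] by simp
  qed
  then show ?thesis
    using chars d(5) by (auto simp: char_cocycles_def subgroup.m_closed[OF d(3)])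
qed

lemma twisted_char_eqI:
  assumes l: "coideal_datum M K l" and l': "coideal_datum M K l'" and l0: "coideal_datum M K l0"
    and eq: "l h m * cnj (l0 h m) = l' h m * cnj (l0 h m)"
  shows "l h m = l' h m"
proof (cases "h \<in> K \<and> m \<in> M")
  case True
  then show ?thesis using eq coideal_datumD(7)[OF l0] by simp
next
  case False
  then show ?thesis
    using twisted_charsD(1)[OF coideal_datumD(6)[OF l]] twisted_charsD(1)[OF coideal_datumD(6)[OF l']]
    by metis
qed

lemma card_twisted_chars_minimal_stabilizer:
  assumes M: "subgroup M G" "M \<subseteq> N" "M \<noteq> {\<one>}"
    and solv: "solvable (G\<lparr>carrier := H\<rparr>)"
    and inv: "\<And>m h. \<lbrakk>m \<in> M; h \<in> H\<rbrakk> \<Longrightarrow> cj m h \<in> M"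
    and minimal: "\<And>X. \<lbrakk>subgroup X G; X \<subseteq> M; \<And>m h. \<lbrakk>m \<in> X; h \<in> H\<rbrakk> \<Longrightarrow> cj m h \<in> X\<rbrakk> \<Longrightarrow> X = {\<one>} \<or> X = M"
  shows "finite (twisted_chars M H)" "card (twisted_chars M H) \<le> (card M - 1) * card H"
proof -
  have finM: "finite M" using M(2) finite_N finite_subset by blast
  note Z = card_char_cocycles_le[OF M(1) finM M(3) subgroup_H finite_H solv inv minimal]
  have D: "coideal_datum M H l" if "l \<in> twisted_chars M H" for l
    using that M inv subgroup_H by (simp add: coideal_datum_def)
  have "finite (twisted_chars M H) \<and> card (twisted_chars M H) \<le> card (char_cocycles H M)"
  proof (cases "twisted_chars M H = {}")
    case False
    then obtain l0 where l0: "l0 \<in> twisted_chars M H" by blast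
    let ?f = "\<lambda>l. \<lambda>h\<in>H. \<lambda>m. l h m * cnj (l0 h m)"
    have inj: "inj_on ?f (twisted_chars M H)"
    proof (rule inj_onI)
      fix l l' assume l: "l \<in> twisted_chars M H" and l': "l' \<in> twisted_chars M H" and eq: "?f l = ?f l'"
      have "l h m = l' h m" for h m
      proof (cases "h \<in> H")
        case True
        have "?f l h m = ?f l' h m" using eq by simp
        then show ?thesis using True twisted_char_eqI[OF D[OF l] D[OF l'] D[OF l0], of h m] by simp
      qed (use twisted_charsD(1)[OF l] twisted_charsD(1)[OF l'] in simp)
      then show "l = l'" by blast
    qed
    have img: "?f ` twisted_chars M H \<subseteq> char_cocycles H M"
      using twisted_char_quotient_cocycle[OF D D[OF l0]] by blast
    show ?thesis using inj_on_finite[OF inj img Z(1)] card_inj_on_le[OF inj img Z(1)] by blast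
  qed simp
  then have fin: "finite (twisted_chars M H)"
    and le: "card (twisted_chars M H) \<le> card (char_cocycles H M)" by blast+
  show "finite (twisted_chars M H)" by (rule fin)
  show "card (twisted_chars M H) \<le> (card M - 1) * card H" by (rule le_trans[OF le Z(2)])
qed

text \<open>Two families agree on a subgroup of K, so by minimality of K one value at k \<noteq>
  \<open>\<one>\<close> determines the family. At k the quotient by a fixed family is a linear
  character of N.\<close>

lemma card_twisted_chars_minimal_support:
  assumes K: "subgroup K G" "K \<subseteq> H" "K \<noteq> {\<one>}"
    and minimal: "\<And>X. \<lbrakk>subgroup X G; X \<subseteq> K\<rbrakk> \<Longrightarrow> X = {\<one>} \<or> X = K"
  shows "finite (twisted_chars N K)" "card (twisted_chars N K) \<le> card N"
proof -
  obtain k where k: "k \<in> K" "k \<noteq> \<one>" using K subgroup.one_closed by blast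
  have D: "coideal_datum N K l" if "l \<in> twisted_chars N K" for l
    using that K subgroup_N by (auto simp: coideal_datum_def)
  have KH: "h \<in> H" if "h \<in> K" for h using that K(2) by blast
  have determined: "l = l'"
    if l: "l \<in> twisted_chars N K" and l': "l' \<in> twisted_chars N K" and eq: "l k = l' k" for l l'
  proof -
    note t = twisted_charsD[OF l] and t' = twisted_charsD[OF l']
    let ?X = "{h \<in> K. l h = l' h}"
    have one: "l \<one> = l' \<one>"
    proof
      show "l \<one> m = l' \<one> m" for m
        using twisted_char_one[OF D[OF l], of m] twisted_char_one[OF D[OF l'], of m] t(1) t'(1)
        by (cases "m \<in> N") auto
    qed
    have "subgroup ?X G"
    proof (rule subgroupI)
      show "?X \<subseteq> carrier G" using KH by auto
      show "?X \<noteq> {}" using k eq by blast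
      show "inv h \<in> ?X" if "h \<in> ?X" for h
      proof -
        have h: "h \<in> K" "l h = l' h" "h \<in> H" using that KH by auto
        have ih: "inv h \<in> K" using h subgroup.m_inv_closed[OF K(1)] by blast
        have "l (inv h) n = l' (inv h) n" for n
        proof (cases "n \<in> N")
          case True
          define m where "m = cj n (inv h)"
          have m: "m \<in> N" "cj m h = n" using True h by (simp_all add: m_def)
          have "l h m * l (inv h) n * \<xi> m h (inv h) = l' h m * l' (inv h) n * \<xi> m h (inv h)"
            using t(4)[OF h(1) ih m(1)] t'(4)[OF h(1) ih m(1)] one m h(3) by simp
          then show ?thesis
            using h m xi_nonzero[OF m(1) h(3), of "inv h"] coideal_datumD(7)[OF D[OF l'] h(1) m(1)] by simp
        qed (use t(1) t'(1) in simp)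
        then show ?thesis using ih by blast
      qed
      show "h \<otimes> g \<in> ?X" if "h \<in> ?X" "g \<in> ?X" for h g
      proof -
        have hg: "h \<in> K" "g \<in> K" "l h = l' h" "l g = l' g" using that by auto
        have hgK: "h \<otimes> g \<in> K" using hg subgroup.m_closed[OF K(1)] by blast
        have "l (h \<otimes> g) m = l' (h \<otimes> g) m" for m
          using t(4)[OF hg(1,2), of m] t'(4)[OF hg(1,2), of m] hg(3,4) t(1) t'(1)
          by (cases "m \<in> N") auto
        then show ?thesis using hgK by blast
      qed
    qed
    then have "?X = K" using minimal[of ?X] k eq by blast
    then show "l = l'" using t(1) t'(1) by (fastforce simp: fun_eq_iff)
  qed
  have "finite (twisted_chars N K) \<and> card (twisted_chars N K) \<le> card (chars N)"
  proof (cases "twisted_chars N K = {}")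
    case False
    then obtain l0 where l0: "l0 \<in> twisted_chars N K" by blast
    let ?f = "\<lambda>l m. l k m * cnj (l0 k m)"
    have inj: "inj_on ?f (twisted_chars N K)"
    proof (rule inj_onI)
      fix l l' assume l: "l \<in> twisted_chars N K" and l': "l' \<in> twisted_chars N K" and eq: "?f l = ?f l'"
      have "l k m = l' k m" for m
        using twisted_char_eqI[OF D[OF l] D[OF l'] D[OF l0] fun_cong[OF eq, of m]] .
      then show "l = l'" using determined[OF l l'] by blast
    qed
    have img: "?f ` twisted_chars N K \<subseteq> chars N"
    proof (rule image_subsetI)
      fix l assume "l \<in> twisted_chars N K"
      from twisted_char_quotient_cocycle[OF D[OF this] D[OF l0]] k(1)
      show "?f l \<in> chars N" by (auto simp: char_cocycles_def)
    qed
    note fin = card_chars(1)[OF subgroup_N finite_N]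
    show ?thesis using inj_on_finite[OF inj img fin] card_inj_on_le[OF inj img fin] by blast
  qed simp
  then show "finite (twisted_chars N K)" "card (twisted_chars N K) \<le> card N"
    using card_chars(2)[OF subgroup_N finite_N] by auto
qed

definition minimal_stabilizers :: "'a set set"
  where "minimal_stabilizers = {M. subgroup M G \<and> M \<subseteq> N \<and> M \<noteq> {\<one>} \<and> (\<forall>m\<in>M. \<forall>h\<in>H. cj m h \<in> M) \<and>
    (\<forall>X. subgroup X G \<longrightarrow> X \<subseteq> M \<longrightarrow> (\<forall>m\<in>X. \<forall>h\<in>H. cj m h \<in> X) \<longrightarrow> X = {\<one>} \<or> X = M)}"

definition minimal_supports :: "'a set set"
  where "minimal_supports = {K. subgroup K G \<and> K \<subseteq> H \<and> K \<noteq> {\<one>} \<and>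
    (\<forall>X. subgroup X G \<longrightarrow> X \<subseteq> K \<longrightarrow> X = {\<one>} \<or> X = K)}"

text \<open>Shrinking M to the identity with K kept enlarges B, so the result is B or the whole
  algebra. In the first case the intermediate coideals come from subgroups between K and H; in the
  second K = H, and an H-invariant subgroup of M would give an intermediate coideal. Only invariance
  under H enters, not normality in N.\<close>

lemma maximal_right_coideal_cases:
  assumes "maximal_right_coideal B"
  shows "(\<exists>K. group.maximal_subgroup (G\<lparr>carrier := H\<rparr>) K \<and> B = coideal_of {\<one>} K (trivial_datum {\<one>} K)) \<or>
    (\<exists>M\<in>minimal_stabilizers. \<exists>l\<in>twisted_chars M H. B = coideal_of M H l)"
proof -
  have B: "right_coideal B" "B \<noteq> alg"
    and max: "\<And>C. \<lbrakk>right_coideal C; B \<subseteq> C\<rbrakk> \<Longrightarrow> C = B \<or> C = alg"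
    using assms unfolding maximal_right_coideal_def by blast+
  obtain M K l where D: "coideal_datum M K l" and Bl: "B = coideal_of M K l"
    using right_coideal_cases[OF B(1)] .
  note d = coideal_datumD[OF D]
  have one: "{\<one>} \<subseteq> M" using subgroup.one_closed[OF d(1)] by blast
  let ?l1 = "trivial_datum {\<one>} K"
  have D1: "coideal_datum {\<one>} K ?l1" by (rule coideal_datum_trivial_stabilizer[OF d(3,4)])
  have "B \<subseteq> coideal_of {\<one>} K ?l1"
    unfolding Bl by (rule coideal_of_mono[OF one order_refl]) (use twisted_char_at_one[OF D] in simp)
  then consider "coideal_of {\<one>} K ?l1 = B" | "coideal_of {\<one>} K ?l1 = alg"
    using max[OF right_coideal_coideal_of[OF D1]] by blast
  then show ?thesis
  proof cases
    case 1
    have "group.maximal_subgroup (G\<lparr>carrier := H\<rparr>) K"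
    proof (rule maximal_subgroup_of_subgroupI[OF subgroup_H d(3,4)])
      show "K \<noteq> H" using 1 B(2) alg_eq_coideal_of by auto
      fix L assume L: "subgroup L G" "K \<subseteq> L" "L \<subseteq> H"
      note DL = coideal_datum_trivial_stabilizer[OF L(1,3)]
      have "B \<subseteq> coideal_of {\<one>} L (trivial_datum {\<one>} L)"
        unfolding 1[symmetric] by (rule coideal_of_mono[OF order_refl L(2)]) (use L(2) in auto)
      then have "coideal_of {\<one>} L (trivial_datum {\<one>} L) = coideal_of {\<one>} K ?l1 \<or>
        coideal_of {\<one>} L (trivial_datum {\<one>} L) = coideal_of {\<one>} H (trivial_datum {\<one>} H)"
        using max[OF right_coideal_coideal_of[OF DL]] unfolding 1 alg_eq_coideal_of[symmetric] by blast
      then show "L = K \<or> L = H"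
        using coideal_of_subsetD(1)[OF DL D1] coideal_of_subsetD(1)[OF D1 DL] L
          coideal_of_subsetD(1)[OF coideal_datum_trivial_stabilizer[OF subgroup_H order_refl] DL] by blast
    qed
    then show ?thesis using 1 by blast
  next
    case 2
    have DH: "coideal_datum {\<one>} H (trivial_datum {\<one>} H)"
      by (rule coideal_datum_trivial_stabilizer[OF subgroup_H order_refl])
    have KH: "K = H"
      using coideal_of_subsetD(1)[OF DH D1] 2 d(4) unfolding alg_eq_coideal_of by blast
    have M1: "M \<noteq> {\<one>}"
    proof
      assume "M = {\<one>}"
      then show False
        using D Bl B(2) coideal_of_trivial_stabilizer_eq[of K l] unfolding KH alg_eq_coideal_of by simp
    qed
    have "X = {\<one>} \<or> X = M"
      if X: "subgroup X G" "X \<subseteq> M" "\<forall>m\<in>X. \<forall>h\<in>H. cj m h \<in> X" for X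
    proof -
      let ?lX = "\<lambda>h m. if h \<in> H \<and> m \<in> X then l h m else 0"
      have DX: "coideal_datum X H ?lX"
        by (rule coideal_datum_restrict[OF D X(1,2) subgroup_H]) (use KH X(3) in auto)
      have "B \<subseteq> coideal_of X H ?lX"
        unfolding Bl by (rule coideal_of_mono[OF X(2)]) (use KH in auto)
      then have "coideal_of X H ?lX = coideal_of M K l \<or>
        coideal_of X H ?lX = coideal_of {\<one>} H (trivial_datum {\<one>} H)"
        using max[OF right_coideal_coideal_of[OF DX]] unfolding Bl alg_eq_coideal_of by blast
      then show ?thesis
        using coideal_of_subsetD(2)[OF DX D] X(2) subgroup.one_closed[OF X(1)]
          coideal_of_subsetD(2)[OF DH DX] by blast
    qed
    then have "M \<in> minimal_stabilizers" using d(1,2,5) M1 KH by (simp add: minimal_stabilizers_def)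
    then show ?thesis using Bl d(6) KH by blast
  qed
qed

text \<open>Dually, shrinking K to the identity with M kept gives a coideal inside B, which is B or
  the scalars. The latter means M = N, and then every subgroup of K gives a coideal inside B by
  restricting l.\<close>

lemma minimal_right_coideal_cases:
  assumes "minimal_right_coideal B"
  shows "(\<exists>M. group.maximal_subgroup (G\<lparr>carrier := N\<rparr>) M \<and> B = coideal_of M {\<one>} (trivial_datum M {\<one>})) \<or>
    (\<exists>K\<in>minimal_supports. \<exists>l\<in>twisted_chars N K. B = coideal_of N K l)"
proof -
  let ?C1 = "coideal_of N {\<one>} (trivial_datum N {\<one>})"
  have B: "right_coideal B" "B \<noteq> ?C1"
    and min: "\<And>C. \<lbrakk>right_coideal C; C \<subseteq> B\<rbrakk> \<Longrightarrow> C = B \<or> C = ?C1"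
    using assms unfolding minimal_right_coideal_def span_one_eq_coideal_of by blast+
  obtain M K l where D: "coideal_datum M K l" and Bl: "B = coideal_of M K l"
    using right_coideal_cases[OF B(1)] .
  note d = coideal_datumD[OF D]
  have one: "{\<one>} \<subseteq> K" using subgroup.one_closed[OF d(3)] by blast
  let ?l1 = "trivial_datum M {\<one>}"
  have D1: "coideal_datum M {\<one>} ?l1" by (rule coideal_datum_trivial_support[OF d(1,2)])
  have DN: "coideal_datum N {\<one>} (trivial_datum N {\<one>})"
    by (rule coideal_datum_trivial_support[OF subgroup_N order_refl])
  have "coideal_of M {\<one>} ?l1 \<subseteq> B"
    unfolding Bl by (rule coideal_of_mono[OF order_refl one]) (use twisted_char_one[OF D] in simp)
  then consider "coideal_of M {\<one>} ?l1 = B" | "coideal_of M {\<one>} ?l1 = ?C1"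
    using min[OF right_coideal_coideal_of[OF D1]] by blast
  then show ?thesis
  proof cases
    case 1
    have "group.maximal_subgroup (G\<lparr>carrier := N\<rparr>) M"
    proof (rule maximal_subgroup_of_subgroupI[OF subgroup_N d(1,2)])
      show "M \<noteq> N" using 1 B(2) by auto
      fix L assume L: "subgroup L G" "M \<subseteq> L" "L \<subseteq> N"
      note DL = coideal_datum_trivial_support[OF L(1,3)]
      have "coideal_of L {\<one>} (trivial_datum L {\<one>}) \<subseteq> B"
        unfolding 1[symmetric] by (rule coideal_of_mono[OF L(2) order_refl]) (use L(2) in auto)
      then have "coideal_of L {\<one>} (trivial_datum L {\<one>}) = coideal_of M {\<one>} ?l1 \<or>
        coideal_of L {\<one>} (trivial_datum L {\<one>}) = ?C1"
        using min[OF right_coideal_coideal_of[OF DL]] unfolding 1 by blast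
      then show "L = M \<or> L = N"
        using coideal_of_subsetD(2)[OF DL D1] coideal_of_subsetD(2)[OF D1 DL] L
          coideal_of_subsetD(2)[OF DL DN] by blast
    qed
    then show ?thesis using 1 by blast
  next
    case 2
    have MN: "M = N" using coideal_of_subsetD(2)[OF D1 DN] 2 d(2) by blast
    have K1: "K \<noteq> {\<one>}"
    proof
      assume "K = {\<one>}"
      then show False using D Bl B(2) coideal_of_trivial_support_eq[of M l] MN by simp
    qed
    have "X = {\<one>} \<or> X = K" if X: "subgroup X G" "X \<subseteq> K" for X
    proof -
      let ?lX = "\<lambda>h m. if h \<in> X \<and> m \<in> N then l h m else 0"
      have DX: "coideal_datum N X ?lX"
        by (rule coideal_datum_restrict[OF D subgroup_N _ X]) (use MN X(2) d(4) in auto)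
      have "coideal_of N X ?lX \<subseteq> B"
        unfolding Bl by (rule coideal_of_mono[OF _ X(2)]) (use MN in auto)
      then have "coideal_of N X ?lX = coideal_of M K l \<or> coideal_of N X ?lX = ?C1"
        using min[OF right_coideal_coideal_of[OF DX]] unfolding Bl by blast
      then show ?thesis
        using coideal_of_subsetD(1)[OF D DX] X(2) subgroup.one_closed[OF X(1)]
          coideal_of_subsetD(1)[OF DX DN] by blast
    qed
    then have "K \<in> minimal_supports" using d(3,4) K1 by (simp add: minimal_supports_def)
    then show ?thesis using Bl d(6) MN by blast
  qed
qed

lemma card_maximal_subgroups_of_less:
  assumes "subgroup S G" "solvable (G\<lparr>carrier := S\<rparr>)"
  shows "finite {K. group.maximal_subgroup (G\<lparr>carrier := S\<rparr>) K}"
    "card {K. group.maximal_subgroup (G\<lparr>carrier := S\<rparr>) K} \<le> card S - 1"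
proof -
  interpret S: group "G\<lparr>carrier := S\<rparr>" using subgroup_imp_group[OF assms(1)] .
  have fin: "finite S" using subgroup.subset[OF assms(1)] finite_G finite_subset by blast
  have "{K. S.maximal_subgroup K} \<subseteq> Pow S"
  proof
    fix K assume "K \<in> {K. S.maximal_subgroup K}"
    then have "subgroup K (G\<lparr>carrier := S\<rparr>)" by (simp add: S.maximal_subgroup_def)
    then show "K \<in> Pow S" using subgroup.subset by fastforce
  qed
  then show "finite {K. S.maximal_subgroup K}" using fin finite_subset by blast
  show "card {K. S.maximal_subgroup K} \<le> card S - 1"
    using S.card_maximal_subgroups_less assms(2) fin by simp
qed

lemma card_pos: "card N > 0" "card H > 0"
  using card_gt_0_iff finite_N finite_H N_closed(3) H_closed(3) by blast+

theorem card_maximal_right_coideals: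
  assumes "solvable (G\<lparr>carrier := H\<rparr>)"
  shows "finite {B. maximal_right_coideal B}" "card {B. maximal_right_coideal B} < card N * card H"
proof -
  let ?X = "(\<lambda>K. coideal_of {\<one>} K (trivial_datum {\<one>} K)) ` {K. group.maximal_subgroup (G\<lparr>carrier := H\<rparr>) K}"
  let ?Y = "\<Union>M\<in>minimal_stabilizers. coideal_of M H ` twisted_chars M H"
  have sub: "{B. maximal_right_coideal B} \<subseteq> ?X \<union> ?Y"
    using maximal_right_coideal_cases by blast
  note X = card_maximal_subgroups_of_less[OF subgroup_H assms]
  have S: "subgroup M G" "M \<subseteq> N" "M \<noteq> {\<one>}" "\<And>m h. \<lbrakk>m \<in> M; h \<in> H\<rbrakk> \<Longrightarrow> cj m h \<in> M"
    "\<And>X. \<lbrakk>subgroup X G; X \<subseteq> M; \<And>m h. \<lbrakk>m \<in> X; h \<in> H\<rbrakk> \<Longrightarrow> cj m h \<in> X\<rbrakk> \<Longrightarrow> X = {\<one>} \<or> X = M"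
    if "M \<in> minimal_stabilizers" for M
    using that unfolding minimal_stabilizers_def by blast+
  have finS: "finite minimal_stabilizers"
    by (rule finite_subset[of _ "Pow N"]) (use S(2) finite_N in auto)
  have T: "finite (twisted_chars M H) \<and> card (twisted_chars M H) \<le> (card M - 1) * card H"
    if "M \<in> minimal_stabilizers" for M
    using card_twisted_chars_minimal_stabilizer[OF S(1-3)[OF that] assms S(4,5)[OF that]] by blast
  have Y: "finite ?Y" "card ?Y \<le> (\<Sum>M\<in>minimal_stabilizers. (card M - 1) * card H)"
    by (rule card_UN_image_le[OF finS T], assumption)+
  have "(\<Sum>M\<in>minimal_stabilizers. card M - 1) \<le> card N - 1"
  proof (rule sum_card_minus_one_le[OF finite_N, where e = \<one>])
    fix M M' assume M: "M \<in> minimal_stabilizers" and M': "M' \<in> minimal_stabilizers" and ne: "M \<noteq> M'"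
    have "subgroup (M \<inter> M') G" using subgroups_Inter_pair[OF S(1)[OF M] S(1)[OF M']] .
    then have "M \<inter> M' = {\<one>} \<or> M \<inter> M' = M" "M \<inter> M' = {\<one>} \<or> M \<inter> M' = M'"
      using S(5)[OF M, of "M \<inter> M'"] S(5)[OF M', of "M \<inter> M'"] S(4)[OF M] S(4)[OF M'] by blast+
    then show "M \<inter> M' \<subseteq> {\<one>}" using ne by blast
  qed (use S in \<open>auto simp: subgroup.one_closed\<close>)
  then have sumle: "(\<Sum>M\<in>minimal_stabilizers. (card M - 1) * card H) \<le> (card N - 1) * card H"
    by (simp add: sum_distrib_right[symmetric])
  have finXY: "finite (?X \<union> ?Y)" using X(1) Y(1) by blast
  then show "finite {B. maximal_right_coideal B}" using sub finite_subset by blast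
  have "card {B. maximal_right_coideal B} \<le> card (?X \<union> ?Y)" by (rule card_mono[OF finXY sub])
  also have "\<dots> \<le> card ?X + card ?Y" by (rule card_Un_le)
  also have "\<dots> \<le> (card H - 1) + (card N - 1) * card H"
    using card_image_le[OF X(1), of "\<lambda>K. coideal_of {\<one>} K (trivial_datum {\<one>} K)"] X(2) Y(2) sumle by linarith
  also have "\<dots> < card N * card H" using card_pos by (cases "card N"; cases "card H") auto
  finally show "card {B. maximal_right_coideal B} < card N * card H" .
qed

theorem card_minimal_right_coideals:
  assumes "solvable (G\<lparr>carrier := N\<rparr>)"
  shows "finite {B. minimal_right_coideal B}" "card {B. minimal_right_coideal B} < card N * card H"
proof -
  let ?X = "(\<lambda>M. coideal_of M {\<one>} (trivial_datum M {\<one>})) ` {M. group.maximal_subgroup (G\<lparr>carrier := N\<rparr>) M}"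
  let ?Y = "\<Union>K\<in>minimal_supports. coideal_of N K ` twisted_chars N K"
  have sub: "{B. minimal_right_coideal B} \<subseteq> ?X \<union> ?Y"
    using minimal_right_coideal_cases by blast
  note X = card_maximal_subgroups_of_less[OF subgroup_N assms]
  have S: "subgroup K G" "K \<subseteq> H" "K \<noteq> {\<one>}" "\<And>X. \<lbrakk>subgroup X G; X \<subseteq> K\<rbrakk> \<Longrightarrow> X = {\<one>} \<or> X = K"
    if "K \<in> minimal_supports" for K
    using that unfolding minimal_supports_def by blast+
  have finS: "finite minimal_supports"
    by (rule finite_subset[of _ "Pow H"]) (use S(2) finite_H in auto)
  have T: "finite (twisted_chars N K) \<and> card (twisted_chars N K) \<le> card N"
    if "K \<in> minimal_supports" for K
    using card_twisted_chars_minimal_support[OF S[OF that]] by blast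
  have Y: "finite ?Y" "card ?Y \<le> (\<Sum>K\<in>minimal_supports. card N)"
    by (rule card_UN_image_le[OF finS T], assumption)+
  \<comment> \<open>Each minimal support owns a nonidentity element, so there are at most |H| - 1 of
    them, each with at most |N| families. Together with at most |N| - 1 maximal subgroups of N this
    makes |N| |H| - 1.\<close>
  have "card minimal_supports = (\<Sum>K\<in>minimal_supports. 1)" by simp
  also have "\<dots> \<le> (\<Sum>K\<in>minimal_supports. card K - 1)"
  proof (rule sum_mono)
    fix K assume K: "K \<in> minimal_supports"
    have "{\<one>} \<subset> K" using S(1,3)[OF K] subgroup.one_closed by blast
    moreover have "finite K" using S(2)[OF K] finite_H finite_subset by blast
    ultimately have "card {\<one>} < card K" by (rule psubset_card_mono[rotated])
    then show "1 \<le> card K - 1" by simp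
  qed
  also have "\<dots> \<le> card H - 1"
  proof (rule sum_card_minus_one_le[OF finite_H, where e = \<one>])
    fix K K' assume K: "K \<in> minimal_supports" and K': "K' \<in> minimal_supports" and ne: "K \<noteq> K'"
    have "subgroup (K \<inter> K') G" using subgroups_Inter_pair[OF S(1)[OF K] S(1)[OF K']] .
    then have "K \<inter> K' = {\<one>} \<or> K \<inter> K' = K" "K \<inter> K' = {\<one>} \<or> K \<inter> K' = K'"
      using S(4)[OF K, of "K \<inter> K'"] S(4)[OF K', of "K \<inter> K'"] by blast+
    then show "K \<inter> K' \<subseteq> {\<one>}" using ne by blast
  qed (use S in \<open>auto simp: subgroup.one_closed\<close>)
  finally have "(\<Sum>K\<in>minimal_supports. card N) \<le> (card H - 1) * card N" by simp
  then have Yle: "card ?Y \<le> (card H - 1) * card N" using Y(2) by linarith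
  have finXY: "finite (?X \<union> ?Y)" using X(1) Y(1) by blast
  then show "finite {B. minimal_right_coideal B}" using sub finite_subset by blast
  have "card {B. minimal_right_coideal B} \<le> card (?X \<union> ?Y)" by (rule card_mono[OF finXY sub])
  also have "\<dots> \<le> card ?X + card ?Y" by (rule card_Un_le)
  also have "\<dots> \<le> (card N - 1) + (card H - 1) * card N"
    using card_image_le[OF X(1), of "\<lambda>M. coideal_of M {\<one>} (trivial_datum M {\<one>})"] X(2) Yle by linarith
  also have "\<dots> < card N * card H" using card_pos by (cases "card N"; cases "card H") auto
  finally show "card {B. minimal_right_coideal B} < card N * card H" .
qed

end

text \<open>Finiteness is asserted separately because \<open>card\<close> is 0 on infinite sets,
  where the inequalities alone would say nothing.\<close>

theorem theorem3p8:
  fixes G :: "('a, 'b) monoid_scheme"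
    and N H :: "'a set"
    and \<eta> \<xi> :: "'a \<Rightarrow> 'a \<Rightarrow> 'a \<Rightarrow> complex"
  assumes "izumi_kosaki G N H \<eta> \<xi>"
    and "solvable (G\<lparr>carrier := N\<rparr>)"
    and "solvable (G\<lparr>carrier := H\<rparr>)"
  shows "finite {B. izumi_kosaki.maximal_right_coideal G N H \<eta> \<xi> B} \<and>
    card {B. izumi_kosaki.maximal_right_coideal G N H \<eta> \<xi> B} < cfun.dim (izumi_kosaki.alg N H) \<and>
    finite {B. izumi_kosaki.minimal_right_coideal G N H \<eta> \<xi> B} \<and>
    card {B. izumi_kosaki.minimal_right_coideal G N H \<eta> \<xi> B} < cfun.dim (izumi_kosaki.alg N H)"
  unfolding izumi_kosaki.dim_alg[OF assms(1)]
  using izumi_kosaki.card_maximal_right_coideals[OF assms(1,3)]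
    izumi_kosaki.card_minimal_right_coideals[OF assms(1,2)] by blast

end
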